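(* Let $\mathbf{k}$ be a field, $R=\mathbf{k}[s,u,t,v]$ the bigraded coordinate ring of $\mathbf{P}^1\times\mathbf{P}^1$, and let $I=\langle f_1,f_2,f_3\rangle\subset R$, where $f_i$ is bihomogeneous of bidegree $(d_i,d_i')$ for $i=1,2,3$. Suppose that $I$ has codimension two in $R$. Let $K\subset\bigoplus_{i=1}^3R(-d_i,-d_i')$ be the module of Koszul syzygies on $f_1,f_2,f_3$, and $V\subset\bigoplus_{i=1}^3R(-d_i,-d_i')$ the module of syzygies on $f_1,f_2,f_3$ vanishing at the base points of $I$. Then $K^{\mathrm{sat}}=V$ if and only if $I$ is a local complete intersection.
   Context: The ring $R=\mathbf{k}[s,u,t,v]$ is bigraded with $s,u$ of bidegree $(1,0)$ and $t,v$ of bidegree $(0,1)$; $\mathbf{m}=\langle st,sv,ut,uv\rangle$ is the irrelevant ideal. $Z=\mathbb{V}(I)\subset\mathbf{P}^1\times\mathbf{P}^1$ is the base point locus (it is finite when $I$ has codimension two), and $\mathcal{I}$ is the ideal sheaf on $\mathbf{P}^1\times\mathbf{P}^1$ defined by $I$. Saturation: for a bigraded submodule $M$ of a finitely generated bigraded free $R$-module $F$, $M^{\mathrm{sat}}=\{x\in F:\mathbf{m}^jx\subset M\text{ for some }j\}$. In particular $I^{\mathrm{sat}}=\{r\in R:\mathbf{m}^jr\subset I\text{ for some }j\}$. The saturation $K^{\mathrm{sat}}$ is taken in $F=\bigoplus_{i=1}^3R(-d_i,-d_i')$. $K$ is the submodule of $\bigoplus_{i=1}^3R(-d_i,-d_i')$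 generated by the columns $(f_2,-f_1,0)^T$, $(f_3,0,-f_1)^T$, $(0,f_3,-f_2)^T$. $V$ is the set of $(a_1,a_2,a_3)\in\bigoplus_{i=1}^3R(-d_i,-d_i')$ with $a_1f_1+a_2f_2+a_3f_3=0$ and $a_i\in I^{\mathrm{sat}}$ for $i=1,2,3$. $I$ is a local complete intersection (LCI) if for every point $p\in Z$ the stalk $\mathcal{I}_p\subset\mathcal{O}_{\mathbf{P}^1\times\mathbf{P}^1,p}$ is generated by a regular sequence. *)

theory Defs
  imports
    "HOL-Analysis.Cartesian_Space"
    "HOL-Computational_Algebra.Fraction_Field"
    "HOL-Computational_Algebra.Polynomial"
    "HOL-Library.Extended_Nat"
begin

section \<open>Ideals and submodules of the free module of rank three\<close>

text \<open>
  The ideals of a commutative ring are the submodules of the ring over itself: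
  ideal.subspace means "is an ideal" and ideal.span is the ideal generated by a set.
  Likewise free.span is the submodule generated by a set of vectors.
\<close>

interpretation ideal: module "(*) :: 'a \<Rightarrow> 'a \<Rightarrow> 'a::comm_ring_1"
  by unfold_locales (simp_all add: algebra_simps)

interpretation free: module "(*s) :: 'a \<Rightarrow> 'a ^ 'n \<Rightarrow> 'a::comm_ring_1 ^ 'n"
  by (rule module.intro)
    (simp_all only: vec_eq_iff vector_add_component vector_smult_component
      distrib_left distrib_right mult.assoc mult_1_left simp_thms)

definition prime_ideal :: "'a::comm_ring_1 set \<Rightarrow> bool" where
  "prime_ideal P \<longleftrightarrow>
     ideal.subspace P \<and> 1 \<notin> P \<and> (\<forall>a b. a * b \<in> P \<longrightarrow> a \<in> P \<or> b \<in> P)"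

primrec ideal_power :: "'a::comm_ring_1 set \<Rightarrow> nat \<Rightarrow> 'a set" where
  "ideal_power J 0 = UNIV"
| "ideal_power J (Suc j) = ideal.span {a * b |a b. a \<in> J \<and> b \<in> ideal_power J j}"

text \<open>The height of a prime is the supremum of the lengths of the chains
  \<open>C 0 \<subset> \<dots> \<subset> C n = P\<close> of primes.\<close>

definition height :: "'a::comm_ring_1 set \<Rightarrow> enat" where
  "height P = Sup {enat n |n. \<exists>C :: nat \<Rightarrow> 'a set.
     (\<forall>i\<le>n. prime_ideal (C i)) \<and> (\<forall>i<n. C i \<subset> C (Suc i)) \<and> C n = P}"

text \<open>The unit ideal has codimension \<open>\<infinity>\<close>.\<close>

definition codim :: "'a::comm_ring_1 set \<Rightarrow> enat" where
  "codim J = Inf {height P |P. prime_ideal P \<and> J \<subseteq> P}"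


section \<open>The bigraded coordinate ring of the product of two projective lines\<close>

text \<open>\<open>k[s,u,t,v]\<close> is encoded as \<open>k[s][u][t][v]\<close>: the variable \<open>s\<close> is the innermost one and
  \<open>v\<close> the outermost one.\<close>

type_synonym 'k bipoly = "'k poly poly poly poly"

definition var_s :: "'k::field bipoly" where "var_s = [:[:[:[:0, 1:]:]:]:]"
definition var_u :: "'k::field bipoly" where "var_u = [:[:[:0, 1:]:]:]"
definition var_t :: "'k::field bipoly" where "var_t = [:[:0, 1:]:]"
definition var_v :: "'k::field bipoly" where "var_v = [:0, 1:]"

text \<open>\<open>mcoeff p a b c d\<close> is the coefficient of \<open>s\<^sup>a u\<^sup>b t\<^sup>c v\<^sup>d\<close> in \<open>p\<close>.\<close>

definition mcoeff :: "'k::field bipoly \<Rightarrow> nat \<Rightarrow> nat \<Rightarrow> nat \<Rightarrow> nat \<Rightarrow> 'k" where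
  "mcoeff p a b c d = coeff (coeff (coeff (coeff p d) c) b) a"

text \<open>As usual, \<open>0\<close> is bihomogeneous of every bidegree.\<close>

definition bihomogeneous :: "nat \<Rightarrow> nat \<Rightarrow> 'k::field bipoly \<Rightarrow> bool" where
  "bihomogeneous m n p \<longleftrightarrow>
     (\<forall>a b c d. mcoeff p a b c d \<noteq> 0 \<longrightarrow> a + b = m \<and> c + d = n)"

definition irrelevant_ideal :: "'k::field bipoly set" where
  "irrelevant_ideal =
     ideal.span {var_s * var_t, var_s * var_v, var_u * var_t, var_u * var_v}"

text \<open>The first argument is the scalar multiplication of the ambient module: \<open>(*)\<close> for ideals,
  \<open>(*s)\<close> for submodules of a free module.\<close>

definition saturation ::
  "('k::field bipoly \<Rightarrow> 'm \<Rightarrow> 'm) \<Rightarrow> 'm set \<Rightarrow> 'm set" where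
  "saturation smul M =
     {x. \<exists>j. \<forall>r \<in> ideal_power irrelevant_ideal j. smul r x \<in> M}"


section \<open>Points, stalks and local complete intersections\<close>

text \<open>Since the field need not be algebraically closed, points are those of the scheme
  \<open>P\<^sup>1 \<times> P\<^sup>1\<close>, i.e. the bihomogeneous prime ideals that do not contain the irrelevant ideal.\<close>

definition bihomogeneous_ideal :: "'k::field bipoly set \<Rightarrow> bool" where
  "bihomogeneous_ideal J \<longleftrightarrow> J = ideal.span {p \<in> J. \<exists>m n. bihomogeneous m n p}"

definition points :: "'k::field bipoly set set" where
  "points = {P. prime_ideal P \<and> bihomogeneous_ideal P \<and> \<not> irrelevant_ideal \<subseteq> P}"

definition base_locus :: "'k::field bipoly set \<Rightarrow> 'k bipoly set set" where
  "base_locus J = {P \<in> points. J \<subseteq> P}"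

text \<open>The local ring at \<open>P\<close> and the stalk at \<open>P\<close> of the ideal sheaf of \<open>J\<close> are the
  bidegree \<open>(0,0)\<close> parts of the bihomogeneous localizations of the ring and of \<open>J\<close> at \<open>P\<close>,
  both realized inside the fraction field.\<close>

definition local_ring :: "'k::field bipoly set \<Rightarrow> 'k bipoly fract set" where
  "local_ring P = {Fract a b |a b m n.
     bihomogeneous m n a \<and> bihomogeneous m n b \<and> b \<notin> P}"

definition ideal_stalk ::
  "'k::field bipoly set \<Rightarrow> 'k bipoly set \<Rightarrow> 'k bipoly fract set" where
  "ideal_stalk J P = {Fract a b |a b m n.
     a \<in> J \<and> bihomogeneous m n a \<and> bihomogeneous m n b \<and> b \<notin> P}"

text \<open>In the following two definitions, \<open>A\<close> is a subring of the ambient ring.\<close>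

definition generated_ideal :: "'a::comm_ring_1 set \<Rightarrow> 'a list \<Rightarrow> 'a set" where
  "generated_ideal A xs =
     {\<Sum>i<length xs. c i * xs ! i |c. \<forall>i<length xs. c i \<in> A}"

definition regular_sequence :: "'a::comm_ring_1 set \<Rightarrow> 'a list \<Rightarrow> bool" where
  "regular_sequence A xs \<longleftrightarrow>
     set xs \<subseteq> A \<and>
     (\<forall>i<length xs. \<forall>a\<in>A. a * xs ! i \<in> generated_ideal A (take i xs) \<longrightarrow>
        a \<in> generated_ideal A (take i xs)) \<and>
     1 \<notin> generated_ideal A xs"

definition local_complete_intersection :: "'k::field bipoly set \<Rightarrow> bool" where
  "local_complete_intersection J \<longleftrightarrow>
     (\<forall>P \<in> base_locus J. \<exists>xs. regular_sequence (local_ring P) xs \<and>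
        ideal_stalk J P = generated_ideal (local_ring P) xs)"


section \<open>Koszul syzygies and syzygies vanishing at the base points\<close>

definition generated_by :: "'k::field bipoly ^ 3 \<Rightarrow> 'k bipoly set" where
  "generated_by f = ideal.span {f $ 1, f $ 2, f $ 3}"

definition koszul_syzygies :: "'k::field bipoly ^ 3 \<Rightarrow> ('k bipoly ^ 3) set" where
  "koszul_syzygies f = free.span
     {vector [f $ 2, - f $ 1, 0], vector [f $ 3, 0, - f $ 1], vector [0, f $ 3, - f $ 2]}"

definition vanishing_syzygies :: "'k::field bipoly ^ 3 \<Rightarrow> ('k bipoly ^ 3) set" where
  "vanishing_syzygies f =
     {a. a $ 1 * f $ 1 + a $ 2 * f $ 2 + a $ 3 * f $ 3 = 0 \<and>
         (\<forall>i. a $ i \<in> saturation (*) (generated_by f))}"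

end

theory Submission
  imports Defs "Berlekamp_Zassenhaus.Unique_Factorization_Poly"
begin

text \<open>
  Write \<open>I\<close> for the ideal of the \<open>f\<^sub>i\<close>, \<open>K\<close> for the Koszul syzygies, which are the cross products
  \<open>p \<times> f\<close>, and \<open>V\<close> for the syzygies with entries in the saturation of \<open>I\<close>.
  The hypothesis on the codimension enters only through one consequence, valid in a factorial ring:
  no prime element divides all \<open>f\<^sub>i\<close>, since a principal prime has height at most one.

  Both sides of the equivalence are local. For a prime \<open>P\<close> let \<open>I\<^sub>P\<close> and \<open>K\<^sub>P\<close> collect what some
  multiplier outside \<open>P\<close> sends into \<open>I\<close> and \<open>K\<close>; this plays the part of localization but stays
  inside the polynomial ring, where unique factorization is at hand. At a base point both conditions
  turn out to be equivalent to a third one: some \<open>f\<^sub>i\<close> is redundant at \<open>P\<close>, i.e. it lies in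
  \<open>(f\<^sub>j, f\<^sub>k)\<^sub>P\<close> for the two other indices.

  \<^item> Redundancy means complete intersection. If \<open>f\<^sub>i\<close> is redundant, then \<open>f\<^sub>j\<close> and \<open>f\<^sub>k\<close> are coprime at
    \<open>P\<close> and hence a regular sequence (\<open>regular_generators_of_redundant\<close>). Conversely, a regular
    sequence in a two-dimensional local ring has at most two terms (\<open>regular_sequence_length\<close>), and a
    determinant shows that any two generators can be exchanged for two of the \<open>f\<^sub>i\<close>
    (\<open>generator_redundant_of_two_generated\<close>).

  \<^item> Redundancy makes syzygies Koszul. Let \<open>f\<^sub>i\<close> be redundant and let \<open>a\<close> be a syzygy with
    \<open>a\<^sub>i \<in> I\<^sub>P\<close>. Koszul syzygies can be subtracted until \<open>a\<^sub>i = 0\<close>; what remains is a relation between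
    the coprime elements \<open>f\<^sub>j\<close> and \<open>f\<^sub>k\<close>, a multiple of \<open>(f\<^sub>k, - f\<^sub>j)\<close>
    (\<open>koszul_of_generator_redundant\<close>).

  \<^item> The converse is the heart of the matter. At \<open>P\<close> the maximal ideal is generated by two coprime
    elements \<open>x\<close>, \<open>y\<close>, and every element of it has a power in \<open>I\<^sub>P\<close> (\<open>point_structure\<close>). The
    quotient of all syzygies by \<open>K\<^sub>P\<close> is the canonical module of the ring modulo \<open>I\<^sub>P\<close>, so it has a
    one-dimensional socle; a generator \<open>r\<close> of the socle can be written down (\<open>socle_generator\<close>). If all
    entries of \<open>r\<close> were in \<open>I\<^sub>P\<close>, then \<open>r\<close> would lie in \<open>V\<close>, up to a multiplier, but not in \<open>K\<^sub>P\<close>. So if \<open>V\<close> is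
    contained in \<open>K\<^sub>P\<close>, some coordinate \<open>r\<^sub>i\<close> is not in \<open>I\<^sub>P\<close>. As every nonzero submodule contains
    the socle, the map \<open>a \<mapsto> a\<^sub>i mod I\<^sub>P\<close> is injective on the quotient
    (\<open>vanishing_coordinate_suffices\<close>). This gives
    \<open>(f\<^sub>j, f\<^sub>k) : f\<^sub>i\<^sup>2 = (f\<^sub>j, f\<^sub>k) : f\<^sub>i\<close> at \<open>P\<close>, and since a power of \<open>f\<^sub>i\<close> lies in
    \<open>(f\<^sub>j, f\<^sub>k)\<^sub>P\<close>, so does \<open>f\<^sub>i\<close> (\<open>generator_redundant_of_koszul\<close>).

  To pass from the points to the saturation, take \<open>a \<in> V\<close> outside the saturation of \<open>K\<close>. The
  multipliers that send \<open>a\<close> into \<open>K\<close> form an ideal that avoids all powers of some generator of the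
  irrelevant ideal, so it is contained in a prime \<open>Q\<close> without that generator. The bihomogeneous part
  of \<open>Q\<close> is a base point, and redundancy there gives redundancy at \<open>Q\<close>, because its witness can be
  chosen bihomogeneous. Then \<open>a \<in> K\<^sub>Q\<close>, a contradiction (\<open>vanishing_subset_saturation\<close>).
\<close>

no_notation Matrix.vec_index (infixl "$" 100)

(* For ideals this simp rule reads a * (b * x) = (a * b) * x and loops with mult.assoc. *)
declare ideal.scale_scale [simp del]

section \<open>Common prime divisors in factorial rings\<close>

text \<open>The substitute for "the greatest common divisor is 1": it needs no choice of a gcd, and it is the
  form in which a codimension of at least two is used.\<close>

definition no_common_prime :: "'a::comm_semiring_1 set \<Rightarrow> bool" where
  "no_common_prime F \<longleftrightarrow> (\<nexists>\<pi>. prime_elem \<pi> \<and> (\<forall>a\<in>F. \<pi> dvd a))"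

text \<open>Induction on the number of prime factors, counted with multiplicity.\<close>

lemma ufd_induct [consumes 1, case_names unit prime]:
  fixes b :: "'a::ufd"
  assumes "b \<noteq> 0"
    and unit: "\<And>u. u dvd 1 \<Longrightarrow> Q u"
    and step: "\<And>\<pi> c. prime_elem \<pi> \<Longrightarrow> c \<noteq> 0 \<Longrightarrow> Q c \<Longrightarrow> Q (\<pi> * c)"
  shows "Q b"
proof (cases "b dvd 1")
  case False
  then obtain F where F: "mset_factors F b"
    using mset_factors_exist \<open>b \<noteq> 0\<close> by blast
  have "(\<forall>p. p \<in># G \<longrightarrow> irreducible p) \<Longrightarrow> prod_mset G \<noteq> 0 \<and> Q (prod_mset G)" for G :: "'a multiset"
  proof (induction G)
    case empty
    then show ?case using unit by simp
  next
    case (add p G)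
    then show ?case using step[of p "prod_mset G"] by auto
  qed
  with F show ?thesis by (auto elim!: mset_factorsE)
qed (rule unit)

lemma no_common_primeD:
  "no_common_prime F \<Longrightarrow> prime_elem \<pi> \<Longrightarrow> \<exists>a\<in>F. \<not> \<pi> dvd a"
  by (auto simp only: no_common_prime_def)

text \<open>A prime factor of \<open>b\<close> misses some \<open>a \<in> F\<close>, so it divides \<open>p\<close> and can be cancelled on both sides;
  this removes the prime factors of \<open>b\<close> one at a time.\<close>

lemma dvd_if_proportional:
  fixes p b :: "'a::ufd"
  assumes "b \<noteq> 0" "no_common_prime F" "\<forall>a\<in>F. \<exists>c. p * a = c * b"
  shows "b dvd p"
  using assms(1,3)
proof (induction b arbitrary: p rule: ufd_induct)
  case (unit u)
  show ?case by (rule dvd_trans[OF unit(1) one_dvd])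
next
  case (prime \<pi> b)
  obtain a where a: "a \<in> F" "\<not> \<pi> dvd a"
    using no_common_primeD[OF assms(2) prime.hyps(1)] by blast
  obtain c where "p * a = c * (\<pi> * b)" using prime.prems a by blast
  then have "\<pi> dvd p * a" by (metis dvd_triv_left mult.left_commute)
  then have "\<pi> dvd p" using prime_elem_dvd_multD[OF prime.hyps(1)] a(2) by metis
  then obtain p' where p': "p = \<pi> * p'" by (rule dvdE)
  have "\<forall>a\<in>F. \<exists>c. p' * a = c * b"
  proof
    fix a assume "a \<in> F"
    then obtain c where "p * a = c * (\<pi> * b)" using prime.prems by blast
    then have "\<pi> * (p' * a) = \<pi> * (c * b)" unfolding p' by (metis mult.assoc mult.left_commute)
    then have "p' * a = c * b" using prime_elem_not_zeroI[OF prime.hyps(1)] by (metis mult_left_cancel)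
    then show "\<exists>c. p' * a = c * b" by blast
  qed
  then have "b dvd p'" by (rule prime.IH)
  then show ?case unfolding p' by (rule mult_dvd_mono[OF dvd_refl])
qed

lemma proportional_pair:
  fixes a b p q :: "'a::ufd"
  assumes "no_common_prime {a, b}" "a \<noteq> 0 \<or> b \<noteq> 0" "p * b = q * a"
  shows "\<exists>c. p = c * a \<and> q = c * b"
proof (cases "a = 0")
  case False
  have "\<forall>e\<in>{a, b}. \<exists>c. p * e = c * a" using assms(3) by blast
  then have "a dvd p" by (rule dvd_if_proportional[OF False assms(1)])
  then obtain c where c: "p = c * a" by (metis dvd_def mult.commute)
  then have "a * q = a * (c * b)" using assms(3) by (metis mult.assoc mult.commute)
  then have "q = c * b" using False by (metis mult_left_cancel)
  then show ?thesis using c by blast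
next
  case True
  then have b: "b \<noteq> 0" using assms(2) by simp
  have "p = 0" using assms(3) True b by simp
  have "\<forall>e\<in>{a, b}. \<exists>c. q * e = c * b" 
    using True by (metis empty_iff insert_iff mult_zero_left mult_zero_right)
  then have "b dvd q" by (rule dvd_if_proportional[OF b assms(1)])
  then show ?thesis using True \<open>p = 0\<close> by (metis dvd_def mult.commute mult_zero_right)
qed

text \<open>Here \<open>h\<close> is a greatest common divisor. The case \<open>a = b = 0\<close> is covered by \<open>h = 0\<close>, \<open>a' = b' = 1\<close>,
  so that the cofactors never vanish together.\<close>

lemma gcd_split:
  fixes a b :: "'a::ufd"
  obtains h a' b' where "a = h * a'" "b = h * b'" "no_common_prime {a', b'}" "a' \<noteq> 0 \<or> b' \<noteq> 0"
proof -
  have one: "no_common_prime {u, c}" if u: "u dvd 1" for u c :: 'a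
    unfolding no_common_prime_def
  proof (rule notI, elim exE conjE)
    fix \<rho> assume \<rho>: "prime_elem \<rho>" "\<forall>a\<in>{u, c}. \<rho> dvd a"
    then have "\<rho> dvd 1" using u dvd_trans by (metis insertCI)
    then show False using \<rho>(1) prime_elem_not_unit by metis
  qed
  have main: "\<exists>h a' b'. a = h * a' \<and> b = h * b' \<and> no_common_prime {a', b'}"
    if "a \<noteq> 0" for a b :: 'a
    using that
  proof (induction a arbitrary: b rule: ufd_induct)
    case (unit u)
    then show ?case using one[of u b] by (metis mult_1)
  next
    case (prime \<pi> a)
    show ?case
    proof (cases "\<pi> dvd b")
      case True
      then obtain b0 where b0: "b = \<pi> * b0" by (rule dvdE)
      obtain h a' b' where "a = h * a'" "b0 = h * b'" "no_common_prime {a', b'}"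
        using prime.IH by metis
      then show ?thesis using b0 by (metis mult.assoc)
    next
      case False
      obtain h a' b' where h: "a = h * a'" "b = h * b'" "no_common_prime {a', b'}"
        using prime.IH by metis
      have "no_common_prime {\<pi> * a', b'}"
        unfolding no_common_prime_def
      proof (rule notI, elim exE conjE)
        fix \<rho> assume \<rho>: "prime_elem \<rho>" "\<forall>a\<in>{\<pi> * a', b'}. \<rho> dvd a"
        then consider "\<rho> dvd \<pi>" | "\<rho> dvd a'"
          using prime_elem_dvd_multD[of \<rho> \<pi> a'] by auto
        then show False
        proof cases
          case 1
          then obtain u where u: "\<pi> = \<rho> * u" by (rule dvdE)
          have "\<rho> dvd 1 \<or> u dvd 1"
            using irreducibleD[of \<pi> \<rho> u] prime_elem_imp_irreducible[OF prime.hyps(1)] u by metis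
          then have "u dvd 1" using prime_elem_not_unit[OF \<rho>(1)] by metis
          then obtain u' where "1 = u * u'" by (rule dvdE)
          then have "\<rho> = \<pi> * u'" using u by (metis mult.assoc mult.right_neutral)
          then have "\<pi> dvd \<rho>" by (metis dvd_triv_left)
          moreover have "\<rho> dvd b" using \<rho>(2) h(2) by (metis dvd_mult insertCI)
          ultimately show False using False dvd_trans by metis
        next
          case 2
          then show False using \<rho>(2) no_common_primeD[OF h(3) \<rho>(1)] by (metis insertCI insertE singletonD)
        qed
      qed
      then show ?thesis using h by (metis mult.left_commute)
    qed
  qed
  show ?thesis
  proof (cases "a = 0")
    case False
    then show ?thesis using main[OF False, of b] that by (metis mult_zero_right)
  next
    case True
    show ?thesis
    proof (cases "b = 0")
      case False
      then obtain h b' a' where "b = h * b'" "a = h * a'" "no_common_prime {b', a'}"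
        using main[OF False, of a] by metis
      then show ?thesis using that[of h a' b'] False by (metis insert_commute mult_zero_right)
    next
      case b: True
      show ?thesis using that[of 0 1 1] one[of 1 1] True b by simp
    qed
  qed
qed

section \<open>Ideals and localization at a prime ideal\<close>

lemma ideal_span_pair: "x \<in> ideal.span {a, b} \<longleftrightarrow> (\<exists>p q. x = p * a + q * b)"
  for a b x :: "'a::comm_ring_1"
proof -
  have "x \<in> ideal.span {a, b} \<longleftrightarrow> (\<exists>p q. x - p * a = q * b)"
    by (auto simp: ideal.span_insert[of a] ideal.span_singleton)
  then show ?thesis by (simp add: diff_eq_eq add.commute)
qed

lemma prime_idealD:
  assumes "prime_ideal P"
  shows "ideal.subspace P" "1 \<notin> P" "a * b \<in> P \<Longrightarrow> a \<in> P \<or> b \<in> P"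
    and "a \<in> P \<Longrightarrow> b * a \<in> P" "a \<in> P \<Longrightarrow> a * b \<in> P" "0 \<in> P"
    "a \<in> P \<Longrightarrow> b \<in> P \<Longrightarrow> a + b \<in> P" "a \<in> P \<Longrightarrow> b \<in> P \<Longrightarrow> a - b \<in> P"
proof -
  show I: "ideal.subspace P" and "1 \<notin> P" using assms by (simp_all add: prime_ideal_def)
  show "a * b \<in> P \<Longrightarrow> a \<in> P \<or> b \<in> P" using assms unfolding prime_ideal_def by blast
  show "a \<in> P \<Longrightarrow> b * a \<in> P" by (rule ideal.subspace_scale[OF I])
  then show "a \<in> P \<Longrightarrow> a * b \<in> P" by (simp only: mult.commute)
  show "0 \<in> P" by (rule ideal.subspace_0[OF I])
  show "a \<in> P \<Longrightarrow> b \<in> P \<Longrightarrow> a + b \<in> P" by (rule ideal.subspace_add[OF I])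
  show "a \<in> P \<Longrightarrow> b \<in> P \<Longrightarrow> a - b \<in> P" by (rule ideal.subspace_diff[OF I])
qed

lemma prime_ideal_mult_iff: "prime_ideal P \<Longrightarrow> a * b \<in> P \<longleftrightarrow> a \<in> P \<or> b \<in> P"
  by (metis prime_idealD(3,4,5))

lemma prime_ideal_power: "prime_ideal P \<Longrightarrow> a ^ n \<in> P \<Longrightarrow> a \<in> P"
  by (induction n) (auto simp: prime_ideal_mult_iff dest: prime_idealD(2))

lemma prime_ideal_prod: 
  assumes "prime_ideal P" "finite A" "\<forall>i\<in>A. w i \<notin> P"
  shows "prod w A \<notin> P"
  using assms(2,3) by (induction A) (auto simp: assms(1) prime_ideal_mult_iff prime_idealD(2))

lemma prime_ideal_unit: "prime_ideal P \<Longrightarrow> u dvd 1 \<Longrightarrow> u \<notin> P"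
  by (metis dvdE prime_idealD(2,5))

lemma prime_ideal_span: "prime_ideal P \<Longrightarrow> F \<subseteq> P \<Longrightarrow> ideal.span F \<subseteq> P"
  by (simp add: prime_idealD(1) ideal.span_minimal)

lemma prime_ideal_prime_factor:
  fixes b :: "'a::ufd"
  assumes "prime_ideal P" "b \<noteq> 0" "b \<in> P"
  shows "\<exists>\<pi>. prime_elem \<pi> \<and> \<pi> \<in> P \<and> \<pi> dvd b"
  using assms(2,3)
proof (induction b rule: ufd_induct)
  case (unit u)
  then show ?case using prime_ideal_unit[OF assms(1)] by metis
next
  case (prime \<pi> c)
  then show ?case by (meson assms(1) dvd_mult dvd_triv_left prime_ideal_mult_iff)
qed

text \<open>For an ideal \<open>I\<close> this is the contraction of its extension to the localization at \<open>P\<close>.\<close>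

definition at_prime :: "'a::comm_ring_1 set \<Rightarrow> 'a set \<Rightarrow> 'a set" where
  "at_prime P I = {x. \<exists>w. w \<notin> P \<and> w * x \<in> I}"

lemma at_primeI: "w \<notin> P \<Longrightarrow> w * x \<in> I \<Longrightarrow> x \<in> at_prime P I"
  by (auto simp: at_prime_def)

lemma at_primeE: "x \<in> at_prime P I \<Longrightarrow> (\<And>w. w \<notin> P \<Longrightarrow> w * x \<in> I \<Longrightarrow> thesis) \<Longrightarrow> thesis"
  by (auto simp: at_prime_def)

lemma subset_at_prime: "prime_ideal P \<Longrightarrow> I \<subseteq> at_prime P I"
  using at_primeI[of 1 P] prime_idealD(2) by force

lemma at_prime_mono: "I \<subseteq> J \<Longrightarrow> at_prime P I \<subseteq> at_prime P J"
  by (auto simp: at_prime_def)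

lemma at_prime_subspace:
  assumes P: "prime_ideal P" and I: "ideal.subspace I"
  shows "ideal.subspace (at_prime P I)"
proof (rule ideal.subspaceI)
  show "0 \<in> at_prime P I"
    using subset_at_prime[OF P] ideal.subspace_0[OF I] by blast
next
  fix x y assume "x \<in> at_prime P I" "y \<in> at_prime P I"
  then obtain w w' where w: "w \<notin> P" "w * x \<in> I" "w' \<notin> P" "w' * y \<in> I"
    by (metis at_primeE)
  have "w' * (w * x) + w * (w' * y) \<in> I"
    by (rule ideal.subspace_add[OF I ideal.subspace_scale[OF I w(2)] ideal.subspace_scale[OF I w(4)]])
  moreover have "w' * (w * x) + w * (w' * y) = (w * w') * (x + y)"
    by (simp add: algebra_simps)
  moreover have "w * w' \<notin> P" using w prime_ideal_mult_iff[OF P] by metis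
  ultimately show "x + y \<in> at_prime P I" using at_primeI by metis
next
  fix c x assume "x \<in> at_prime P I"
  then obtain w where "w \<notin> P" "w * x \<in> I" by (rule at_primeE)
  then show "c * x \<in> at_prime P I"
    using ideal.subspace_scale[OF I, of "w * x" c] at_primeI by (metis mult.left_commute)
qed

lemma at_prime_cancel:
  "prime_ideal P \<Longrightarrow> w \<notin> P \<Longrightarrow> w * x \<in> at_prime P I \<Longrightarrow> x \<in> at_prime P I"
  by (erule at_primeE) (metis at_primeI mult.assoc prime_ideal_mult_iff)

lemma at_prime_common_denominator:
  fixes v :: "'n::finite \<Rightarrow> 'a::comm_ring_1"
  assumes P: "prime_ideal P" and I: "ideal.subspace I" and v: "\<And>i. v i \<in> at_prime P I"
  obtains w where "w \<notin> P" "\<And>i. w * v i \<in> I"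
proof -
  have "\<forall>i. \<exists>w. w \<notin> P \<and> w * v i \<in> I" using v by (simp add: at_prime_def)
  then obtain w where w: "\<And>i. w i \<notin> P" "\<And>i. w i * v i \<in> I" by metis
  have "prod w UNIV * v i \<in> I" for i
  proof -
    have "prod w UNIV = prod w (UNIV - {i}) * w i"
      by (simp add: prod.remove[of UNIV i] mult.commute)
    then show ?thesis using ideal.subspace_scale[OF I w(2)[of i]] by (metis mult.assoc)
  qed
  moreover have "prod w UNIV \<notin> P" using prime_ideal_prod[OF P, of UNIV w] w(1) by simp
  ultimately show ?thesis using that by blast
qed

section \<open>The Koszul complex on three elements\<close>

text \<open>The index type \<open>3\<close> is the ring of integers modulo 3, so \<open>i\<close>, \<open>nxt i\<close>, \<open>prv i\<close> are the three indices
  in cyclic order, whichever \<open>i\<close> one starts from. Opaque names keep the simplifier away from the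
  arithmetic of indices.\<close>

definition nxt :: "3 \<Rightarrow> 3" where "nxt i = i + 1"
definition prv :: "3 \<Rightarrow> 3" where "prv i = i + 2"

definition cross :: "'a::comm_ring_1 ^ 3 \<Rightarrow> 'a ^ 3 \<Rightarrow> 'a ^ 3" where
  "cross p f = (\<chi> i. p $ nxt i * f $ prv i - p $ prv i * f $ nxt i)"

definition dot :: "'a::comm_ring_1 ^ 3 \<Rightarrow> 'a ^ 3 \<Rightarrow> 'a" where
  "dot p f = (\<Sum>i\<in>UNIV. p $ i * f $ i)"

lemma nxt_prv_simps [simp]:
  "nxt (nxt i) = prv i" "nxt (prv i) = i" "prv (nxt i) = i" "prv (prv i) = nxt i"
  "nxt i \<noteq> i" "prv i \<noteq> i" "i \<noteq> nxt i" "i \<noteq> prv i" "nxt i \<noteq> prv i" "prv i \<noteq> nxt i"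
  using exhaust_3[of i] by (auto simp: nxt_def prv_def)

lemma UNIV_nxt_prv: "UNIV = {i, nxt i, prv i}"
proof -
  have "x \<in> {i, nxt i, prv i}" for x :: 3
    using exhaust_3[of x] exhaust_3[of i] by (auto simp: nxt_def prv_def)
  then show ?thesis by blast
qed

lemma all_nxt_prv: "(\<forall>l. Q l) \<longleftrightarrow> Q i \<and> Q (nxt i) \<and> Q (prv i)" for i :: 3
proof -
  have "l = i \<or> l = nxt i \<or> l = prv i" for l using UNIV_nxt_prv[of i] by blast
  then show ?thesis by metis
qed

lemma dot_expand: "dot p f = p $ i * f $ i + p $ nxt i * f $ nxt i + p $ prv i * f $ prv i"
  unfolding dot_def UNIV_nxt_prv[of i] by (simp add: add.assoc)

lemma cross_nth: "cross p f $ i = p $ nxt i * f $ prv i - p $ prv i * f $ nxt i"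
  by (simp add: cross_def)

lemma cross_add: "cross (p + q) f = cross p f + cross q f"
  unfolding Finite_Cartesian_Product.vec_eq_iff cross_nth vector_add_component by (simp add: algebra_simps)

lemma cross_diff: "cross (p - q) f = cross p f - cross q f"
  unfolding Finite_Cartesian_Product.vec_eq_iff cross_nth vector_minus_component by (simp add: algebra_simps)

lemma cross_smult: "cross (c *s p) f = c *s cross p f"
  unfolding Finite_Cartesian_Product.vec_eq_iff cross_nth vector_smult_component by (simp add: algebra_simps)

lemma cross_self: "cross f f = 0"
  unfolding Finite_Cartesian_Product.vec_eq_iff cross_nth zero_index by (simp add: algebra_simps)

lemma dot_add: "dot (p + q) f = dot p f + dot q f"
  by (simp add: dot_def sum.distrib distrib_right)

lemma dot_diff: "dot (p - q) f = dot p f - dot q f"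
  by (simp add: dot_def sum_subtractf left_diff_distrib)

lemma dot_smult: "dot (c *s p) f = c * dot p f"
  unfolding dot_def sum_distrib_left vector_smult_component mult.assoc ..

lemma dot_cross: "dot (cross p f) f = 0"
  unfolding dot_expand[of _ _ 0] cross_nth nxt_prv_simps by (simp add: algebra_simps)

text \<open>For a syzygy \<open>a\<close> of \<open>f\<close> it gives \<open>(u \<times> a) \<times> f = (u \<cdot> f) a\<close>: the ideal of the \<open>f\<^sub>i\<close> sends every syzygy
  to a Koszul syzygy.\<close>

lemma cross_cross: "cross (cross u v) w = dot u w *s v - dot v w *s u"
proof -
  have "cross (cross u v) w $ i = (dot u w *s v - dot v w *s u) $ i" for i
    unfolding cross_nth dot_expand[of _ _ i] nxt_prv_simps vector_minus_component
      vector_smult_component by (simp add: algebra_simps)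
  then show ?thesis unfolding Finite_Cartesian_Product.vec_eq_iff by blast
qed

lemma dot_axis: "dot (axis i 1) f = f $ i"
  by (simp add: dot_expand[of _ _ i] axis_def)

lemma range_nth3: "range (($) f) = {f $ i, f $ nxt i, f $ prv i}" for f :: "'a ^ 3"
  using arg_cong[OF UNIV_nxt_prv[of i], of "image (($) f)"] by simp

lemma ideal_span_range: "ideal.span (range (($) f)) = range (\<lambda>u. dot u f)"
  for f :: "'a::comm_ring_1 ^ 3"
proof
  have sub: "ideal.subspace (range (\<lambda>u. dot u f))"
  proof (rule ideal.subspaceI)
    show "0 \<in> range (\<lambda>u. dot u f)"
      by (rule range_eqI[of _ _ 0]) (simp add: dot_def)
    show "x + y \<in> range (\<lambda>u. dot u f)"
      if "x \<in> range (\<lambda>u. dot u f)" "y \<in> range (\<lambda>u. dot u f)" for x y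
      using that by (auto simp flip: dot_add)
    show "c * x \<in> range (\<lambda>u. dot u f)" if "x \<in> range (\<lambda>u. dot u f)" for c x
      using that by (auto simp flip: dot_smult)
  qed
  have "f $ i \<in> range (\<lambda>u. dot u f)" for i
    by (rule range_eqI[of _ _ "axis i 1"]) (simp add: dot_axis)
  then show "ideal.span (range (($) f)) \<subseteq> range (\<lambda>u. dot u f)"
    by (intro ideal.span_minimal sub) auto
  show "range (\<lambda>u. dot u f) \<subseteq> ideal.span (range (($) f))"
    unfolding dot_def
    by (intro image_subsetI ideal.span_sum ideal.span_scale ideal.span_base rangeI)
qed

section \<open>Koszul syzygies at a prime ideal\<close>

definition koszul_at :: "'a::comm_ring_1 set \<Rightarrow> 'a ^ 3 \<Rightarrow> ('a ^ 3) set" where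
  "koszul_at P f = {a. \<exists>w p. w \<notin> P \<and> w *s a = cross p f}"

lemma koszul_atI: "w \<notin> P \<Longrightarrow> w *s a = cross p f \<Longrightarrow> a \<in> koszul_at P f"
  by (auto simp: koszul_at_def)

lemma koszul_atE:
  "a \<in> koszul_at P f \<Longrightarrow> (\<And>w p. w \<notin> P \<Longrightarrow> w *s a = cross p f \<Longrightarrow> thesis) \<Longrightarrow> thesis"
  by (auto simp: koszul_at_def)

lemma cross_in_koszul_at: "prime_ideal P \<Longrightarrow> cross p f \<in> koszul_at P f"
  by (rule koszul_atI[of 1]) (simp_all add: prime_idealD(2))

lemma koszul_at_smult: "a \<in> koszul_at P f \<Longrightarrow> c *s a \<in> koszul_at P f"
proof (erule koszul_atE)
  fix w p assume "w \<notin> P" "w *s a = cross p f"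
  then show "c *s a \<in> koszul_at P f"
    by (intro koszul_atI[of w P _ "c *s p"])
      (simp_all add: cross_smult vector_smult_assoc mult.commute[of w c] flip: \<open>w *s a = cross p f\<close>)
qed

lemma koszul_at_add:
  assumes "prime_ideal P" "a \<in> koszul_at P f" "b \<in> koszul_at P f"
  shows "a + b \<in> koszul_at P f"
proof -
  obtain w p where w: "w \<notin> P" "w *s a = cross p f" using assms(2) by (rule koszul_atE)
  obtain v q where v: "v \<notin> P" "v *s b = cross q f" using assms(3) by (rule koszul_atE)
  have "(w * v) *s (a + b) = v *s (w *s a) + w *s (v *s b)"
    by (simp add: vector_add_ldistrib vector_smult_assoc mult.commute)
  also have "\<dots> = cross (v *s p + w *s q) f"
    by (simp add: w v cross_add cross_smult)
  finally show ?thesis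
    using w(1) v(1) prime_ideal_mult_iff[OF assms(1)] koszul_atI by metis
qed

lemma koszul_at_uminus: "a \<in> koszul_at P f \<Longrightarrow> - a \<in> koszul_at P f"
  using koszul_at_smult[of a P f "-1"] by simp

lemma koszul_at_cancel:
  "prime_ideal P \<Longrightarrow> w \<notin> P \<Longrightarrow> w *s a \<in> koszul_at P f \<Longrightarrow> a \<in> koszul_at P f"
  by (erule koszul_atE) (metis koszul_atI vector_smult_assoc prime_ideal_mult_iff)

lemma cross_entry_in_span: "cross p f $ i \<in> ideal.span {f $ nxt i, f $ prv i}"
  unfolding ideal_span_pair cross_nth
  by (rule exI[of _ "- p $ prv i"], rule exI[of _ "p $ nxt i"]) simp

lemma koszul_at_entry:
  "a \<in> koszul_at P f \<Longrightarrow> a $ i \<in> at_prime P (ideal.span {f $ nxt i, f $ prv i})"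
  by (erule koszul_atE) (metis at_primeI cross_entry_in_span vector_smult_component)

lemma koszul_at_of_ideal:
  assumes "dot a f = 0" "b \<in> at_prime P (ideal.span (range (($) f)))"
  shows "b *s a \<in> koszul_at P f"
proof -
  obtain w u where w: "w \<notin> P" "w * b = dot u f"
    using assms(2) unfolding ideal_span_range by (auto elim!: at_primeE)
  have "w *s (b *s a) = cross (cross u a) f"
    by (simp add: cross_cross assms(1) w(2) vector_smult_assoc)
  then show ?thesis by (rule koszul_atI[OF w(1)])
qed

text \<open>Exactness of the Koszul complex one step further to the left: a vector parallel to \<open>f\<close> is a multiple
  of \<open>f\<close>.\<close>

lemma cross_eq_zero:
  fixes p f :: "'a::ufd ^ 3"
  assumes "cross p f = 0" "no_common_prime (range (($) f))" "f \<noteq> 0"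
  obtains c where "p = c *s f"
proof -
  obtain i where i: "f $ i \<noteq> 0"
    using assms(3) by (auto simp: Finite_Cartesian_Product.vec_eq_iff)
  have n: "p $ i * f $ nxt i = p $ nxt i * f $ i"
    using arg_cong[OF assms(1), of "\<lambda>v. v $ prv i"] by (simp add: cross_nth)
  have v: "p $ i * f $ prv i = p $ prv i * f $ i"
    using arg_cong[OF assms(1), of "\<lambda>v. v $ nxt i"] by (simp add: cross_nth)
  have "\<forall>a\<in>range (($) f). \<exists>c. p $ i * a = c * f $ i"
    unfolding range_nth3[of f i] using n v by blast
  then have "f $ i dvd p $ i" by (rule dvd_if_proportional[OF i assms(2)])
  then obtain c where c: "p $ i = f $ i * c" by (rule dvdE)
  have "p $ nxt i = c * f $ nxt i" using n i by (simp add: c)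
  moreover have "p $ prv i = c * f $ prv i" using v i by (simp add: c)
  ultimately have "\<forall>l. p $ l = (c *s f) $ l" by (simp add: all_nxt_prv[of _ i] c)
  then have "p = c *s f" unfolding Finite_Cartesian_Product.vec_eq_iff .
  then show ?thesis by (rule that)
qed

lemma proportional_vectors:
  fixes p q :: "'a::ufd ^ 3"
  assumes "no_common_prime {x, y}" "x \<noteq> 0 \<or> y \<noteq> 0" "y *s p = x *s q"
  obtains z where "p = x *s z" "q = y *s z"
proof -
  have "\<exists>c. p $ i = c * x \<and> q $ i = c * y" for i
    using proportional_pair[OF assms(1,2), of "p $ i" "q $ i"]
      arg_cong[OF assms(3), of "\<lambda>v. v $ i"] by (simp add: mult.commute)
  then obtain c where "\<And>i. p $ i = c i * x \<and> q $ i = c i * y" by metis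
  then show ?thesis
    by (intro that[of "\<chi> i. c i"]) (simp_all add: Finite_Cartesian_Product.vec_eq_iff mult.commute)
qed

text \<open>For a prime \<open>P\<close> the localization is a two-dimensional regular local ring with regular system of
  parameters \<open>x\<close>, \<open>y\<close>.\<close>

definition local_parameters :: "'a::comm_ring_1 set \<Rightarrow> 'a \<Rightarrow> 'a \<Rightarrow> bool" where
  "local_parameters P x y \<longleftrightarrow> x \<in> P \<and> y \<in> P \<and> (x \<noteq> 0 \<or> y \<noteq> 0) \<and> no_common_prime {x, y} \<and>
     P \<subseteq> at_prime P (ideal.span {x, y})"

lemma smult_cancel_either:
  fixes a b :: "'a::idom ^ 3"
  assumes "x \<noteq> 0 \<or> y \<noteq> 0" "x *s a = x *s b" "y *s a = y *s b"
  shows "a = b"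
  using assms(1)
proof
  assume "x \<noteq> 0"
  then show ?thesis using assms(2) by (simp add: Finite_Cartesian_Product.vec_eq_iff)
next
  assume "y \<noteq> 0"
  then show ?thesis using assms(3) by (simp add: Finite_Cartesian_Product.vec_eq_iff)
qed

text \<open>All \<open>f\<^sub>i\<close> are in the maximal ideal, so \<open>w\<^sub>0 f = x p + y q\<close> for some \<open>w\<^sub>0 \<notin> P\<close>. Taking the cross
  product with \<open>f\<close> gives \<open>x (p \<times> f) = - y (q \<times> f)\<close>, and as \<open>x\<close>, \<open>y\<close> are coprime, there is an \<open>r\<close> with
  \<open>q \<times> f = x r\<close> and \<open>p \<times> f = - y r\<close>. This \<open>r\<close> spans the socle of the syzygies modulo \<open>K\<^sub>P\<close>. For
  another socle element \<open>a\<close> with, up to a multiplier, \<open>x a = p' \<times> f\<close> and \<open>y a = q' \<times> f\<close>, the vector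
  \<open>y p' - x q'\<close> is parallel to \<open>f\<close>, say \<open>c f\<close>; then \<open>a\<close> is congruent to a multiple of \<open>c r\<close>.\<close>

lemma socle_generator:
  fixes f :: "'a::ufd ^ 3"
  assumes P: "prime_ideal P" and xy: "local_parameters P x y"
    and f: "\<And>i. f $ i \<in> P" "no_common_prime (range (($) f))" "f \<noteq> 0"
  obtains r where "dot r f = 0" "r \<notin> koszul_at P f" "x *s r \<in> koszul_at P f" "y *s r \<in> koszul_at P f"
    "\<And>a. x *s a \<in> koszul_at P f \<Longrightarrow> y *s a \<in> koszul_at P f \<Longrightarrow>
       \<exists>w c. w \<notin> P \<and> w *s a - c *s r \<in> koszul_at P f"
proof -
  have x: "x \<in> P" "y \<in> P" "x \<noteq> 0 \<or> y \<noteq> 0" "no_common_prime {x, y}"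
    "P \<subseteq> at_prime P (ideal.span {x, y})"
    using xy by (simp_all add: local_parameters_def)
  obtain w0 where w0: "w0 \<notin> P" "\<And>i. w0 * f $ i \<in> ideal.span {x, y}"
    using at_prime_common_denominator[OF P ideal.subspace_span, of "($) f" "{x, y}"] f(1) x(5) by blast
  have "\<forall>i. \<exists>p q. w0 * f $ i = p * x + q * y" using w0(2) by (simp add: ideal_span_pair)
  then obtain p0 q0 where pq0: "\<And>i. w0 * f $ i = p0 i * x + q0 i * y" by metis
  define p q :: "'a ^ 3" where "p = (\<chi> i. p0 i)" and "q = (\<chi> i. q0 i)"
  have f_eq: "w0 *s f = x *s p + y *s q"
    by (simp add: Finite_Cartesian_Product.vec_eq_iff p_def q_def pq0 mult.commute)
  have "x *s cross p f + y *s cross q f = 0"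
    using arg_cong[OF f_eq, of "\<lambda>v. cross v f"] by (simp add: cross_add cross_smult cross_self)
  then have "y *s cross q f = x *s (- cross p f)"
    by (simp add: eq_neg_iff_add_eq_0 add.commute)
  then obtain r where r: "cross q f = x *s r" "- cross p f = y *s r"
    by (rule proportional_vectors[OF x(4,3)])
  have r2: "cross p f = - (y *s r)" using r(2) by (metis minus_minus)
  show ?thesis
  proof
    have "x * dot r f = 0" using dot_cross[of q f] by (simp add: r dot_smult)
    moreover have "y * dot r f = 0" using dot_cross[of "- p" f] r(2)
      by (metis dot_smult dot_cross r2 minus_minus neg_equal_0_iff_equal mult_minus1 vector_sneg_minus1 mult_eq_0_iff)
    ultimately show "dot r f = 0" using x(3) by auto
    show "x *s r \<in> koszul_at P f" using cross_in_koszul_at[OF P, of q f] r(1) by simp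
    show "y *s r \<in> koszul_at P f"
      using koszul_at_uminus[OF cross_in_koszul_at[OF P, of p f]] r(2) by simp
    show "r \<notin> koszul_at P f"
    proof
      assume "r \<in> koszul_at P f"
      then obtain w z where w: "w \<notin> P" "w *s r = cross z f" by (rule koszul_atE)
      \<comment> \<open>A Koszul \<open>r\<close> would turn \<open>w\<^sub>0 f = x p + y q\<close> into \<open>w w\<^sub>0 f = (x \<beta> + y \<alpha>) f\<close>, which puts a
        unit of the local ring into the maximal ideal.\<close>
      have "cross (w *s q - x *s z) f = 0"
        by (simp add: cross_diff cross_smult r w(2)[symmetric] vector_smult_assoc mult.commute)
      then obtain \<alpha> where \<alpha>: "w *s q - x *s z = \<alpha> *s f" by (rule cross_eq_zero[OF _ f(2,3)])
      have "cross (w *s p + y *s z) f = 0"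
        by (simp add: cross_add cross_smult r2 w(2)[symmetric] vector_smult_assoc mult.commute)
      then obtain \<beta> where \<beta>: "w *s p + y *s z = \<beta> *s f" by (rule cross_eq_zero[OF _ f(2,3)])
      obtain i where i: "f $ i \<noteq> 0"
        using f(3) by (auto simp: Finite_Cartesian_Product.vec_eq_iff)
      have *: "w * q $ i = \<alpha> * f $ i + x * z $ i" "w * p $ i = \<beta> * f $ i - y * z $ i"
        using arg_cong[OF \<alpha>, of "\<lambda>v. v $ i"] arg_cong[OF \<beta>, of "\<lambda>v. v $ i"]
        by (simp_all add: algebra_simps)
      then have "x * (w * p $ i) + y * (w * q $ i) = (x * \<beta> + y * \<alpha>) * f $ i"
        unfolding * by (simp add: algebra_simps)
      moreover have "(w * w0) * f $ i = x * (w * p $ i) + y * (w * q $ i)"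
        using arg_cong[OF f_eq, of "\<lambda>v. w * v $ i"] by (simp add: algebra_simps)
      ultimately have "(w * w0) * f $ i = (x * \<beta> + y * \<alpha>) * f $ i"
        by simp
      then have "w * w0 = x * \<beta> + y * \<alpha>" using i by simp
      moreover have "x * \<beta> + y * \<alpha> \<in> P"
        by (rule prime_idealD(7)[OF P]) (simp_all add: prime_idealD(5)[OF P] x(1,2))
      ultimately show False using w(1) w0(1) prime_idealD(3)[OF P, of w w0] by simp
    qed
  next
    fix a assume "x *s a \<in> koszul_at P f" "y *s a \<in> koszul_at P f"
    then obtain w1 p1 w2 q1 where w12: "w1 \<notin> P" "w1 *s (x *s a) = cross p1 f"
      "w2 \<notin> P" "w2 *s (y *s a) = cross q1 f"
      by (metis koszul_atE)
    define w where "w = w1 * w2"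
    define p' where "p' = w2 *s p1"
    define q' where "q' = w1 *s q1"
    have w: "w \<notin> P" using w12 prime_idealD(3)[OF P] by (auto simp: w_def)
    have p': "cross p' f = x *s (w *s a)"
      by (simp add: p'_def cross_smult w12(2)[symmetric] w_def vector_smult_assoc mult_ac)
    have q': "cross q' f = y *s (w *s a)"
      by (simp add: q'_def cross_smult w12(4)[symmetric] w_def vector_smult_assoc mult_ac)
    have "cross (y *s p' - x *s q') f = 0"
      by (simp add: cross_diff cross_smult p' q' vector_smult_assoc mult_ac)
    then obtain c where c: "y *s p' - x *s q' = c *s f" by (rule cross_eq_zero[OF _ f(2,3)])
    \<comment> \<open>Subtracting \<open>c r\<close> makes the obstruction \<open>c\<close> vanish.\<close>
    have "y *s (w0 *s p') - x *s (w0 *s q') = w0 *s (y *s p' - x *s q')"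
      by (simp add: vector_ssub_ldistrib vector_smult_assoc mult_ac)
    also have "\<dots> = c *s (w0 *s f)" by (simp add: c vector_smult_assoc mult_ac)
    also have "\<dots> = x *s (c *s p) + y *s (c *s q)"
      by (simp add: f_eq vector_add_ldistrib vector_smult_assoc mult_ac)
    finally have "y *s (w0 *s p' - c *s q) = x *s (w0 *s q' + c *s p)"
      by (simp add: vector_ssub_ldistrib vector_add_ldistrib algebra_simps)
    then obtain z where z: "w0 *s p' - c *s q = x *s z" "w0 *s q' + c *s p = y *s z"
      by (rule proportional_vectors[OF x(4,3)])
    have "x *s ((w0 * w) *s a - c *s r) = cross (w0 *s p' - c *s q) f"
      by (simp add: cross_diff cross_smult p' r vector_ssub_ldistrib vector_smult_assoc mult_ac)
    moreover have "y *s ((w0 * w) *s a - c *s r) = cross (w0 *s q' + c *s p) f"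
      by (simp add: cross_add cross_smult q' r2 vector_ssub_ldistrib vector_smult_assoc mult_ac)
    ultimately have "(w0 * w) *s a - c *s r = cross z f"
      unfolding z cross_smult by (rule smult_cancel_either[OF x(3)])
    then show "\<exists>w c. w \<notin> P \<and> w *s a - c *s r \<in> koszul_at P f"
      using w w0(1) prime_idealD(3)[OF P, of w0 w] cross_in_koszul_at[OF P] by metis
  qed
qed

lemma last_nonmember:
  fixes a :: "'a::comm_ring_1 ^ 'n"
  assumes "a \<notin> K" "x ^ k *s a \<in> K"
  obtains m where "x ^ m *s a \<notin> K" "x ^ Suc m *s a \<in> K"
  using assms(2)
proof (induction k arbitrary: thesis)
  case 0
  then show ?case using assms(1) by (simp add: vector_smult_lid)
next
  case (Suc k)
  then show ?case by metis
qed

lemma koszul_at_power: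
  assumes "prime_ideal P" "dot a f = 0" "x ^ k \<in> at_prime P (ideal.span (range (($) f)))"
    and "a \<notin> koszul_at P f"
  obtains m where "x ^ m *s a \<notin> koszul_at P f" "x *s (x ^ m *s a) \<in> koszul_at P f"
proof -
  have "x ^ k *s a \<in> koszul_at P f" by (rule koszul_at_of_ideal[OF assms(2,3)])
  then obtain m where "x ^ m *s a \<notin> koszul_at P f" "x ^ Suc m *s a \<in> koszul_at P f"
    using last_nonmember[OF assms(4)] by metis
  then show ?thesis using that by (simp add: vector_smult_assoc)
qed

lemma at_prime_span_mono:
  "F \<subseteq> ideal.span G \<Longrightarrow> at_prime P (ideal.span F) \<subseteq> at_prime P (ideal.span G)"
  by (intro at_prime_mono ideal.span_minimal ideal.subspace_span)

lemma pair_subset_range: "{f $ nxt i, f $ prv i} \<subseteq> ideal.span (range (($) f))"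
  by (auto intro: ideal.span_base)

lemma koszul_at_entry':
  "a \<in> koszul_at P f \<Longrightarrow> a $ i \<in> at_prime P (ideal.span (range (($) f)))"
  using koszul_at_entry[of a P f i] at_prime_span_mono[OF pair_subset_range[of f i]] by blast

text \<open>The coordinate \<open>i\<close> is one where the socle generator \<open>r\<close> is not in \<open>I\<^sub>P\<close>. A counterexample \<open>a\<close> for
  this \<open>i\<close> could be multiplied by powers of \<open>x\<close> and \<open>y\<close> until it lies in the socle without becoming
  Koszul; then it is a unit multiple of \<open>r\<close> modulo \<open>K\<^sub>P\<close>, and its \<open>i\<close>-th entry is not in \<open>I\<^sub>P\<close>.\<close>

lemma vanishing_coordinate_suffices:
  fixes f :: "'a::ufd ^ 3"
  assumes P: "prime_ideal P" and xy: "local_parameters P x y"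
    and nil: "\<And>q. q \<in> P \<Longrightarrow> \<exists>k. q ^ k \<in> at_prime P (ideal.span (range (($) f)))"
    and f: "\<And>i. f $ i \<in> P" "no_common_prime (range (($) f))" "f \<noteq> 0"
    and V: "\<And>a. dot a f = 0 \<Longrightarrow> (\<And>i. a $ i \<in> at_prime P (ideal.span (range (($) f)))) \<Longrightarrow>
      a \<in> koszul_at P f"
  obtains i where "\<And>a. dot a f = 0 \<Longrightarrow> a $ i \<in> at_prime P (ideal.span (range (($) f))) \<Longrightarrow>
      a \<in> koszul_at P f"
proof -
  define I where "I = at_prime P (ideal.span (range (($) f)))"
  have I: "ideal.subspace I"
    unfolding I_def by (rule at_prime_subspace[OF P ideal.subspace_span])
  obtain r where r: "dot r f = 0" "r \<notin> koszul_at P f"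
    "x *s r \<in> koszul_at P f" "y *s r \<in> koszul_at P f"
    and socle: "\<And>a. x *s a \<in> koszul_at P f \<Longrightarrow> y *s a \<in> koszul_at P f \<Longrightarrow>
       \<exists>w c. w \<notin> P \<and> w *s a - c *s r \<in> koszul_at P f"
    using socle_generator[OF P xy f] by metis
  obtain i where i: "r $ i \<notin> I" using V[OF r(1)] r(2) unfolding I_def by metis
  have "a \<in> koszul_at P f" if a: "dot a f = 0" "a $ i \<in> I" for a
  proof (rule ccontr)
    assume "a \<notin> koszul_at P f"
    have xP: "x \<in> P" "y \<in> P" "P \<subseteq> at_prime P (ideal.span {x, y})"
      using xy by (simp_all add: local_parameters_def)
    obtain k l where kl: "x ^ k \<in> I" "y ^ l \<in> I" using nil xP unfolding I_def by metis
    obtain m where m: "x ^ m *s a \<notin> koszul_at P f" "x *s (x ^ m *s a) \<in> koszul_at P f"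
      using koszul_at_power[OF P a(1) kl(1)[unfolded I_def] \<open>a \<notin> koszul_at P f\<close>] by metis
    have "dot (x ^ m *s a) f = 0" using a by (simp add: dot_smult)
    then obtain n where n: "y ^ n *s (x ^ m *s a) \<notin> koszul_at P f"
      "y *s (y ^ n *s (x ^ m *s a)) \<in> koszul_at P f"
      using koszul_at_power[OF P _ kl(2)[unfolded I_def] m(1)] by metis
    define b where "b = y ^ n *s (x ^ m *s a)"
    have "x *s b = y ^ n *s (x *s (x ^ m *s a))"
      by (simp add: b_def vector_smult_assoc mult_ac)
    then have "x *s b \<in> koszul_at P f" using koszul_at_smult[OF m(2)] by metis
    moreover have "y *s b \<in> koszul_at P f" using n b_def by metis
    ultimately obtain w c where wc: "w \<notin> P" "w *s b - c *s r \<in> koszul_at P f"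
      using socle by metis
    have "c \<notin> P"
    proof
      assume "c \<in> P"
      then obtain v where v: "v \<notin> P" "v * c \<in> ideal.span {x, y}"
        using xP(3) by (auto elim!: at_primeE)
      then obtain p q where pq: "v * c = p * x + q * y" by (auto simp: ideal_span_pair)
      have "v *s (c *s r) = p *s (x *s r) + q *s (y *s r)"
        by (simp add: vector_smult_assoc pq vector_sadd_rdistrib)
      then have "v *s (c *s r) \<in> koszul_at P f"
        using koszul_at_add[OF P] koszul_at_smult r(3,4) by metis
      then have "c *s r \<in> koszul_at P f" by (rule koszul_at_cancel[OF P v(1)])
      then have "w *s b \<in> koszul_at P f" using koszul_at_add[OF P wc(2)] by fastforce
      then show False using koszul_at_cancel[OF P wc(1)] n(1) b_def by metis
    qed
    have "b $ i \<in> I"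
      using ideal.subspace_scale[OF I a(2)] by (simp add: b_def flip: mult.assoc)
    then have "w * b $ i \<in> I" by (rule ideal.subspace_scale[OF I])
    moreover have "w * b $ i - c * r $ i \<in> I"
      using koszul_at_entry'[OF wc(2), of i] by (simp add: I_def)
    ultimately have "w * b $ i - (w * b $ i - c * r $ i) \<in> I" by (rule ideal.subspace_diff[OF I])
    then have "c * r $ i \<in> I" by simp
    then show False using at_prime_cancel[OF P \<open>c \<notin> P\<close>] i unfolding I_def by metis
  qed
  then show ?thesis using that unfolding I_def by metis
qed

text \<open>The colon ideals \<open>J : e\<^sup>n\<close> are constant for \<open>n \<ge> 1\<close> as soon as the first two coincide.\<close>

lemma power_descent:
  assumes J: "ideal.subspace J" and sq: "\<And>z. z * e * e \<in> J \<Longrightarrow> z * e \<in> J"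
    and k: "e ^ k \<in> J"
  shows "e \<in> J"
proof (cases k)
  case 0
  then show ?thesis using ideal.subspace_scale[OF J k, of e] by simp
next
  case (Suc n)
  have "e ^ Suc n \<in> J \<Longrightarrow> e \<in> J" for n
  proof (induction n)
    case (Suc n)
    then show ?case using sq[of "e ^ n"] by (simp add: mult_ac)
  qed simp
  then show ?thesis using k Suc by blast
qed

text \<open>Let \<open>h\<close> be the gcd of \<open>f\<^sub>j\<close> and \<open>f\<^sub>k\<close>. The syzygy \<open>(0, f\<^sub>k / h, - f\<^sub>j / h)\<close> has \<open>i\<close>-th entry \<open>0\<close>, so it
  is Koszul at \<open>P\<close>, and this forces \<open>h \<notin> P\<close>. Hence a power of \<open>f\<^sub>i\<close> lies in \<open>(f\<^sub>j, f\<^sub>k)\<^sub>P\<close>. If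
  \<open>z f\<^sub>i\<^sup>2\<close> lies there, then \<open>z f\<^sub>i\<close> is the \<open>i\<close>-th entry of a syzygy, and it is in \<open>I\<close>; the syzygy is
  Koszul, so \<open>z f\<^sub>i\<close> lies in \<open>(f\<^sub>j, f\<^sub>k)\<^sub>P\<close> as well.\<close>

lemma generator_redundant_of_koszul:
  fixes f :: "'a::ufd ^ 3"
  assumes P: "prime_ideal P"
    and nil: "\<And>F q. F \<subseteq> P \<Longrightarrow> no_common_prime F \<Longrightarrow> q \<in> P \<Longrightarrow>
      \<exists>k. q ^ k \<in> at_prime P (ideal.span F)"
    and f: "\<And>i. f $ i \<in> P" "no_common_prime (range (($) f))" "f \<noteq> 0"
    and V: "\<And>a. dot a f = 0 \<Longrightarrow> a $ i \<in> at_prime P (ideal.span (range (($) f))) \<Longrightarrow>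
      a \<in> koszul_at P f"
  shows "f $ i \<in> at_prime P (ideal.span {f $ nxt i, f $ prv i})"
proof -
  define J where "J = at_prime P (ideal.span {f $ nxt i, f $ prv i})"
  have J: "ideal.subspace J"
    unfolding J_def by (rule at_prime_subspace[OF P ideal.subspace_span])
  have in_I: "0 \<in> at_prime P (ideal.span (range (($) f)))"
    using ideal.subspace_0[OF at_prime_subspace[OF P ideal.subspace_span]] .
  obtain h a b where h: "f $ nxt i = h * a" "f $ prv i = h * b" "no_common_prime {a, b}"
    "a \<noteq> 0 \<or> b \<noteq> 0"
    by (rule gcd_split)
  have h0: "h \<noteq> 0"
  proof
    assume h0: "h = 0"
    then have "f $ i \<noteq> 0"
      using f(3) h all_nxt_prv[of "\<lambda>l. f $ l = 0" i] by (auto simp: Finite_Cartesian_Product.vec_eq_iff)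
    then obtain \<pi> where \<pi>: "prime_elem \<pi>" "\<pi> dvd f $ i"
      using prime_ideal_prime_factor[OF P _ f(1)] by metis
    then have "\<forall>c\<in>range (($) f). \<pi> dvd c"
      unfolding range_nth3[of f i] using h h0 by simp
    then show False using no_common_primeD[OF f(2) \<pi>(1)] by metis
  qed
  have "h \<notin> P"
  proof
    assume "h \<in> P"
    define v :: "'a ^ 3" where "v = (\<chi> l. if l = i then 0 else if l = nxt i then b else - a)"
    have v: "v $ i = 0" "v $ nxt i = b" "v $ prv i = - a" by (simp_all add: v_def)
    have "dot v f = 0" by (simp add: dot_expand[of _ _ i] v h)
    then have "v \<in> koszul_at P f" using V in_I v(1) by metis
    then obtain w z where w: "w \<notin> P" "w *s v = cross z f" by (rule koszul_atE)
    have "cross z f $ i = 0" "cross z f $ nxt i = w * b" "cross z f $ prv i = - (w * a)"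
      using v by (simp_all flip: w(2))
    then have z: "z $ nxt i * (h * b) = z $ prv i * (h * a)"
      "z $ prv i * f $ i - z $ i * (h * b) = w * b" "z $ i * (h * a) - z $ nxt i * f $ i = - (w * a)"
      by (simp_all add: cross_nth h)
    have "z $ nxt i * b = z $ prv i * a"
      using z(1) h0 by (simp add: mult.left_commute[of _ h])
    then obtain \<delta> where \<delta>: "z $ nxt i = \<delta> * a" "z $ prv i = \<delta> * b"
      using proportional_pair[OF h(3,4)] by metis
    have "w * b = (\<delta> * f $ i - z $ i * h) * b" "w * a = (\<delta> * f $ i - z $ i * h) * a"
      using z(2,3) unfolding \<delta> by (simp_all add: algebra_simps)
    then have "w = \<delta> * f $ i - z $ i * h" using h(4) by auto
    moreover have "\<delta> * f $ i - z $ i * h \<in> P"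
      by (intro prime_idealD(8)[OF P] prime_idealD(4)[OF P] f(1) \<open>h \<in> P\<close>)
    ultimately show False using w(1) by simp
  qed
  have "a \<in> P" "b \<in> P" using f(1)[of "nxt i"] f(1)[of "prv i"] \<open>h \<notin> P\<close> h
    by (auto dest: prime_idealD(3)[OF P])
  then obtain k where "f $ i ^ k \<in> at_prime P (ideal.span {a, b})"
    using nil[OF _ h(3) f(1)[of i]] by auto
  then obtain w where w: "w \<notin> P" "w * f $ i ^ k \<in> ideal.span {a, b}" by (rule at_primeE)
  then obtain p q where "w * f $ i ^ k = p * a + q * b" by (auto simp: ideal_span_pair)
  then have "(h * w) * f $ i ^ k = p * f $ nxt i + q * f $ prv i"
    by (simp add: h mult.assoc) (simp add: algebra_simps)
  then have pow: "f $ i ^ k \<in> J"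
    using \<open>h \<notin> P\<close> w(1) unfolding J_def
    by (intro at_primeI[of "h * w"]) (auto simp: ideal_span_pair dest: prime_idealD(3)[OF P])
  have "f $ i \<in> J"
  proof (rule power_descent[OF J _ pow])
    fix z assume "z * f $ i * f $ i \<in> J"
    then obtain w p q where w: "w \<notin> P" "w * (z * f $ i * f $ i) = p * f $ nxt i + q * f $ prv i"
      unfolding J_def by (auto elim!: at_primeE simp: ideal_span_pair)
    define v :: "'a ^ 3" where
      "v = (\<chi> l. if l = i then w * z * f $ i else if l = nxt i then - p else - q)"
    have v: "v $ i = w * z * f $ i" "v $ nxt i = - p" "v $ prv i = - q" by (simp_all add: v_def)
    have "dot v f = 0" using w(2) by (simp add: dot_expand[of _ _ i] v mult.assoc)
    moreover have "v $ i \<in> at_prime P (ideal.span (range (($) f)))"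
      unfolding v
      using subset_at_prime[OF P] ideal.span_scale[OF ideal.span_base[OF rangeI[of "($) f" i]]] by blast
    ultimately have "v \<in> koszul_at P f" by (rule V)
    then have "w * (z * f $ i) \<in> J"
      using koszul_at_entry[of v P f i] by (simp add: J_def v mult.assoc)
    then show "z * f $ i \<in> J" unfolding J_def by (rule at_prime_cancel[OF P w(1)])
  qed
  then show ?thesis by (simp add: J_def)
qed

text \<open>Redundancy gives \<open>I\<^sub>P = (f\<^sub>j, f\<^sub>k)\<^sub>P\<close>, so the \<open>i\<close>-th entry of \<open>a\<close> can be removed by a Koszul syzygy
  \<open>z \<times> f\<close>. The rest \<open>b\<close> is a relation between \<open>f\<^sub>j\<close> and \<open>f\<^sub>k\<close>, whose gcd is outside \<open>P\<close>: a prime of \<open>P\<close>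
  dividing both would divide the redundant \<open>f\<^sub>i\<close>, too.\<close>

lemma koszul_of_generator_redundant:
  fixes f :: "'a::ufd ^ 3"
  assumes P: "prime_ideal P" and f: "no_common_prime (range (($) f))" "f \<noteq> 0"
    and i: "f $ i \<in> at_prime P (ideal.span {f $ nxt i, f $ prv i})"
    and a: "dot a f = 0" "a $ i \<in> at_prime P (ideal.span (range (($) f)))"
  shows "a \<in> koszul_at P f"
proof -
  define J where "J = at_prime P (ideal.span {f $ nxt i, f $ prv i})"
  have J: "ideal.subspace J"
    unfolding J_def by (rule at_prime_subspace[OF P ideal.subspace_span])
  have "f $ nxt i \<in> J" "f $ prv i \<in> J"
    unfolding J_def by (rule subsetD[OF subset_at_prime[OF P]], simp add: ideal.span_base)+
  then have "range (($) f) \<subseteq> J" using i unfolding range_nth3[of f i] J_def by simp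
  then have span_J: "ideal.span (range (($) f)) \<subseteq> J" by (rule ideal.span_minimal[OF _ J])
  obtain u where u: "u \<notin> P" "u * a $ i \<in> J"
    using a(2) span_J by (auto elim!: at_primeE)
  then have "a $ i \<in> J" unfolding J_def using at_prime_cancel[OF P] by metis
  then obtain w p q where w: "w \<notin> P" "w * a $ i = p * f $ nxt i + q * f $ prv i"
    unfolding J_def by (auto elim!: at_primeE simp: ideal_span_pair)
  define z :: "'a ^ 3" where "z = (\<chi> l. if l = i then 0 else if l = nxt i then q else - p)"
  have z: "z $ i = 0" "z $ nxt i = q" "z $ prv i = - p" by (simp_all add: z_def)
  define b where "b = w *s a - cross z f"
  have b_i: "b $ i = 0" by (simp add: b_def cross_nth z w(2))
  have "dot b f = 0" by (simp add: b_def dot_diff dot_smult dot_cross a(1))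
  then have b: "b $ nxt i * f $ nxt i + b $ prv i * f $ prv i = 0"
    by (simp add: dot_expand[of _ _ i] b_i)
  obtain h c e where h: "f $ nxt i = h * c" "f $ prv i = h * e" "no_common_prime {c, e}"
    "c \<noteq> 0 \<or> e \<noteq> 0"
    by (rule gcd_split)
  obtain v s t where v: "v \<notin> P" "v * f $ i = s * f $ nxt i + t * f $ prv i"
    using i by (auto elim!: at_primeE simp: ideal_span_pair)
  have h0: "h \<noteq> 0"
  proof
    assume "h = 0"
    then have "f $ nxt i = 0" "f $ prv i = 0" "v * f $ i = 0" using h v by simp_all
    moreover have "v \<noteq> 0" using v(1) prime_idealD(6)[OF P] by auto
    ultimately have "\<forall>l. f $ l = 0" by (simp add: all_nxt_prv[of _ i])
    then show False using f(2) by (simp add: Finite_Cartesian_Product.vec_eq_iff)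
  qed
  have "h \<notin> P"
  proof
    assume "h \<in> P"
    then obtain \<pi> where \<pi>: "prime_elem \<pi>" "\<pi> \<in> P" "\<pi> dvd h"
      using prime_ideal_prime_factor[OF P h0] by metis
    have nx: "\<pi> dvd f $ nxt i" "\<pi> dvd f $ prv i" using \<pi>(3) h by (metis dvd_mult2)+
    then have "\<pi> dvd v * f $ i" unfolding v(2) by (intro dvd_add dvd_mult)
    moreover have "\<not> \<pi> dvd v"
    proof
      assume "\<pi> dvd v"
      then obtain v' where "v = \<pi> * v'" by (rule dvdE)
      then show False using v(1) prime_idealD(5)[OF P \<pi>(2)] by metis
    qed
    ultimately have "\<pi> dvd f $ i" using prime_elem_dvd_multD[OF \<pi>(1)] by metis
    then have "\<forall>c\<in>range (($) f). \<pi> dvd c"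
      unfolding range_nth3[of f i] using nx by simp
    then show False using no_common_primeD[OF f(1) \<pi>(1)] by metis
  qed
  have "h * (b $ nxt i * c + b $ prv i * e) = 0" using b by (simp add: h algebra_simps)
  then have "b $ prv i * e = (- b $ nxt i) * c" using h0 by (simp add: eq_neg_iff_add_eq_0 add.commute)
  then obtain \<delta> where \<delta>: "b $ prv i = \<delta> * c" "- b $ nxt i = \<delta> * e"
    using proportional_pair[OF h(3,4)] by metis
  have bn: "b $ nxt i = - (\<delta> * e)" using \<delta>(2) by (metis minus_minus)
  define y :: "'a ^ 3" where "y = (\<chi> l. if l = i then \<delta> else 0)"
  have y: "y $ i = \<delta>" "y $ nxt i = 0" "y $ prv i = 0" by (simp_all add: y_def)
  have "\<forall>l. (h *s b) $ l = cross y f $ l"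
    by (simp add: all_nxt_prv[of _ i] cross_nth y b_i bn \<delta>(1) h mult_ac)
  then have "h *s b = cross y f" by (simp add: Finite_Cartesian_Product.vec_eq_iff)
  then have "b \<in> koszul_at P f" by (rule koszul_atI[OF \<open>h \<notin> P\<close>])
  then have "b + cross z f \<in> koszul_at P f"
    by (rule koszul_at_add[OF P _ cross_in_koszul_at[OF P]])
  then show ?thesis using koszul_at_cancel[OF P w(1)] by (simp add: b_def)
qed

text \<open>An instance of the exchange of minimal generators in a local ring. Write the \<open>f\<^sub>i\<close> through
  \<open>p\<^sub>1, p\<^sub>2\<close> and conversely; the product \<open>M\<close> of the two coefficient matrices fixes \<open>(p\<^sub>1, p\<^sub>2)\<close> up to the
  multiplier \<open>w\<close>. As \<open>p\<^sub>1\<close> and \<open>p\<^sub>2\<close> are coprime at \<open>P\<close>, every relation between them has coefficients in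
  \<open>P\<close>, so \<open>M\<close> is congruent to \<open>w\<close> times the identity and its determinant is not in \<open>P\<close>. By the
  Cauchy-Binet formula some minor \<open>\<Delta> i\<close> is not in \<open>P\<close> either, and Cramer's rule
  expresses \<open>p\<^sub>1, p\<^sub>2\<close> through the two \<open>f\<close>s of that minor.\<close>

lemma generator_redundant_of_two_generated:
  fixes f :: "'a::ufd ^ 3"
  assumes P: "prime_ideal P"
    and f: "\<And>i. f $ i \<in> P" "no_common_prime (range (($) f))" "f \<noteq> 0"
    and p: "p1 \<in> ideal.span (range (($) f))" "p2 \<in> ideal.span (range (($) f))"
    and gen: "\<And>i. f $ i \<in> at_prime P (ideal.span {p1, p2})"
  shows "\<exists>i. f $ i \<in> at_prime P (ideal.span {f $ nxt i, f $ prv i})"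
proof -
  obtain w where w: "w \<notin> P" "\<And>i. w * f $ i \<in> ideal.span {p1, p2}"
    using at_prime_common_denominator[OF P ideal.subspace_span, of "($) f" "{p1, p2}"] gen by metis
  then obtain c c' where c: "\<And>i. w * f $ i = c i * p1 + c' i * p2"
    unfolding ideal_span_pair by metis
  obtain e e' where e: "p1 = dot e f" "p2 = dot e' f" using p unfolding ideal_span_range by blast
  have w0: "w \<noteq> 0" using w(1) prime_idealD(6)[OF P] by auto
  have range_P: "ideal.span (range (($) f)) \<subseteq> P"
    by (rule prime_ideal_span[OF P]) (use f(1) in auto)
  define M11 where "M11 = (\<Sum>i\<in>UNIV. e $ i * c i)"
  define M12 where "M12 = (\<Sum>i\<in>UNIV. e $ i * c' i)"
  define M21 where "M21 = (\<Sum>i\<in>UNIV. e' $ i * c i)"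
  define M22 where "M22 = (\<Sum>i\<in>UNIV. e' $ i * c' i)"
  have "w * dot u f = (\<Sum>i\<in>UNIV. u $ i * c i) * p1 + (\<Sum>i\<in>UNIV. u $ i * c' i) * p2" for u :: "'a ^ 3"
  proof -
    have "w * dot u f = (\<Sum>i\<in>UNIV. u $ i * (w * f $ i))"
      by (simp add: dot_def sum_distrib_left mult_ac)
    also have "\<dots> = (\<Sum>i\<in>UNIV. u $ i * c i * p1 + u $ i * c' i * p2)"
      by (simp add: c algebra_simps)
    finally show ?thesis by (simp add: sum.distrib sum_distrib_right)
  qed
  then have M: "w * p1 = M11 * p1 + M12 * p2" "w * p2 = M21 * p1 + M22 * p2"
    by (simp_all add: e M11_def M12_def M21_def M22_def)
  obtain h a b where h: "p1 = h * a" "p2 = h * b" "no_common_prime {a, b}" "a \<noteq> 0 \<or> b \<noteq> 0"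
    by (rule gcd_split)
  obtain l where l: "f $ l \<noteq> 0"
    using f(3) by (auto simp: Finite_Cartesian_Product.vec_eq_iff)
  have h0: "h \<noteq> 0"
  proof
    assume "h = 0"
    then have "w * f $ l = 0" using c[of l] h by simp
    then show False using l w0 by simp
  qed
  have "h \<notin> P"
  proof
    assume "h \<in> P"
    then obtain \<pi> where \<pi>: "prime_elem \<pi>" "\<pi> \<in> P" "\<pi> dvd h"
      using prime_ideal_prime_factor[OF P h0] by metis
    have "\<not> \<pi> dvd w"
    proof
      assume "\<pi> dvd w"
      then obtain v' where "w = \<pi> * v'" by (rule dvdE)
      then show False using w(1) prime_idealD(5)[OF P \<pi>(2)] by metis
    qed
    moreover have "\<pi> dvd w * f $ i" for i
      unfolding c h using \<pi>(3) by (intro dvd_add dvd_mult dvd_mult2)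
    ultimately have "\<forall>i. \<pi> dvd f $ i" using prime_elem_dvd_multD[OF \<pi>(1)] by metis
    then show False using no_common_primeD[OF f(2) \<pi>(1)] by blast
  qed
  have ab: "a \<in> P" "b \<in> P"
    using p range_P h \<open>h \<notin> P\<close> prime_idealD(3)[OF P] by (metis subsetD)+
  have "h * ((w - M11) * a) = h * (M12 * b)" using M(1) by (simp add: h algebra_simps)
  then have "M12 * b = (w - M11) * a" using h0 by simp
  then obtain \<delta> where \<delta>: "M12 = \<delta> * a" "w - M11 = \<delta> * b" using proportional_pair[OF h(3,4)] by metis
  have "h * ((w - M22) * b) = h * (M21 * a)" using M(2) by (simp add: h algebra_simps)
  then have "(w - M22) * b = M21 * a" using h0 by simp
  then obtain \<epsilon> where \<epsilon>: "w - M22 = \<epsilon> * a" "M21 = \<epsilon> * b" using proportional_pair[OF h(3,4)] by metis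
  have M_P: "M12 \<in> P" "w - M11 \<in> P" "w - M22 \<in> P"
    unfolding \<delta> \<epsilon> using ab by (simp_all add: prime_idealD(4)[OF P])
  have "M11 \<notin> P" "M22 \<notin> P"
    using M_P w(1) prime_idealD(7)[OF P, of "w - M11" M11] prime_idealD(7)[OF P, of "w - M22" M22] by auto
  then have "M11 * M22 \<notin> P" using prime_idealD(3)[OF P] by metis
  moreover have "M12 * M21 \<in> P" using M_P prime_idealD(5)[OF P] by metis
  ultimately have det: "M11 * M22 - M12 * M21 \<notin> P"
    using prime_idealD(7)[OF P, of "M11 * M22 - M12 * M21" "M12 * M21"] by auto
  define \<Delta> where "\<Delta> i = c (nxt i) * c' (prv i) - c (prv i) * c' (nxt i)" for i
  define E where "E i = e $ nxt i * e' $ prv i - e $ prv i * e' $ nxt i" for i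
  \<comment> \<open>The Cauchy-Binet formula for the \<open>2 \<times> 3\<close> and \<open>3 \<times> 2\<close> coefficient matrices.\<close>
  have "M11 * M22 - M12 * M21 = (\<Sum>i\<in>UNIV. E i * \<Delta> i)"
    unfolding M11_def M12_def M21_def M22_def UNIV_nxt_prv[of 0]
    by (simp add: E_def \<Delta>_def algebra_simps)
  moreover have "(\<Sum>i\<in>UNIV. E i * \<Delta> i) \<in> P" if "\<forall>i. \<Delta> i \<in> P"
    using that by (intro ideal.subspace_sum prime_idealD(1,4)[OF P]) auto
  ultimately obtain i where i: "\<Delta> i \<notin> P" using det by metis
  have "\<Delta> i * p1 = (w * c' (prv i)) * f $ nxt i + (- (w * c' (nxt i))) * f $ prv i"
  proof -
    have "\<Delta> i * p1 = c' (prv i) * (c (nxt i) * p1 + c' (nxt i) * p2) - c' (nxt i) * (c (prv i) * p1 + c' (prv i) * p2)"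
      by (simp add: \<Delta>_def algebra_simps)
    then show ?thesis unfolding c[symmetric] by (simp add: algebra_simps)
  qed
  moreover have "\<Delta> i * p2 = (- (w * c (prv i))) * f $ nxt i + (w * c (nxt i)) * f $ prv i"
  proof -
    have "\<Delta> i * p2 = c (nxt i) * (c (prv i) * p1 + c' (prv i) * p2) - c (prv i) * (c (nxt i) * p1 + c' (nxt i) * p2)"
      by (simp add: \<Delta>_def algebra_simps)
    then show ?thesis unfolding c[symmetric] by (simp add: algebra_simps)
  qed
  ultimately have \<Delta>p: "\<Delta> i * p1 \<in> ideal.span {f $ nxt i, f $ prv i}" "\<Delta> i * p2 \<in> ideal.span {f $ nxt i, f $ prv i}"
    unfolding ideal_span_pair by metis+
  have "c i * (\<Delta> i * p1) + c' i * (\<Delta> i * p2) \<in> ideal.span {f $ nxt i, f $ prv i}"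
    by (rule ideal.span_add[OF ideal.span_scale[OF \<Delta>p(1)] ideal.span_scale[OF \<Delta>p(2)]])
  moreover have "c i * (\<Delta> i * p1) + c' i * (\<Delta> i * p2) = (\<Delta> i * w) * f $ i"
    using arg_cong[OF c[of i], of "\<lambda>t. \<Delta> i * t"] by (simp add: algebra_simps)
  ultimately have "f $ i \<in> at_prime P (ideal.span {f $ nxt i, f $ prv i})"
    using i w(1) prime_idealD(3)[OF P, of "\<Delta> i" w] by (intro at_primeI[of "\<Delta> i * w"]) auto
  then show ?thesis ..
qed

section \<open>Maximal ideals of a polynomial ring in two variables\<close>

lemma ideal_power_sum:
  fixes a b :: "'a::comm_ring_1"
  assumes I: "ideal.subspace I" and "a ^ m \<in> I" "b ^ n \<in> I"
  shows "(a + b) ^ (m + n) \<in> I"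
proof -
  have "of_nat (m + n choose k) * a ^ k * b ^ (m + n - k) \<in> I" for k
  proof (cases "m \<le> k")
    case True
    then have "a ^ k = a ^ (k - m) * a ^ m" by (simp flip: power_add)
    then have "of_nat (m + n choose k) * a ^ k * b ^ (m + n - k) =
      (of_nat (m + n choose k) * a ^ (k - m) * b ^ (m + n - k)) * a ^ m"
      by (simp add: mult_ac)
    then show ?thesis using ideal.subspace_scale[OF I assms(2)] by metis
  next
    case False
    then have "b ^ (m + n - k) = b ^ (m - k) * b ^ n" by (simp flip: power_add)
    then have "of_nat (m + n choose k) * a ^ k * b ^ (m + n - k) =
      (of_nat (m + n choose k) * a ^ k * b ^ (m - k)) * b ^ n"
      by (simp add: mult_ac)
    then show ?thesis using ideal.subspace_scale[OF I assms(3)] by metis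
  qed
  then show ?thesis unfolding binomial_ring by (intro ideal.subspace_sum[OF I])
qed

lemma pseudo_division:
  fixes p g :: "'a::idom poly"
  assumes "g \<noteq> 0"
  obtains k q r where "smult (lead_coeff g ^ k) p = g * q + r" "r = 0 \<or> degree r < degree g"
proof -
  obtain q r where "pseudo_divmod p g = (q, r)" by fastforce
  from pseudo_divmod[OF assms this] that show ?thesis by blast
qed

lemma degree_unit: "u dvd 1 \<Longrightarrow> degree u = 0" for u :: "'a::idom poly"
  by (elim dvdE) (metis add_is_0 degree_1 degree_mult_eq mult_eq_0_iff zero_neq_one)

text \<open>Primes of degree zero are constants, and a product of constants is constant.\<close>

lemma prime_factor_positive_degree:
  fixes e :: "'a::ufd poly"
  assumes "degree e > 0"
  shows "\<exists>\<pi>. prime_elem \<pi> \<and> \<pi> dvd e \<and> degree \<pi> > 0"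
proof -
  have "e \<noteq> 0" using assms by auto
  then show ?thesis using assms
  proof (induction e rule: ufd_induct)
    case (unit u)
    then show ?case using degree_unit[of u] by simp
  next
    case (prime \<pi> c)
    have "\<pi> \<noteq> 0" using prime.hyps(1) by (rule prime_elem_not_zeroI)
    then have "degree \<pi> + degree c > 0" using prime.prems prime.hyps(2) degree_mult_eq by metis
    then consider "degree \<pi> > 0" | "degree c > 0" by linarith
    then show ?case
    proof cases
      case 1
      then show ?thesis using prime.hyps(1) by (metis dvd_triv_left)
    next
      case 2
      then show ?thesis using prime.IH by (metis dvd_mult)
    qed
  qed
qed

lemma not_dvd_smult_prime:
  fixes \<pi> p :: "'a::idom poly"
  assumes "prime_elem \<pi>" "degree \<pi> > 0" "a \<noteq> 0" "\<pi> dvd smult a p"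
  shows "\<pi> dvd p"
proof -
  have "\<pi> dvd [:a:] * p" using assms(4) by simp
  moreover have "\<not> \<pi> dvd [:a:]"
    using assms(2,3) by (metis degree_pCons_0 dvd_const less_nat_zero_code pCons_eq_0_iff)
  ultimately show ?thesis using prime_elem_dvd_multD[OF assms(1)] by metis
qed

lemma exists_prime_elem: "\<exists>\<pi> :: 'a::ufd poly. prime_elem \<pi>"
  using prime_factor_positive_degree[of "[:0, 1:]"] by force

text \<open>Take a nonzero \<open>e\<close> of least degree in the ideal. Pseudo-division leaves no remainder, so \<open>e\<close> divides
  every element of \<open>F\<close> up to a nonzero constant factor. If \<open>e\<close> had positive degree, one of its prime
  factors of positive degree would divide all of \<open>F\<close>. This replaces the Gauss lemma and Bezout's
  identity over the field of fractions.\<close>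

lemma elimination:
  fixes F :: "'a::ufd poly set"
  assumes "no_common_prime F"
  obtains c where "c \<noteq> 0" "[:c:] \<in> ideal.span F"
proof -
  obtain p where "p \<in> F" "p \<noteq> 0"
    using exists_prime_elem no_common_primeD[OF assms] by (metis dvd_0_right)
  then have "\<exists>e. e \<in> ideal.span F \<and> e \<noteq> 0" using ideal.span_base by metis
  then obtain e where e: "e \<in> ideal.span F" "e \<noteq> 0"
    and min: "\<And>e'. e' \<in> ideal.span F \<Longrightarrow> e' \<noteq> 0 \<Longrightarrow> degree e \<le> degree e'"
    using ex_has_least_nat[of "\<lambda>e. e \<in> ideal.span F \<and> e \<noteq> 0" _ degree] by metis
  show ?thesis
  proof (cases "degree e = 0")
    case True
    then obtain c where "e = [:c:]" by (rule degree_eq_zeroE)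
    then show ?thesis using e that by auto
  next
    case False
    then obtain \<pi> where \<pi>: "prime_elem \<pi>" "\<pi> dvd e" "degree \<pi> > 0"
      using prime_factor_positive_degree by auto
    have "\<pi> dvd p" if p: "p \<in> F" for p
    proof -
      obtain k q r where r: "smult (lead_coeff e ^ k) p = e * q + r" "r = 0 \<or> degree r < degree e"
        by (rule pseudo_division[OF e(2)])
      have "smult (lead_coeff e ^ k) p \<in> ideal.span F"
        using ideal.span_scale[OF ideal.span_base[OF p], of "[:lead_coeff e ^ k:]"] by simp
      moreover have "e * q \<in> ideal.span F"
        using ideal.span_scale[OF e(1), of q] by (simp add: mult.commute)
      ultimately have "smult (lead_coeff e ^ k) p - e * q \<in> ideal.span F" by (rule ideal.span_diff)
      then have "r \<in> ideal.span F" using r(1) by simp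
      then have "r = 0" using min r(2) by force
      then have "\<pi> dvd smult (lead_coeff e ^ k) p" using r(1) \<pi>(2) by (metis add_0_right dvd_mult2)
      moreover have "lead_coeff e ^ k \<noteq> 0" using e(2) by simp
      ultimately show ?thesis using not_dvd_smult_prime[OF \<pi>(1,3)] by metis
    qed
    then show ?thesis using no_common_primeD[OF assms \<pi>(1)] by metis
  qed
qed

lemma prime_not_dvd_outside: "prime_ideal P \<Longrightarrow> \<pi> \<in> P \<Longrightarrow> w \<notin> P \<Longrightarrow> \<not> \<pi> dvd w"
  by (metis dvd_def prime_idealD(5))

text \<open>The assumption on constants makes \<open>P\<close> a prime of the plane over the field of fractions of the constants;
  nonzero constants act as units at \<open>P\<close>. The first generator \<open>x\<close> is an element of least degree in
  the contraction of \<open>P\<close> to the polynomials in the inner variable \<open>X\<close>. The second one, \<open>h\<close>, has least degree in the outer variable among the elements of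
  \<open>P\<close> outside \<open>G = (x)\<^sub>P\<close>. Its leading coefficient is a unit at \<open>P\<close>, since otherwise the leading
  term could be removed modulo \<open>x\<close>. Division by \<open>h\<close> thus leaves remainders in \<open>G\<close>.

  For the powers, elimination puts a nonzero polynomial in \<open>X\<close> alone into the ideal of \<open>F\<close>, and it is a
  power of \<open>x\<close> up to units at \<open>P\<close>. Repeated division of some \<open>e \<in> F\<close> outside \<open>G\<close> by \<open>h\<close> shows that \<open>e\<close>
  is a power of \<open>h\<close> up to units and modulo \<open>x\<close>.\<close>

theorem plane_point_structure:
  fixes P F :: "'c::ufd poly poly set"
  assumes P: "prime_ideal P"
    and const: "\<And>c. [:[:c:]:] \<in> P \<Longrightarrow> c = 0"
    and F: "F \<subseteq> P" "no_common_prime F"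
  shows "\<exists>x\<in>P. \<exists>y\<in>P. P \<subseteq> at_prime P (ideal.span {x, y}) \<and>
     (\<forall>q\<in>P. \<exists>k. q ^ k \<in> at_prime P (ideal.span F))"
proof -
  have notP: "w * w' \<notin> P" if "w \<notin> P" "w' \<notin> P" for w w' using that prime_idealD(3)[OF P] by metis
  define I where "I = at_prime P (ideal.span F)"
  have I: "ideal.subspace I"
    unfolding I_def by (rule at_prime_subspace[OF P ideal.subspace_span])
  have F_I: "F \<subseteq> I" 
    unfolding I_def using subset_at_prime[OF P, of "ideal.span F"] by (auto intro: ideal.span_base)
  obtain c0 where c0: "c0 \<noteq> 0" "[:c0:] \<in> ideal.span F" using elimination[OF F(2)] by metis
  then have c0_P: "[:c0:] \<in> P" using prime_ideal_span[OF P F(1)] by blast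
  have c0_I: "[:c0:] \<in> I" unfolding I_def using subset_at_prime[OF P] c0 by blast
  obtain g where g: "[:g:] \<in> P" "g \<noteq> 0"
    and g_min: "\<And>u. [:u:] \<in> P \<Longrightarrow> u \<noteq> 0 \<Longrightarrow> degree g \<le> degree u"
    using ex_has_least_nat[of "\<lambda>u. [:u:] \<in> P \<and> u \<noteq> 0" c0 degree] c0_P c0(1) by metis
  have lead: "[:[:lead_coeff g ^ k:]:] \<notin> P" for k
    using const[of "lead_coeff g ^ k"] g(2) by auto
  have g_div: "\<exists>k q. smult (lead_coeff g ^ k) u = g * q" if u: "[:u:] \<in> P" for u
  proof -
    obtain k q r where r: "smult (lead_coeff g ^ k) u = g * q + r" "r = 0 \<or> degree r < degree g"
      by (rule pseudo_division[OF g(2)])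
    have "[:smult (lead_coeff g ^ k) u:] \<in> P"
      using prime_idealD(4)[OF P u, of "[:[:lead_coeff g ^ k:]:]"] by simp
    moreover have "[:g * q:] \<in> P"
      using prime_idealD(5)[OF P g(1), of "[:q:]"] by (simp add: mult.commute)
    ultimately have "[:smult (lead_coeff g ^ k) u:] - [:g * q:] \<in> P" by (rule prime_idealD(8)[OF P])
    then have "[:r:] \<in> P" using r(1) by simp
    then have "r = 0" using g_min r(2) by force
    then show ?thesis using r(1) by auto
  qed
  have deg_g: "degree g > 0"
  proof (rule ccontr)
    assume "\<not> degree g > 0"
    then obtain a where "g = [:a:]" by (metis degree_eq_zeroE gr0I)
    then show False using const g by auto
  qed
  have g_power: "\<exists>c M u'. [:[:c:]:] \<notin> P \<and> smult c u = g ^ M * u' \<and> [:u':] \<notin> P" if "u \<noteq> 0" for u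
    using that
  proof (induction "degree u" arbitrary: u rule: less_induct)
    case less
    show ?case
    proof (cases "[:u:] \<in> P")
      case False
      have "[:[:1:]:] \<notin> P" using prime_idealD(2)[OF P] by (simp flip: one_pCons)
      then show ?thesis using False
        by (intro exI[of _ 1] exI[of _ 0] exI[of _ u]) simp
    next
      case True
      then obtain k q where q: "smult (lead_coeff g ^ k) u = g * q" using g_div by metis
      have "q \<noteq> 0" using q less.prems g(2) by auto
      have "degree u = degree (g * q)"
        using g(2) by (simp flip: q)
      then have "degree q < degree u" using deg_g \<open>q \<noteq> 0\<close> g(2) by (simp add: degree_mult_eq)
      then obtain c M u' where IH: "[:[:c:]:] \<notin> P" "smult c q = g ^ M * u'" "[:u':] \<notin> P"
        using less.hyps \<open>q \<noteq> 0\<close> by metis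
      have "smult (c * lead_coeff g ^ k) u = smult c (g * q)" by (simp flip: q)
      also have "\<dots> = g ^ Suc M * u'" using arg_cong[OF IH(2), of "\<lambda>t. g * t"] by (simp add: mult_ac)
      finally have eq: "smult (c * lead_coeff g ^ k) u = g ^ Suc M * u'" .
      have "[:[:c * lead_coeff g ^ k:]:] \<notin> P" using notP[OF IH(1) lead[of k]] by (simp add: mult.commute)
      then show ?thesis using eq IH(3) by blast
    qed
  qed
  define x where "x = [:g:]"
  have x: "x \<in> P" using g x_def by simp
  have x_nil: "\<exists>M. x ^ M \<in> I"
  proof -
    obtain c M u' where u: "[:[:c:]:] \<notin> P" "smult c c0 = g ^ M * u'" "[:u':] \<notin> P"
      using g_power[OF c0(1)] by metis
    have "[:u':] * x ^ M = [:[:c:]:] * [:c0:]"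
      using u(2) by (simp add: x_def poly_const_pow mult.commute)
    also have "\<dots> \<in> I" by (rule ideal.subspace_scale[OF I c0_I])
    finally have "x ^ M \<in> I" unfolding I_def by (rule at_prime_cancel[OF P u(3)])
    then show ?thesis ..
  qed
  define G where "G = at_prime P (ideal.span {x})"
  have G: "ideal.subspace G"
    unfolding G_def by (rule at_prime_subspace[OF P ideal.subspace_span])
  have G_mult: "x * z \<in> G" for z
  proof -
    have "x * z \<in> ideal.span {x}"
      using ideal.span_scale[OF ideal.span_base, of x "{x}" z] by (simp add: mult.commute)
    then show ?thesis unfolding G_def by (rule subsetD[OF subset_at_prime[OF P]])
  qed
  have G_E: "\<exists>w z. w \<notin> P \<and> w * q = z * x" if "q \<in> G" for q
    using that unfolding G_def at_prime_def by (auto simp: ideal.span_singleton)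
  obtain e0 where e0: "e0 \<in> F" "e0 \<notin> G"
  proof -
    have "x \<noteq> 0" using g(2) by (simp add: x_def)
    then obtain \<pi> where \<pi>: "prime_elem \<pi>" "\<pi> \<in> P" "\<pi> dvd x"
      using prime_ideal_prime_factor[OF P _ x] by metis
    have "\<pi> dvd q" if "q \<in> G" for q
    proof -
      obtain w z where w: "w \<notin> P" "w * q = z * x" using G_E[OF \<open>q \<in> G\<close>] by metis
      then have "\<pi> dvd w * q" using \<pi>(3) by (metis dvd_mult)
      then show ?thesis
        using prime_elem_dvd_multD[OF \<pi>(1)] prime_not_dvd_outside[OF P \<pi>(2) w(1)] by metis
    qed
    then show ?thesis using no_common_primeD[OF F(2) \<pi>(1)] that by metis
  qed
  then obtain h where h: "h \<in> P" "h \<notin> G"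
    and h_min: "\<And>q. q \<in> P \<Longrightarrow> q \<notin> G \<Longrightarrow> degree h \<le> degree q"
    using ex_has_least_nat[of "\<lambda>q. q \<in> P \<and> q \<notin> G" e0 degree] F(1) by blast
  have h0: "h \<noteq> 0" using h(2) ideal.subspace_0[OF G] by metis
  have lead_h: "[:lead_coeff h:] \<notin> P"
  proof
    assume "[:lead_coeff h:] \<in> P"
    then obtain k q where q: "smult (lead_coeff g ^ k) (lead_coeff h) = g * q" using g_div by metis
    define c where "c = [:[:lead_coeff g ^ k:]:]"
    \<comment> \<open>The leading term of \<open>h\<close> cancels, and \<open>h'\<close> is too small to be outside \<open>G\<close>.\<close>
    define h' where "h' = c * h - x * monom q (degree h)"
    have c: "c \<notin> P" using lead c_def by simp
    have "h' \<in> P"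
      unfolding h'_def using h(1) x prime_idealD[OF P] by metis
    have "coeff h' (degree h) = 0"
      using q by (simp add: h'_def c_def x_def)
    moreover have "degree h' \<le> degree h"
      unfolding h'_def c_def x_def
      by (intro degree_diff_le) (simp_all add: degree_monom_le)
    ultimately have "h' = 0 \<or> degree h' < degree h"
      by (metis eq_zero_or_degree_less)
    then have "h' \<in> G"
      using h_min \<open>h' \<in> P\<close> ideal.subspace_0[OF G] by force
    then have "h' + x * monom q (degree h) \<in> G" by (rule ideal.subspace_add[OF G _ G_mult])
    then have "c * h \<in> G" by (simp add: h'_def)
    then show False using at_prime_cancel[OF P c] h(2) unfolding G_def by metis
  qed
  have lead_hk: "[:lead_coeff h ^ k:] \<notin> P" for k
    using prime_ideal_power[OF P, of "[:lead_coeff h:]" k] lead_h by (auto simp: poly_const_pow)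
  have deg_h: "degree h > 0"
  proof (rule ccontr)
    assume "\<not> degree h > 0"
    then obtain a where "h = [:a:]" by (metis degree_eq_zeroE gr0I)
    then show False using lead_h h(1) by simp
  qed
  have division: "\<exists>k \<alpha> r. [:lead_coeff h ^ k:] * q = h * \<alpha> + r \<and> r \<in> G \<and> (r = 0 \<or> degree r < degree h)"
    if q: "q \<in> P" for q
  proof -
    obtain k \<alpha> r where r: "smult (lead_coeff h ^ k) q = h * \<alpha> + r" "r = 0 \<or> degree r < degree h"
      by (rule pseudo_division[OF h0])
    then have "r = [:lead_coeff h ^ k:] * q - h * \<alpha>" by simp
    also have "\<dots> \<in> P" using q h(1) prime_idealD(4,5,8)[OF P] by metis
    finally have "r \<in> G" using h_min r(2) ideal.subspace_0[OF G] by force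
    then show ?thesis using r by auto
  qed
  have gen: "P \<subseteq> at_prime P (ideal.span {x, h})"
  proof
    fix q assume "q \<in> P"
    then obtain k \<alpha> r where r: "[:lead_coeff h ^ k:] * q = h * \<alpha> + r" "r \<in> G" using division by metis
    obtain w z where w: "w \<notin> P" "w * r = z * x" using G_E[OF r(2)] by metis
    have "(w * [:lead_coeff h ^ k:]) * q = w * (h * \<alpha> + r)" by (simp only: mult.assoc r(1))
    also have "\<dots> = z * x + (w * \<alpha>) * h" using w(2) by (simp add: algebra_simps)
    finally have "(w * [:lead_coeff h ^ k:]) * q \<in> ideal.span {x, h}"
      unfolding ideal_span_pair by metis
    then show "q \<in> at_prime P (ideal.span {x, h})" by (rule at_primeI[OF notP[OF w(1) lead_hk]])
  qed
  have h_power: "\<exists>a w w' z. w \<notin> P \<and> w' \<notin> P \<and> w' * e = h ^ a * w + x * z" if "e \<notin> G" for e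
    using that
  proof (induction "degree e" arbitrary: e rule: less_induct)
    case less
    show ?case
    proof (cases "e \<in> P")
      case False
      then show ?thesis using prime_idealD(2)[OF P]
        by (intro exI[of _ 0] exI[of _ e] exI[of _ 1] exI[of _ 0]) simp
    next
      case True
      then obtain k \<alpha> r where r: "[:lead_coeff h ^ k:] * e = h * \<alpha> + r" "r \<in> G"
        "r = 0 \<or> degree r < degree h"
        using division by metis
      have \<alpha>G: "\<alpha> \<notin> G"
      proof
        assume "\<alpha> \<in> G"
        then have "h * \<alpha> + r \<in> G" by (intro ideal.subspace_add[OF G] ideal.subspace_scale[OF G] r(2))
        then have "[:lead_coeff h ^ k:] * e \<in> G" by (simp only: r(1))
        then show False using at_prime_cancel[OF P lead_hk] less.prems unfolding G_def by metis
      qed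
      have "\<alpha> \<noteq> 0" using \<alpha>G ideal.subspace_0[OF G] by metis
      have "degree \<alpha> < degree e"
      proof -
        have "degree (h * \<alpha>) = degree h + degree \<alpha>" using h0 \<open>\<alpha> \<noteq> 0\<close> by (rule degree_mult_eq)
        moreover have "degree (h * \<alpha> + r) = degree (h * \<alpha>)"
        proof -
          have "r = 0 \<or> degree r < degree (h * \<alpha>)" using r(3) calculation by linarith
          then show ?thesis using degree_add_eq_left[of r "h * \<alpha>"] by auto
        qed
        moreover have "degree ([:lead_coeff h ^ k:] * e) = degree e" using h0 by simp
        then have "degree e = degree (h * \<alpha> + r)" by (simp only: r(1))
        ultimately show ?thesis using deg_h by linarith
      qed
      then obtain a w w' z where IH: "w \<notin> P" "w' \<notin> P" "w' * \<alpha> = h ^ a * w + x * z"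
        using less.hyps \<alpha>G by metis
      obtain v y where v: "v \<notin> P" "v * r = y * x" using G_E[OF r(2)] by metis
      have "(w' * v * [:lead_coeff h ^ k:]) * e = w' * v * (h * \<alpha> + r)"
        by (simp only: mult.assoc r(1))
      also have "\<dots> = v * h * (w' * \<alpha>) + w' * (v * r)" by (simp add: algebra_simps)
      also have "\<dots> = h ^ Suc a * (v * w) + x * (v * h * z + w' * y)"
        unfolding IH(3) v(2) by (simp add: algebra_simps)
      finally show ?thesis using notP IH(1,2) v(1) lead_hk by metis
    qed
  qed
  obtain M where M: "x ^ M \<in> I" using x_nil by metis
  have h_nil: "\<exists>N. h ^ N \<in> I"
  proof -
    obtain a w w' z where w: "w \<notin> P" "w' \<notin> P" "w' * e0 = h ^ a * w + x * z"
      using h_power[OF e0(2)] by metis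
    have "(w' * e0) ^ 1 \<in> I" using ideal.subspace_scale[OF I subsetD[OF F_I e0(1)]] by simp
    moreover have "(- z * x) ^ M \<in> I"
      unfolding power_mult_distrib by (rule ideal.subspace_scale[OF I M])
    ultimately have "(w' * e0 + - z * x) ^ (1 + M) \<in> I" by (rule ideal_power_sum[OF I])
    moreover have "w' * e0 + - z * x = w * h ^ a"
      unfolding w(3) by (simp add: algebra_simps)
    ultimately have "w ^ (1 + M) * h ^ (a * (1 + M)) \<in> I" by (simp only: power_mult_distrib power_mult)
    moreover have "w ^ (1 + M) \<notin> P" using prime_ideal_power[OF P] w(1) by metis
    ultimately have "h ^ (a * (1 + M)) \<in> I" unfolding I_def using at_prime_cancel[OF P] by metis
    then show ?thesis ..
  qed
  then obtain N where N: "h ^ N \<in> I" by metis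
  have "\<exists>k. q ^ k \<in> I" if q: "q \<in> P" for q
  proof -
    obtain w a b where w: "w \<notin> P" "w * q = a * x + b * h"
      using gen q by (auto elim!: at_primeE simp: ideal_span_pair dest!: subsetD)
    have "(a * x) ^ M \<in> I" "(b * h) ^ N \<in> I"
      unfolding power_mult_distrib by (intro ideal.subspace_scale[OF I] M N)+
    then have "(w * q) ^ (M + N) \<in> I" unfolding w(2) by (rule ideal_power_sum[OF I])
    then have "w ^ (M + N) * q ^ (M + N) \<in> I" by (simp only: power_mult_distrib)
    moreover have "w ^ (M + N) \<notin> P" using prime_ideal_power[OF P] w(1) by metis
    ultimately show ?thesis unfolding I_def using at_prime_cancel[OF P] by metis
  qed
  then show ?thesis using x h(1) gen unfolding I_def by metis
qed

text \<open>A common factor of \<open>x\<close> and \<open>y\<close> is a unit at \<open>P\<close>: otherwise one prime element would divide everything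
  in \<open>P\<close>, in particular \<open>F\<close>.\<close>

lemma local_parameters_exist:
  fixes P F :: "'c::ufd poly set"
  assumes P: "prime_ideal P" and F: "F \<subseteq> P" "no_common_prime F"
    and xy: "x \<in> P" "y \<in> P" "P \<subseteq> at_prime P (ideal.span {x, y})"
  shows "\<exists>x y. local_parameters P x y"
proof -
  obtain h a b where h: "x = h * a" "y = h * b" "no_common_prime {a, b}" "a \<noteq> 0 \<or> b \<noteq> 0"
    by (rule gcd_split)
  have mult_h: "\<exists>w p. w \<notin> P \<and> w * q = p * h" if "q \<in> P" for q
  proof -
    obtain w p p' where "w \<notin> P" "w * q = p * x + p' * y"
      using xy(3) \<open>q \<in> P\<close> by (auto elim!: at_primeE simp: ideal_span_pair dest!: subsetD)
    then have "w * q = (p * a + p' * b) * h" by (simp add: h algebra_simps)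
    then show ?thesis using \<open>w \<notin> P\<close> by metis
  qed
  have "h \<notin> P"
  proof
    assume "h \<in> P"
    obtain \<pi> where \<pi>: "prime_elem \<pi>" "\<forall>q\<in>P. \<pi> dvd q"
    proof (cases "h = 0")
      case True
      obtain \<pi> :: "'c poly" where \<pi>: "prime_elem \<pi>" using exists_prime_elem by metis
      have "q = 0" if "q \<in> P" for q
        using mult_h[OF that] True prime_idealD(6)[OF P] by (metis mult_eq_0_iff mult_zero_right)
      then show ?thesis using that \<pi> by (metis dvd_0_right)
    next
      case False
      then obtain \<pi> where \<pi>: "prime_elem \<pi>" "\<pi> \<in> P" "\<pi> dvd h"
        using prime_ideal_prime_factor[OF P False \<open>h \<in> P\<close>] by metis
      have "\<pi> dvd q" if q: "q \<in> P" for q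
      proof -
        obtain w p where w: "w \<notin> P" "w * q = p * h" using mult_h[OF q] by metis
        then have "\<pi> dvd w * q" using \<pi>(3) by (metis dvd_mult)
        then show ?thesis
          using prime_elem_dvd_multD[OF \<pi>(1)] prime_not_dvd_outside[OF P \<pi>(2) w(1)] by metis
      qed
      then show ?thesis using that \<pi>(1) by metis
    qed
    then show False using no_common_primeD[OF F(2) \<pi>(1)] F(1) by (metis subsetD)
  qed
  then have ab: "a \<in> P" "b \<in> P" using xy(1,2) h prime_idealD(3)[OF P] by metis+
  have sub: "{x, y} \<subseteq> ideal.span {a, b}"
    unfolding h by (auto intro!: ideal.span_scale intro: ideal.span_base)
  have "P \<subseteq> at_prime P (ideal.span {a, b})"
    by (rule subset_trans[OF xy(3) at_prime_span_mono[OF sub]])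
  then show ?thesis using ab h(3,4) unfolding local_parameters_def by metis
qed

section \<open>Evaluation homomorphisms\<close>

text \<open>The extension of a ring homomorphism to polynomials that sends the variable to \<open>a\<close>.\<close>

definition poly_ext :: "('a::comm_ring_1 \<Rightarrow> 'b::comm_ring_1) \<Rightarrow> 'b \<Rightarrow> 'a poly \<Rightarrow> 'b" where
  "poly_ext h a p = poly (map_poly h p) a"

lemma poly_ext_hom:
  assumes "comm_ring_hom h"
  shows "comm_ring_hom (poly_ext h a)"
proof -
  interpret h: comm_ring_hom h by fact
  interpret m: map_poly_comm_ring_hom h ..
  show ?thesis
    by unfold_locales (simp_all add: poly_ext_def m.hom_add m.hom_mult)
qed

lemma poly_ext_monom:
  assumes "comm_ring_hom h"
  shows "poly_ext h a (monom c n) = h c * a ^ n"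
proof -
  interpret h: comm_ring_hom h by fact
  show ?thesis by (simp add: poly_ext_def poly_monom)
qed

lemma poly_ext_const: "comm_ring_hom h \<Longrightarrow> poly_ext h a [:c:] = h c"
  using poly_ext_monom[of h a c 0] by (simp add: monom_0)

lemma poly_ext_var:
  assumes "comm_ring_hom h"
  shows "poly_ext h a [:0, 1:] = a"
proof -
  interpret h: comm_ring_hom h by fact
  show ?thesis by (simp add: poly_ext_def map_poly_pCons)
qed

definition subst4 :: "('k::field \<Rightarrow> 'b::comm_ring_1) \<Rightarrow> 'b \<Rightarrow> 'b \<Rightarrow> 'b \<Rightarrow> 'b \<Rightarrow> 'k bipoly \<Rightarrow> 'b" where
  "subst4 h a b c d = poly_ext (poly_ext (poly_ext (poly_ext h a) b) c) d"

lemma subst4_hom: "comm_ring_hom h \<Longrightarrow> comm_ring_hom (subst4 h a b c d)"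
  unfolding subst4_def by (intro poly_ext_hom)

lemma subst4_var:
  assumes "comm_ring_hom h"
  shows "subst4 h a b c d var_s = a" "subst4 h a b c d var_u = b"
    "subst4 h a b c d var_t = c" "subst4 h a b c d var_v = d"
  unfolding subst4_def var_s_def var_u_def var_t_def var_v_def
  by (simp_all only: poly_ext_const poly_ext_var poly_ext_hom assms)

text \<open>The monomial \<open>x s\<^sup>a u\<^sup>b t\<^sup>c v\<^sup>d\<close>.\<close>

definition bimonomial :: "'k::field \<Rightarrow> nat \<Rightarrow> nat \<Rightarrow> nat \<Rightarrow> nat \<Rightarrow> 'k bipoly" where
  "bimonomial x a b c d = monom (monom (monom (monom x a) b) c) d"

lemma subst4_mono:
  "comm_ring_hom h \<Longrightarrow> subst4 h s u t v (bimonomial x a b c d) = h x * s ^ a * u ^ b * t ^ c * v ^ d"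
  unfolding subst4_def bimonomial_def by (simp add: poly_ext_monom poly_ext_hom)

lemma poly_additive_induct:
  assumes "Q 0" "\<And>p q. Q p \<Longrightarrow> Q q \<Longrightarrow> Q (p + q)" "\<And>c n. Q (monom c n)"
  shows "Q (p :: 'a::comm_monoid_add poly)"
proof -
  have "Q (\<Sum>i\<in>A. monom (coeff p i) i)" if "finite A" for A
    using that by (induction A) (simp_all add: assms)
  from this[of "{..degree p}"] show ?thesis by (simp add: poly_as_sum_of_monoms)
qed

lemma bipoly_additive_induct:
  assumes zero: "Q 0" and add: "\<And>p q. Q p \<Longrightarrow> Q q \<Longrightarrow> Q (p + q)" and bimonomial: "\<And>x a b c d. Q (bimonomial x a b c d)"
  shows "Q p"
proof (rule poly_additive_induct[of Q, OF zero add])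
  show "Q (monom p3 d)" for p3 d
  proof (induction p3 rule: poly_additive_induct)
    case (3 p2 c)
    show ?case
    proof (induction p2 rule: poly_additive_induct)
      case (3 p1 b)
      show ?case
      proof (induction p1 rule: poly_additive_induct)
        case (3 x a)
        show ?case using bimonomial[of x a b c d] by (simp add: bimonomial_def)
      qed (simp_all add: zero add flip: add_monom)
    qed (simp_all add: zero add flip: add_monom)
  qed (simp_all add: zero add flip: add_monom)
qed

lemma bipoly_hom_ext:
  fixes \<phi> \<psi> :: "'k::field bipoly \<Rightarrow> 'b::comm_ring_1"
  assumes "comm_ring_hom \<phi>" "comm_ring_hom \<psi>" "\<And>x a b c d. \<phi> (bimonomial x a b c d) = \<psi> (bimonomial x a b c d)"
  shows "\<phi> p = \<psi> p"
proof -
  interpret f: comm_ring_hom \<phi> by fact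
  interpret g: comm_ring_hom \<psi> by fact
  show ?thesis
    by (induction p rule: bipoly_additive_induct) (simp_all add: f.hom_add g.hom_add assms(3))
qed

lemma const_poly_hom: "comm_ring_hom (\<lambda>c::'a::comm_ring_1. [:c:])"
  by unfold_locales

lemma comp_hom: "comm_ring_hom f \<Longrightarrow> comm_ring_hom g \<Longrightarrow> comm_ring_hom (\<lambda>x. f (g x))"
proof -
  assume "comm_ring_hom f" "comm_ring_hom g"
  then interpret f: comm_ring_hom f + g: comm_ring_hom g by auto
  show ?thesis by unfold_locales (simp_all add: f.hom_add g.hom_add f.hom_mult g.hom_mult)
qed

definition scalar :: "'k::field \<Rightarrow> 'k bipoly" where "scalar x = [:[:[:[:x:]:]:]:]"

lemma scalar_hom: "comm_ring_hom scalar"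
  unfolding scalar_def by (intro comp_hom[OF const_poly_hom] const_poly_hom)

lemma scalar_one: "scalar 1 = 1"
  by (simp add: scalar_def)

lemma bimonomial_eq:
  fixes x :: "'k::field"
  shows "bimonomial x a b c d = scalar x * var_s ^ a * var_u ^ b * var_t ^ c * var_v ^ d"
proof -
  have "(var_v :: 'k bipoly) ^ d = monom 1 d" for d
    by (simp add: var_v_def monom_altdef)
  moreover have "(var_t :: 'k bipoly) ^ c = [:monom 1 c:]" for c
    by (simp add: var_t_def monom_altdef poly_const_pow)
  moreover have "(var_u :: 'k bipoly) ^ b = [:[:monom 1 b:]:]" for b
    by (simp add: var_u_def monom_altdef poly_const_pow)
  moreover have "(var_s :: 'k bipoly) ^ a = [:[:[:monom 1 a:]:]:]" for a
    by (simp add: var_s_def monom_altdef poly_const_pow)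
  ultimately show ?thesis
    by (simp add: bimonomial_def scalar_def smult_monom)
qed

section \<open>The bigrading\<close>

text \<open>The action of the two-dimensional torus: \<open>s, u\<close> are multiplied by a new variable \<open>\<lambda>\<close>, the inner one,
  and \<open>t, v\<close> by a new variable \<open>\<mu>\<close>, the outer one. As this is a ring homomorphism, products of
  components need not be computed by hand: the component of bidegree \<open>(m, n)\<close> is the coefficient of
  \<open>\<lambda>\<^sup>m \<mu>\<^sup>n\<close>.\<close>

definition coact :: "'k::field bipoly \<Rightarrow> 'k bipoly poly poly" where
  "coact = subst4 (\<lambda>x. [:[:scalar x:]:]) [:monom var_s 1:] [:monom var_u 1:] (monom [:var_t:] 1) (monom [:var_v:] 1)"

lemma coact_base_hom: "comm_ring_hom (\<lambda>x. [:[:scalar x:]:])"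
  by (rule comp_hom[OF const_poly_hom comp_hom[OF const_poly_hom scalar_hom]])

lemma coact_hom: "comm_ring_hom coact"
  unfolding coact_def by (rule subst4_hom[OF coact_base_hom])

lemma coact_mono: "coact (bimonomial x a b c d) = monom (monom (bimonomial x a b c d) (a + b)) (c + d)"
  unfolding coact_def subst4_mono[OF coact_base_hom]
  unfolding bimonomial_eq
  by (simp add: poly_const_pow monom_power smult_monom mult_monom mult_ac add.commute)

definition component :: "nat \<Rightarrow> nat \<Rightarrow> 'k::field bipoly \<Rightarrow> 'k bipoly" where
  "component m n p = coeff (coeff (coact p) n) m"

lemma component_add: "component m n (p + q) = component m n p + component m n q"
proof -
  interpret comm_ring_hom coact by (rule coact_hom)
  show ?thesis by (simp add: component_def hom_add)
qed

lemma component_zero [simp]: "component m n 0 = 0"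
proof -
  interpret comm_ring_hom coact by (rule coact_hom)
  show ?thesis by (simp add: component_def)
qed

lemma mcoeff_mono: "mcoeff (bimonomial x a b c d) i j k l = (if i = a \<and> j = b \<and> k = c \<and> l = d then x else 0)"
  by (simp add: mcoeff_def bimonomial_def)

lemma mcoeff_add: "mcoeff (p + q) i j k l = mcoeff p i j k l + mcoeff q i j k l"
  by (simp add: mcoeff_def)

lemma mcoeff_zero: "mcoeff 0 i j k l = 0"
  by (simp add: mcoeff_def)

lemma bipoly_eqI: "(\<And>i j k l. mcoeff p i j k l = mcoeff q i j k l) \<Longrightarrow> p = q"
  unfolding mcoeff_def by (intro poly_eqI) simp

lemma mcoeff_component:
  "mcoeff (component m n p) a b c d = (if a + b = m \<and> c + d = n then mcoeff p a b c d else 0)"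
proof (induction p rule: bipoly_additive_induct)
  case (3 x i j k l)
  show ?case by (auto simp: component_def coact_mono mcoeff_mono mcoeff_zero)
qed (simp_all add: mcoeff_zero mcoeff_add component_add)

lemma bihomogeneous_component: "bihomogeneous m n (component m n p)"
  by (simp add: bihomogeneous_def mcoeff_component)

lemma component_bihomogeneous:
  "bihomogeneous m n p \<Longrightarrow> component i j p = (if i = m \<and> j = n then p else 0)"
  by (intro bipoly_eqI) (auto simp: mcoeff_component mcoeff_zero bihomogeneous_def)

lemma coact_bihomogeneous: "bihomogeneous m n p \<longleftrightarrow> coact p = monom (monom p m) n"
proof
  assume "bihomogeneous m n p"
  then show "coact p = monom (monom p m) n"
    by (intro poly_eqI) (simp add: component_bihomogeneous flip: component_def)
next
  assume "coact p = monom (monom p m) n"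
  then have "component m n p = p" by (simp add: component_def)
  then show "bihomogeneous m n p" by (metis bihomogeneous_component)
qed

lemma bihomogeneous_zero [simp]: "bihomogeneous m n 0"
  by (simp add: bihomogeneous_def mcoeff_zero)

lemma bihomogeneous_add:
  "bihomogeneous m n p \<Longrightarrow> bihomogeneous m n q \<Longrightarrow> bihomogeneous m n (p + q)"
  unfolding bihomogeneous_def mcoeff_add by (metis add_0)

lemma bihomogeneous_mult:
  "bihomogeneous m n p \<Longrightarrow> bihomogeneous m' n' q \<Longrightarrow> bihomogeneous (m + m') (n + n') (p * q)"
proof -
  interpret comm_ring_hom coact by (rule coact_hom)
  show "bihomogeneous m n p \<Longrightarrow> bihomogeneous m' n' q \<Longrightarrow> bihomogeneous (m + m') (n + n') (p * q)"
    by (simp add: coact_bihomogeneous hom_mult mult_monom)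
qed

lemma bihomogeneous_mono: "bihomogeneous (a + b) (c + d) (bimonomial x a b c d)"
  by (simp add: bihomogeneous_def mcoeff_mono)

lemma bihomogeneous_one: "bihomogeneous 0 0 1"
  using bihomogeneous_mono[of 0 0 0 0 1] by (simp add: bimonomial_eq scalar_one)

lemma bihomogeneous_var:
  "bihomogeneous 1 0 var_s" "bihomogeneous 1 0 var_u" "bihomogeneous 0 1 var_t" "bihomogeneous 0 1 var_v"
  using bihomogeneous_mono[of 1 0 0 0 1] bihomogeneous_mono[of 0 1 0 0 1]
    bihomogeneous_mono[of 0 0 1 0 1] bihomogeneous_mono[of 0 0 0 1 1]
  by (simp_all add: bimonomial_eq scalar_one)

lemma bihomogeneous_power: "bihomogeneous m n p \<Longrightarrow> bihomogeneous (k * m) (k * n) (p ^ k)"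
  by (induction k) (simp_all add: bihomogeneous_one bihomogeneous_mult)

lemma component_mult:
  assumes "bihomogeneous d d' f"
  shows "component m n (p * f) = (if d \<le> m \<and> d' \<le> n then component (m - d) (n - d') p * f else 0)"
proof -
  interpret comm_ring_hom coact by (rule coact_hom)
  have "coact (f * p) = monom (monom f d) d' * coact p"
    using assms by (simp add: coact_bihomogeneous hom_mult)
  then show ?thesis
    unfolding component_def mult.commute[of p f] by (simp add: coeff_monom_mult mult.commute[of f])
qed

section \<open>Bihomogeneous ideals\<close>

definition coeffs_in :: "'a::comm_ring_1 set \<Rightarrow> 'a poly set" where
  "coeffs_in J = {p. \<forall>i. coeff p i \<in> J}"

lemma coeffs_in_subspace:
  assumes J: "ideal.subspace J"
  shows "ideal.subspace (coeffs_in J)"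
proof (rule ideal.subspaceI)
  show "0 \<in> coeffs_in J" by (simp add: coeffs_in_def ideal.subspace_0[OF J])
  show "p + q \<in> coeffs_in J" if "p \<in> coeffs_in J" "q \<in> coeffs_in J" for p q
    using that by (simp add: coeffs_in_def ideal.subspace_add[OF J])
  show "c * p \<in> coeffs_in J" if "p \<in> coeffs_in J" for c p
    unfolding coeffs_in_def
  proof (intro CollectI allI)
    fix i
    show "coeff (c * p) i \<in> J"
      unfolding coeff_mult[of c p i] using that
      by (intro ideal.subspace_sum[OF J] ideal.subspace_scale[OF J]) (simp add: coeffs_in_def)
  qed
qed

text \<open>As for the Gauss lemma: in the product of two polynomials outside, the first coefficients outside \<open>P\<close>
  meet in a coefficient that is not in \<open>P\<close>.\<close>

lemma coeffs_in_prime: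
  assumes P: "prime_ideal P"
  shows "prime_ideal (coeffs_in P)"
  unfolding prime_ideal_def
proof (intro conjI allI impI)
  show sub: "ideal.subspace (coeffs_in P)" by (rule coeffs_in_subspace[OF prime_idealD(1)[OF P]])
  show "1 \<notin> coeffs_in P"
    using prime_idealD(2)[OF P] by (auto simp: coeffs_in_def intro!: exI[of _ 0])
  fix p q assume pq: "p * q \<in> coeffs_in P"
  show "p \<in> coeffs_in P \<or> q \<in> coeffs_in P"
  proof (rule ccontr)
    assume "\<not> ?thesis"
    then have ex: "\<exists>i. coeff p i \<notin> P" "\<exists>j. coeff q j \<notin> P" by (auto simp: coeffs_in_def)
    define i where "i = (LEAST i. coeff p i \<notin> P)"
    define j where "j = (LEAST j. coeff q j \<notin> P)"
    have i: "coeff p i \<notin> P" "\<And>k. k < i \<Longrightarrow> coeff p k \<in> P"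
      unfolding i_def using LeastI_ex[OF ex(1)] not_less_Least by blast+
    have j: "coeff q j \<notin> P" "\<And>k. k < j \<Longrightarrow> coeff q k \<in> P"
      unfolding j_def using LeastI_ex[OF ex(2)] not_less_Least by blast+
    have "coeff p k * coeff q (i + j - k) \<in> P" if "k \<in> {..i + j} - {i}" for k
    proof (cases "k < i")
      case True
      then show ?thesis using i(2) prime_idealD(5)[OF P] by metis
    next
      case False
      then have "i + j - k < j" using that by auto
      then show ?thesis using j(2) prime_idealD(4)[OF P] by metis
    qed
    then have "(\<Sum>k\<in>{..i + j} - {i}. coeff p k * coeff q (i + j - k)) \<in> P"
      by (rule ideal.subspace_sum[OF prime_idealD(1)[OF P]])
    moreover have "coeff (p * q) (i + j) = coeff p i * coeff q j +
        (\<Sum>k\<in>{..i + j} - {i}. coeff p k * coeff q (i + j - k))"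
      unfolding coeff_mult by (subst sum.remove[of _ i]) auto
    moreover have "coeff (p * q) (i + j) \<in> P" using pq by (simp add: coeffs_in_def)
    ultimately have "coeff p i * coeff q j \<in> P"
      using prime_idealD(8)[OF P] by (metis add_diff_cancel_right')
    then show False using prime_idealD(3)[OF P] i(1) j(1) by metis
  qed
qed

lemma prime_ideal_vimage:
  assumes \<phi>: "comm_ring_hom \<phi>" and P: "prime_ideal P"
  shows "prime_ideal {p. \<phi> p \<in> P}"
proof -
  interpret comm_ring_hom \<phi> by fact
  show ?thesis
    unfolding prime_ideal_def
    using prime_idealD[OF P]
    by (auto simp: hom_mult hom_add intro!: ideal.subspaceI)
qed

text \<open>The largest bihomogeneous ideal inside \<open>J\<close>.\<close>

definition bihomogeneous_part :: "'k::field bipoly set \<Rightarrow> 'k bipoly set" where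
  "bihomogeneous_part J = {p. \<forall>m n. component m n p \<in> J}"

lemma bihomogeneous_part_coact:
  "bihomogeneous_part J = {p. coact p \<in> coeffs_in (coeffs_in J)}"
  by (auto simp: bihomogeneous_part_def coeffs_in_def component_def)

text \<open>It is the preimage of \<open>P[\<lambda>, \<mu>]\<close> under a ring homomorphism.\<close>

lemma bihomogeneous_part_prime: "prime_ideal P \<Longrightarrow> prime_ideal (bihomogeneous_part P)"
  unfolding bihomogeneous_part_coact
  by (intro prime_ideal_vimage[OF coact_hom] coeffs_in_prime)

lemma bihomogeneous_part_subspace:
  assumes "ideal.subspace J"
  shows "ideal.subspace (bihomogeneous_part J)"
proof -
  interpret comm_ring_hom coact by (rule coact_hom)
  have sub: "ideal.subspace (coeffs_in (coeffs_in J))" by (intro coeffs_in_subspace assms)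
  show ?thesis
    unfolding bihomogeneous_part_coact
    using ideal.subspace_0[OF sub] ideal.subspace_add[OF sub] ideal.subspace_scale[OF sub]
    by (intro ideal.subspaceI) (simp_all add: hom_add hom_mult)
qed

lemma poly_one_in: 
  assumes "ideal.subspace J" "q \<in> coeffs_in J"
  shows "poly q 1 \<in> J"
  using assms(2) unfolding poly_altdef coeffs_in_def
  by (auto intro!: ideal.subspace_sum[OF assms(1)])

text \<open>An element is the sum of its components, that is, its image under \<open>coact\<close> evaluated at
  \<open>\<lambda> = \<mu> = 1\<close>.\<close>

lemma components_in_ideal:
  assumes J: "ideal.subspace J" and p: "\<And>m n. component m n p \<in> J"
  shows "p \<in> J"
proof -
  have one: "comm_ring_hom (\<lambda>q::'b::comm_ring_1 poly. poly q 1)" by unfold_locales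
  have "comm_ring_hom (\<lambda>p. poly (poly (coact p) 1) 1)"
    by (rule comp_hom[OF one comp_hom[OF one coact_hom]])
  moreover have "comm_ring_hom (\<lambda>p::'a bipoly. p)" by unfold_locales simp_all
  ultimately have eq: "poly (poly (coact p) 1) 1 = p"
    by (rule bipoly_hom_ext) (simp add: coact_mono poly_monom)
  have "coact p \<in> coeffs_in (coeffs_in J)"
    using p by (simp add: coeffs_in_def component_def)
  then have "poly (poly (coact p) 1) 1 \<in> J"
    by (intro poly_one_in J coeffs_in_subspace)
  then show ?thesis by (simp only: eq)
qed

lemma bihomogeneous_part_subset: "ideal.subspace J \<Longrightarrow> bihomogeneous_part J \<subseteq> J"
  using components_in_ideal[of J] by (auto simp: bihomogeneous_part_def)

lemma bihomogeneous_in_part: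
  "ideal.subspace J \<Longrightarrow> p \<in> J \<Longrightarrow> bihomogeneous m n p \<Longrightarrow> p \<in> bihomogeneous_part J"
  by (simp add: bihomogeneous_part_def component_bihomogeneous ideal.subspace_0)

lemma component_in_bihomogeneous_ideal:
  assumes "bihomogeneous_ideal J" "p \<in> J"
  shows "component m n p \<in> J"
proof -
  let ?H = "{p \<in> J. \<exists>m n. bihomogeneous m n p}"
  have eq: "J = ideal.span ?H" by (rule bihomogeneous_ideal_def[THEN iffD1, OF assms(1)])
  have J: "ideal.subspace J" by (subst eq) (rule ideal.subspace_span)
  have "ideal.span ?H \<subseteq> bihomogeneous_part J"
    using bihomogeneous_in_part[OF J]
    by (intro ideal.span_minimal bihomogeneous_part_subspace J) blast
  moreover have "p \<in> ideal.span ?H" using eq assms(2) by (rule subst[where P = "\<lambda>X. p \<in> X"])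
  ultimately show ?thesis by (auto simp: bihomogeneous_part_def)
qed

lemma bihomogeneous_ideal_part:
  assumes J: "ideal.subspace J"
  shows "bihomogeneous_ideal (bihomogeneous_part J)"
  unfolding bihomogeneous_ideal_def
proof
  let ?H = "{p \<in> bihomogeneous_part J. \<exists>m n. bihomogeneous m n p}"
  show "bihomogeneous_part J \<subseteq> ideal.span ?H"
  proof
    fix p assume p: "p \<in> bihomogeneous_part J"
    show "p \<in> ideal.span ?H"
    proof (rule components_in_ideal[OF ideal.subspace_span])
      fix m n
      have "component m n p \<in> bihomogeneous_part J"
        using p by (intro bihomogeneous_in_part[OF J _ bihomogeneous_component])
          (simp add: bihomogeneous_part_def)
      then show "component m n p \<in> ideal.span ?H"
        by (intro ideal.span_base CollectI conjI exI[of _ m] exI[of _ n] bihomogeneous_component)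
    qed
  qed
  show "ideal.span ?H \<subseteq> bihomogeneous_part J"
    by (intro ideal.span_minimal bihomogeneous_part_subspace J) blast
qed

section \<open>Affine charts at a point\<close>

lemma substitution_involution:
  fixes a b c d :: "'k::field bipoly"
  defines "\<theta> \<equiv> subst4 scalar a b c d"
  assumes var: "\<theta> a = var_s" "\<theta> b = var_u" "\<theta> c = var_t" "\<theta> d = var_v"
  shows "\<theta> (\<theta> p) = p"
proof -
  have hom: "comm_ring_hom \<theta>" unfolding \<theta>_def by (rule subst4_hom[OF scalar_hom])
  interpret comm_ring_hom \<theta> by fact
  have id: "comm_ring_hom (\<lambda>p::'k bipoly. p)" by unfold_locales simp_all
  have bimonomial: "\<theta> (bimonomial x i j k l) = scalar x * a ^ i * b ^ j * c ^ k * d ^ l" for x i j k l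
    unfolding \<theta>_def by (rule subst4_mono[OF scalar_hom])
  have scalar: "\<theta> (scalar x) = scalar x" for x
    using bimonomial[of x 0 0 0 0] by (simp add: bimonomial_eq)
  have "\<theta> (\<theta> (bimonomial x i j k l)) = bimonomial x i j k l" for x i j k l
    unfolding bimonomial by (simp add: hom_mult hom_power var scalar bimonomial_eq)
  then show ?thesis by (rule bipoly_hom_ext[OF comp_hom[OF hom hom] id])
qed

text \<open>A bihomogeneous prime without \<open>a\<close> and \<open>b\<close> contains no nonzero polynomial in \<open>a\<close> and \<open>b\<close> when their
  monomials have distinct bidegrees: it would contain every term of the polynomial, and the
  coefficients of the terms are units.\<close>

lemma substitution_constants:
  fixes a b c d :: "'k::field bipoly"
  assumes P: "prime_ideal P" "bihomogeneous_ideal P"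
    and a: "bihomogeneous m n a" "a \<notin> P" and b: "bihomogeneous m' n' b" "b \<notin> P"
    and inj: "\<And>i j i' j'. i * m + j * m' = i' * m + j' * m' \<Longrightarrow> i * n + j * n' = i' * n + j' * n' \<Longrightarrow>
      i = i' \<and> j = j'"
    and q: "subst4 scalar a b c d [:[:q:]:] \<in> P"
  shows "q = 0"
proof -
  define \<phi> where "\<phi> q = subst4 scalar a b c d [:[:q:]:]" for q
  have hom: "comm_ring_hom \<phi>"
    unfolding \<phi>_def by (intro comp_hom[OF subst4_hom[OF scalar_hom]] comp_hom[OF const_poly_hom] const_poly_hom)
  interpret comm_ring_hom \<phi> by fact
  interpret scalar: comm_ring_hom scalar by (rule scalar_hom)
  have comp: "component (i * m + j * m') (i * n + j * n') (\<phi> q) = scalar (coeff (coeff q j) i) * a ^ i * b ^ j"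
    for i j q
  proof (induction q rule: poly_additive_induct)
    case (3 r l)
    show ?case
    proof (induction r rule: poly_additive_induct)
      case (3 x k)
      have eq: "[:[:monom (monom x k) l:]:] = bimonomial x k l 0 0" by (simp add: bimonomial_def monom_0)
      have \<phi>: "\<phi> (monom (monom x k) l) = scalar x * a ^ k * b ^ l"
        unfolding \<phi>_def eq subst4_mono[OF scalar_hom] by simp
      have "bihomogeneous 0 0 (scalar x)" using bihomogeneous_mono[of 0 0 0 0 x] by (simp add: bimonomial_eq)
      then have "bihomogeneous (0 + k * m + l * m') (0 + k * n + l * n') (scalar x * a ^ k * b ^ l)"
        by (intro bihomogeneous_mult bihomogeneous_power a(1) b(1))
      then have bihom: "bihomogeneous (k * m + l * m') (k * n + l * n') (scalar x * a ^ k * b ^ l)"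
        by simp
      have deg: "i * m + j * m' = k * m + l * m' \<and> i * n + j * n' = k * n + l * n' \<longleftrightarrow> i = k \<and> j = l"
        using inj[of i j k l] by blast
      show ?case
        unfolding \<phi> component_bihomogeneous[OF bihom] deg by (simp add: scalar_def)
    next
      case 1
      then show ?case by (simp add: scalar_def)
    next
      case (2 p q)
      then show ?case
        by (simp add: hom_add component_add scalar.hom_add distrib_right flip: add_monom)
    qed
  next
    case 1
    then show ?case by (simp add: scalar_def)
  next
    case (2 p q)
    then show ?case by (simp add: hom_add component_add scalar.hom_add distrib_right)
  qed
  have "coeff (coeff q j) i = 0" for i j
  proof (rule ccontr)
    let ?x = "coeff (coeff q j) i"
    assume x: "?x \<noteq> 0"
    have "scalar ?x * a ^ i * b ^ j \<in> P"
      using component_in_bihomogeneous_ideal[OF P(2) q] comp[of i j q, unfolded \<phi>_def] by metis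
    then have "scalar ?x \<in> P"
      using prime_idealD(3)[OF P(1)] prime_ideal_power[OF P(1)] a(2) b(2) by metis
    moreover have "scalar (inverse ?x) * scalar ?x = 1" using x by (simp add: scalar_def)
    ultimately show False using prime_idealD(2,4)[OF P(1)] by metis
  qed
  then show ?thesis by (simp add: poly_eq_iff)
qed

lemma points_prime: "P \<in> points \<Longrightarrow> prime_ideal P"
  and points_bihomogeneous: "P \<in> points \<Longrightarrow> bihomogeneous_ideal P"
  by (simp_all add: points_def)

lemma points_coordinates:
  assumes "P \<in> points"
  obtains \<sigma> \<tau> where "\<sigma> \<in> {var_s, var_u}" "\<tau> \<in> {var_t, var_v}" "\<sigma> \<notin> P" "\<tau> \<notin> P"
proof -
  have P: "prime_ideal P" by (rule points_prime[OF assms])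
  have "\<not> {var_s * var_t, var_s * var_v, var_u * var_t, var_u * var_v} \<subseteq> P"
    using assms prime_ideal_span[OF P] unfolding points_def irrelevant_ideal_def by blast
  then obtain \<sigma> \<tau> where "\<sigma> \<in> {var_s, var_u}" "\<tau> \<in> {var_t, var_v}" "\<sigma> * \<tau> \<notin> P" by auto
  then show ?thesis using that prime_ideal_mult_iff[OF P] by metis
qed

text \<open>At a point one of \<open>s, u\<close> and one of \<open>t, v\<close> does not vanish. The involution \<open>\<theta>\<close> moves these two to the
  places \<open>s, u\<close> of the two inner variables, by exchanging two variables. Inverting all polynomials in them
  takes the place of dehomogenization.\<close>

lemma point_chart:
  assumes "P \<in> points"
  obtains \<theta> :: "'k::field bipoly \<Rightarrow> 'k bipoly" where "comm_ring_hom \<theta>" "\<And>p. \<theta> (\<theta> p) = p"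
    "\<And>q. \<theta> [:[:q:]:] \<in> P \<Longrightarrow> q = 0"
proof -
  note P = points_prime[OF assms] points_bihomogeneous[OF assms]
  obtain \<sigma> \<tau> :: "'k bipoly" where st: "\<sigma> \<in> {var_s, var_u}" "\<tau> \<in> {var_t, var_v}" "\<sigma> \<notin> P" "\<tau> \<notin> P"
    by (rule points_coordinates[OF assms])
  then consider "\<sigma> = var_s" "\<tau> = var_t" | "\<sigma> = var_s" "\<tau> = var_v"
    | "\<sigma> = var_u" "\<tau> = var_t" | "\<sigma> = var_u" "\<tau> = var_v" by blast
  then show ?thesis
  proof cases
    case 1
    show ?thesis
      by (rule that[of "subst4 scalar var_s var_t var_u var_v"], rule subst4_hom[OF scalar_hom],
          rule substitution_involution; (simp add: subst4_var[OF scalar_hom])?)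
        (rule substitution_constants[OF P bihomogeneous_var(1) _ bihomogeneous_var(3)],
          use st 1 in auto)
  next
    case 2
    show ?thesis
      by (rule that[of "subst4 scalar var_s var_v var_t var_u"], rule subst4_hom[OF scalar_hom],
          rule substitution_involution; (simp add: subst4_var[OF scalar_hom])?)
        (rule substitution_constants[OF P bihomogeneous_var(1) _ bihomogeneous_var(4)],
          use st 2 in auto)
  next
    case 3
    show ?thesis
      by (rule that[of "subst4 scalar var_t var_u var_s var_v"], rule subst4_hom[OF scalar_hom],
          rule substitution_involution; (simp add: subst4_var[OF scalar_hom])?)
        (rule substitution_constants[OF P bihomogeneous_var(3) _ bihomogeneous_var(2)],
          use st 3 in auto)
  next
    case 4
    show ?thesis
      by (rule that[of "subst4 scalar var_v var_u var_t var_s"], rule subst4_hom[OF scalar_hom],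
          rule substitution_involution; (simp add: subst4_var[OF scalar_hom])?)
        (rule substitution_constants[OF P bihomogeneous_var(4) _ bihomogeneous_var(2)],
          use st 4 in auto)
  qed
qed

lemma hom_span:
  assumes "comm_ring_hom \<phi>" "p \<in> ideal.span F"
  shows "\<phi> p \<in> ideal.span (\<phi> ` F)"
proof -
  interpret comm_ring_hom \<phi> by fact
  have "ideal.subspace {p. \<phi> p \<in> ideal.span (\<phi> ` F)}"
    by (rule ideal.subspaceI)
      (simp_all add: ideal.span_zero hom_add hom_mult ideal.span_add ideal.span_scale)
  then have "ideal.span F \<subseteq> {p. \<phi> p \<in> ideal.span (\<phi> ` F)}"
    by (intro ideal.span_minimal) (auto intro: ideal.span_base)
  then show ?thesis using assms(2) by blast
qed

lemma hom_at_prime: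
  assumes "comm_ring_hom \<phi>" "q \<in> at_prime {p. \<phi> p \<in> P} (ideal.span F)"
  shows "\<phi> q \<in> at_prime P (ideal.span (\<phi> ` F))"
proof -
  interpret comm_ring_hom \<phi> by fact
  obtain w where "\<phi> w \<notin> P" "w * q \<in> ideal.span F" using assms(2) by (auto elim!: at_primeE)
  then show ?thesis
    using hom_span[OF assms(1), of "w * q" F] by (intro at_primeI[of "\<phi> w"]) (simp_all add: hom_mult)
qed

lemma involution_no_common_prime:
  fixes \<theta> :: "'a::comm_ring_1 \<Rightarrow> 'a"
  assumes \<theta>: "comm_ring_hom \<theta>" "\<And>p. \<theta> (\<theta> p) = p" and F: "no_common_prime F"
  shows "no_common_prime (\<theta> ` F)"
proof -
  interpret comm_ring_hom \<theta> by fact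
  have dvd: "\<theta> a dvd \<theta> b" if "a dvd b" for a b
    using that by (elim dvdE) (simp add: hom_mult)
  have dvd_swap: "\<theta> a dvd b" if "a dvd \<theta> b" for a b
    using dvd[OF that] by (simp add: \<theta>(2))
  have "prime_elem (\<theta> \<pi>)" if \<pi>: "prime_elem \<pi>" for \<pi>
  proof (rule prime_elemI)
    show "\<theta> \<pi> \<noteq> 0" using prime_elem_not_zeroI[OF \<pi>] \<theta>(2) by (metis hom_zero)
    show "\<not> \<theta> \<pi> dvd 1"
      using prime_elem_not_unit[OF \<pi>] dvd[of "\<theta> \<pi>" 1] \<theta>(2) by (metis hom_one)
    fix a b assume "\<theta> \<pi> dvd a * b"
    then have "\<pi> dvd \<theta> a * \<theta> b" using dvd[of "\<theta> \<pi>" "a * b"] by (simp add: \<theta>(2) hom_mult)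
    then have "\<pi> dvd \<theta> a \<or> \<pi> dvd \<theta> b" by (rule prime_elem_dvd_multD[OF \<pi>])
    then show "\<theta> \<pi> dvd a \<or> \<theta> \<pi> dvd b" using dvd_swap by metis
  qed
  then have "\<exists>a\<in>F. \<not> \<theta> \<pi> dvd a" if "prime_elem \<pi>" for \<pi>
    using no_common_primeD[OF F] that by metis
  then have "\<exists>a\<in>\<theta> ` F. \<not> \<pi> dvd a" if "prime_elem \<pi>" for \<pi>
    using that dvd_swap by (metis imageI)
  then show ?thesis unfolding no_common_prime_def by metis
qed

text \<open>The preceding chart carries \<open>P\<close> to a prime to which \<open>plane_point_structure\<close> applies, with \<open>k[s, u]\<close> as ring
  of constants.\<close>

theorem point_structure:
  fixes P F :: "'k::field bipoly set"
  assumes P: "P \<in> points" and F: "F \<subseteq> P" "no_common_prime F"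
  shows "\<exists>x\<in>P. \<exists>y\<in>P. P \<subseteq> at_prime P (ideal.span {x, y}) \<and>
     (\<forall>q\<in>P. \<exists>k. q ^ k \<in> at_prime P (ideal.span F))"
proof -
  obtain \<theta> :: "'k bipoly \<Rightarrow> 'k bipoly" where \<theta>: "comm_ring_hom \<theta>" "\<And>p. \<theta> (\<theta> p) = p"
    "\<And>q. \<theta> [:[:q:]:] \<in> P \<Longrightarrow> q = 0"
    using point_chart[OF P] by metis
  interpret comm_ring_hom \<theta> by fact
  define P' where "P' = {p. \<theta> p \<in> P}"
  have "prime_ideal P'" unfolding P'_def by (rule prime_ideal_vimage[OF \<theta>(1) points_prime[OF P]])
  moreover have "\<theta> ` F \<subseteq> P'" using F(1) by (auto simp: P'_def \<theta>(2))
  ultimately obtain x y where xy: "x \<in> P'" "y \<in> P'" "P' \<subseteq> at_prime P' (ideal.span {x, y})"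
    and nil: "\<forall>q\<in>P'. \<exists>k. q ^ k \<in> at_prime P' (ideal.span (\<theta> ` F))"
    using plane_point_structure[of P' "\<theta> ` F"] \<theta>(3) involution_no_common_prime[OF \<theta>(1,2) F(2)]
    unfolding P'_def by blast
  have P'_iff: "\<theta> q \<in> P' \<longleftrightarrow> q \<in> P" for q by (simp add: P'_def \<theta>(2))
  have img: "\<theta> ` \<theta> ` F = F" by (simp add: image_image \<theta>(2))
  have "P \<subseteq> at_prime P (ideal.span {\<theta> x, \<theta> y})"
  proof
    fix q assume "q \<in> P"
    then have "\<theta> q \<in> at_prime P' (ideal.span {x, y})" using xy(3) P'_iff by blast
    then show "q \<in> at_prime P (ideal.span {\<theta> x, \<theta> y})"
      using hom_at_prime[OF \<theta>(1), of "\<theta> q" P "{x, y}"] by (simp add: P'_def \<theta>(2))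
  qed
  moreover have "\<exists>k. q ^ k \<in> at_prime P (ideal.span F)" if q: "q \<in> P" for q
  proof -
    obtain k where "\<theta> q ^ k \<in> at_prime P' (ideal.span (\<theta> ` F))"
      using nil P'_iff[of q] q by blast
    then have "q ^ k \<in> at_prime P (ideal.span F)"
      using hom_at_prime[OF \<theta>(1), of "\<theta> q ^ k" P "\<theta> ` F"]
      by (simp add: P'_def \<theta>(2) img hom_power)
    then show ?thesis ..
  qed
  ultimately show ?thesis using xy(1,2) unfolding P'_def by blast
qed

section \<open>Homogeneous localization\<close>

text \<open>The second property says that \<open>\<alpha>'\<close> is bihomogeneous of bidegree \<open>(m - d, n - d')\<close>, and zero if a
  difference is negative; it avoids subtraction of natural numbers.\<close>

lemma component_multiple:
  assumes f: "bihomogeneous d d' f"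
  obtains \<alpha>' where "component m n (\<alpha> * f) = \<alpha>' * f"
    "\<And>b. bihomogeneous d d' b \<Longrightarrow> bihomogeneous m n (\<alpha>' * b)"
proof (cases "d \<le> m \<and> d' \<le> n")
  case True
  show ?thesis
  proof (rule that)
    show "component m n (\<alpha> * f) = component (m - d) (n - d') \<alpha> * f"
      using True by (simp add: component_mult[OF f])
    show "bihomogeneous m n (component (m - d) (n - d') \<alpha> * b)" if "bihomogeneous d d' b" for b
      using bihomogeneous_mult[OF bihomogeneous_component[of "m - d" "n - d'" \<alpha>] that] True by simp
  qed
next
  case False
  then show ?thesis using that[of 0] by (auto simp: component_mult[OF f])
qed

lemma component_outside:
  assumes "prime_ideal P" "w \<notin> P"
  obtains m n where "component m n w \<notin> P"
  using components_in_ideal[OF prime_idealD(1)[OF assms(1)]] assms(2) by metis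

text \<open>If all components of \<open>w\<close> were in \<open>P\<close>, then \<open>w\<close> would be. So some component of \<open>w\<close> is outside \<open>P\<close>, and
  comparing the components of both sides in the matching bidegree makes the relation bihomogeneous.\<close>

lemma homogeneous_relation:
  assumes P: "prime_ideal P" and w: "w \<notin> P" "w * z = \<alpha> * f + \<beta> * g"
    and z: "bihomogeneous m n z" and f: "bihomogeneous d d' f" and g: "bihomogeneous e e' g"
  obtains w' k l \<alpha>' \<beta>' where "w' \<notin> P" "bihomogeneous k l w'" "w' * z = \<alpha>' * f + \<beta>' * g"
    "\<forall>b. bihomogeneous d d' b \<longrightarrow> bihomogeneous (k + m) (l + n) (\<alpha>' * b)"
    "\<forall>b. bihomogeneous e e' b \<longrightarrow> bihomogeneous (k + m) (l + n) (\<beta>' * b)"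
proof -
  obtain k l where kl: "component k l w \<notin> P" using component_outside[OF P w(1)] by metis
  obtain \<alpha>' where \<alpha>': "component (k + m) (l + n) (\<alpha> * f) = \<alpha>' * f"
    "\<And>b. bihomogeneous d d' b \<Longrightarrow> bihomogeneous (k + m) (l + n) (\<alpha>' * b)"
    using component_multiple[OF f] by metis
  obtain \<beta>' where \<beta>': "component (k + m) (l + n) (\<beta> * g) = \<beta>' * g"
    "\<And>b. bihomogeneous e e' b \<Longrightarrow> bihomogeneous (k + m) (l + n) (\<beta>' * b)"
    using component_multiple[OF g] by metis
  have "component k l w * z = component (k + m) (l + n) (w * z)"
    by (simp add: component_mult[OF z])
  also have "\<dots> = \<alpha>' * f + \<beta>' * g" by (simp only: w(2) component_add \<alpha>' \<beta>')
  finally show ?thesis using that[OF kl bihomogeneous_component] \<alpha>'(2) \<beta>'(2) by metis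
qed

lemma point_denominator:
  assumes "P \<in> points"
  obtains b where "bihomogeneous m n b" "b \<notin> P"
proof -
  have P: "prime_ideal P" by (rule points_prime[OF assms])
  obtain \<sigma> \<tau> where st: "\<sigma> \<in> {var_s, var_u}" "\<tau> \<in> {var_t, var_v}" "\<sigma> \<notin> P" "\<tau> \<notin> P"
    by (rule points_coordinates[OF assms])
  have "bihomogeneous 1 0 \<sigma>" "bihomogeneous 0 1 \<tau>" using st bihomogeneous_var by auto
  then have "bihomogeneous (m * 1 + n * 0) (m * 0 + n * 1) (\<sigma> ^ m * \<tau> ^ n)"
    by (intro bihomogeneous_mult bihomogeneous_power)
  moreover have "\<sigma> ^ m * \<tau> ^ n \<notin> P"
    using st(3,4) prime_ideal_power[OF P] prime_idealD(3)[OF P] by metis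
  ultimately show ?thesis using that by simp
qed

lemma local_ringI:
  "bihomogeneous m n a \<Longrightarrow> bihomogeneous m n b \<Longrightarrow> b \<notin> P \<Longrightarrow> Fract a b \<in> local_ring P"
  unfolding local_ring_def by blast

lemma local_ringE:
  assumes "z \<in> local_ring P"
  obtains a b m n where "z = Fract a b" "bihomogeneous m n a" "bihomogeneous m n b" "b \<notin> P"
  using assms unfolding local_ring_def by blast

lemma ideal_stalkI:
  "a \<in> J \<Longrightarrow> bihomogeneous m n a \<Longrightarrow> bihomogeneous m n b \<Longrightarrow> b \<notin> P \<Longrightarrow> Fract a b \<in> ideal_stalk J P"
  unfolding ideal_stalk_def by blast

lemma ideal_stalkE:
  assumes "z \<in> ideal_stalk J P"
  obtains a b m n where "z = Fract a b" "a \<in> J" "bihomogeneous m n a" "bihomogeneous m n b" "b \<notin> P"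
  using assms unfolding ideal_stalk_def by blast

lemma prime_ideal_nonzero: "prime_ideal P \<Longrightarrow> b \<notin> P \<Longrightarrow> b \<noteq> 0"
  using prime_idealD(6) by metis

lemma local_ring_mult:
  assumes P: "prime_ideal P" and "x \<in> local_ring P" "y \<in> local_ring P"
  shows "x * y \<in> local_ring P"
proof -
  obtain a b m n where x: "x = Fract a b" "bihomogeneous m n a" "bihomogeneous m n b" "b \<notin> P"
    using assms(2) by (rule local_ringE)
  obtain c d k l where y: "y = Fract c d" "bihomogeneous k l c" "bihomogeneous k l d" "d \<notin> P"
    using assms(3) by (rule local_ringE)
  have "x * y = Fract (a * c) (b * d)" by (simp add: x y)
  moreover have "b * d \<notin> P" using x y prime_idealD(3)[OF P] by metis
  ultimately show ?thesis
    using local_ringI bihomogeneous_mult x y by metis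
qed

lemma local_ring_zero: "prime_ideal P \<Longrightarrow> 0 \<in> local_ring P"
  using local_ringI[of 0 0 0 1 P] bihomogeneous_one prime_idealD(2)[of P] by (simp add: fract_collapse)

lemma local_ring_one: "prime_ideal P \<Longrightarrow> 1 \<in> local_ring P"
  using local_ringI[of 0 0 1 1 P] bihomogeneous_one prime_idealD(2)[of P] by (simp add: fract_collapse)

lemma local_ring_power: "prime_ideal P \<Longrightarrow> x \<in> local_ring P \<Longrightarrow> x ^ k \<in> local_ring P"
  by (induction k) (simp_all add: local_ring_one local_ring_mult)

text \<open>Regular sequences are built one term at a time, and so are the ideals of their initial segments.\<close>

lemma generated_ideal_snoc:
  "generated_ideal A (xs @ [x]) = {z + c * x |z c. z \<in> generated_ideal A xs \<and> c \<in> A}"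
proof (intro equalityI subsetI)
  fix y assume "y \<in> generated_ideal A (xs @ [x])"
  then obtain c where c: "y = (\<Sum>i<length (xs @ [x]). c i * (xs @ [x]) ! i)" "\<forall>i<length (xs @ [x]). c i \<in> A"
    unfolding generated_ideal_def by blast
  have "y = (\<Sum>i<length xs. c i * xs ! i) + c (length xs) * x"
    by (simp add: c(1) nth_append)
  moreover have "(\<Sum>i<length xs. c i * xs ! i) \<in> generated_ideal A xs"
    unfolding generated_ideal_def using c(2) by force
  ultimately show "y \<in> {z + c * x |z c. z \<in> generated_ideal A xs \<and> c \<in> A}" using c(2) by auto
next
  fix y assume "y \<in> {z + c * x |z c. z \<in> generated_ideal A xs \<and> c \<in> A}"
  then obtain c e where c: "y = (\<Sum>i<length xs. c i * xs ! i) + e * x" "\<forall>i<length xs. c i \<in> A" "e \<in> A"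
    unfolding generated_ideal_def by blast
  define c' where "c' = c(length xs := e)"
  have "y = (\<Sum>i<length (xs @ [x]). c' i * (xs @ [x]) ! i)"
    by (simp add: c(1) nth_append c'_def)
  moreover have "\<forall>i<length (xs @ [x]). c' i \<in> A" using c by (auto simp: c'_def less_Suc_eq)
  ultimately show "y \<in> generated_ideal A (xs @ [x])" unfolding generated_ideal_def by blast
qed

lemma generated_ideal_Nil: "generated_ideal A [] = {0}"
  by (auto simp: generated_ideal_def)

lemma generated_ideal_single: "generated_ideal A [x] = {c * x |c. c \<in> A}"
  using generated_ideal_snoc[of A "[]" x] by (simp add: generated_ideal_Nil)

lemma generated_ideal_pair: "generated_ideal A [x, y] = {c * x + e * y |c e. c \<in> A \<and> e \<in> A}"
  using generated_ideal_snoc[of A "[x]" y] by (auto simp: generated_ideal_single)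

lemma generated_ideal_take_mono:
  assumes "0 \<in> A" "i \<le> j"
  shows "generated_ideal A (take i xs) \<subseteq> generated_ideal A (take j xs)"
  using assms(2)
proof (induction j rule: dec_induct)
  case (step j)
  have "generated_ideal A (take j xs) \<subseteq> generated_ideal A (take (Suc j) xs)"
  proof (cases "j < length xs")
    case True
    show ?thesis
    proof
      fix z assume "z \<in> generated_ideal A (take j xs)"
      moreover have "z = z + 0 * xs ! j" by simp
      ultimately show "z \<in> generated_ideal A (take (Suc j) xs)"
        unfolding take_Suc_conv_app_nth[OF True] generated_ideal_snoc using assms(1) by blast
    qed
  qed simp
  then show ?case using step.IH by blast
qed simp

section \<open>Local complete intersections\<close>

lemma sum_in_stalk:
  fixes f g :: "'k::field bipoly"
  assumes P: "prime_ideal P" and J: "ideal.subspace J" "f \<in> J" "g \<in> J"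
    and f: "bihomogeneous d d' f" "bihomogeneous d d' b" "b \<notin> P"
    and g: "bihomogeneous e e' g" "bihomogeneous e e' c" "c \<notin> P"
    and x: "x \<in> local_ring P" and y: "y \<in> local_ring P"
  shows "x * Fract f b + y * Fract g c \<in> ideal_stalk J P"
proof -
  obtain p q m n where x: "x = Fract p q" "bihomogeneous m n p" "bihomogeneous m n q" "q \<notin> P"
    using x by (rule local_ringE)
  obtain r s k l where y: "y = Fract r s" "bihomogeneous k l r" "bihomogeneous k l s" "s \<notin> P"
    using y by (rule local_ringE)
  have nz: "q \<noteq> 0" "b \<noteq> 0" "s \<noteq> 0" "c \<noteq> 0" using prime_ideal_nonzero[OF P] x y f g by metis+
  have eq: "x * Fract f b + y * Fract g c = Fract ((p * f) * (s * c) + (r * g) * (q * b)) ((q * b) * (s * c))"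
    using nz by (simp add: x y)
  have "(p * f) * (s * c) + (r * g) * (q * b) \<in> J"
    using ideal.subspace_add[OF J(1) ideal.subspace_scale[OF J(1,2), of "p * s * c"]
        ideal.subspace_scale[OF J(1,3), of "r * q * b"]]
    by (simp add: mult_ac)
  moreover have "bihomogeneous (m + d + (k + e)) (n + d' + (l + e')) ((p * f) * (s * c) + (r * g) * (q * b))"
  proof (rule bihomogeneous_add)
    show "bihomogeneous (m + d + (k + e)) (n + d' + (l + e')) ((p * f) * (s * c))"
      by (intro bihomogeneous_mult x y f g)
    have "bihomogeneous (k + e + (m + d)) (l + e' + (n + d')) ((r * g) * (q * b))"
      by (intro bihomogeneous_mult x y f g)
    then show "bihomogeneous (m + d + (k + e)) (n + d' + (l + e')) ((r * g) * (q * b))"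
      by (simp only: add.commute)
  qed
  moreover have "bihomogeneous (m + d + (k + e)) (n + d' + (l + e')) ((q * b) * (s * c))"
    by (intro bihomogeneous_mult x y f g)
  moreover have "(q * b) * (s * c) \<notin> P" using x(4) y(4) f(3) g(3) prime_idealD(3)[OF P] by metis
  ultimately show ?thesis unfolding eq by (rule ideal_stalkI)
qed

text \<open>Let \<open>z g / c\<close> be a multiple of \<open>f / b\<close>. Clearing denominators and cancelling the common factor \<open>h\<close>,
  one finds that \<open>f\<close> divides the numerator of \<open>z\<close> up to \<open>h\<close> and other factors outside \<open>P\<close>. The
  quotient may be inhomogeneous, which \<open>homogeneous_relation\<close> repairs.\<close>

lemma regular_sequence_of_coprime:
  fixes f g :: "'k::field bipoly"
  assumes P: "prime_ideal P"
    and f: "f \<in> P" "bihomogeneous d d' f" "bihomogeneous d d' b" "b \<notin> P"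
    and g: "g \<in> P" "bihomogeneous e e' g" "bihomogeneous e e' c" "c \<notin> P"
    and h: "f = h * a" "g = h * a'" "no_common_prime {a, a'}" "h \<notin> P"
  shows "regular_sequence (local_ring P) [Fract f b, Fract g c]"
proof -
  let ?A = "local_ring P"
  have aP: "a \<in> P" "a' \<in> P" using f(1) g(1) h prime_idealD(3)[OF P] by metis+
  have prime_dvd: "\<exists>\<pi>. prime_elem \<pi> \<and> \<pi> dvd z" if "z \<in> P" for z
    using prime_ideal_prime_factor[OF P _ that] exists_prime_elem by (metis dvd_0_right)
  have a0: "a \<noteq> 0" using no_common_primeD[OF h(3)] prime_dvd[OF aP(2)] by (metis dvd_0_right insertE singletonD)
  have nz: "b \<noteq> 0" "c \<noteq> 0" "h \<noteq> 0" using prime_ideal_nonzero[OF P] f g h by metis+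
  have f0: "f \<noteq> 0" using a0 nz h by simp
  have sub: "set [Fract f b, Fract g c] \<subseteq> ?A" using f g local_ringI by auto
  have reg0: "z \<in> generated_ideal ?A []"
    if "z \<in> ?A" "z * Fract f b \<in> generated_ideal ?A []" for z
  proof -
    have "Fract f b \<noteq> 0" using f0 nz by (simp add: Zero_fract_def eq_fract)
    then show ?thesis using that by (simp add: generated_ideal_Nil)
  qed
  have reg1: "z \<in> generated_ideal ?A [Fract f b]"
    if z: "z \<in> ?A" "z * Fract g c \<in> generated_ideal ?A [Fract f b]" for z
  proof -
    obtain p q m n where p: "z = Fract p q" "bihomogeneous m n p" "bihomogeneous m n q" "q \<notin> P"
      using z(1) by (rule local_ringE)
    obtain r where "r \<in> ?A" "z * Fract g c = r * Fract f b"
      using z(2) by (auto simp: generated_ideal_single)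
    then obtain r s k l where r: "z * Fract g c = Fract r s * Fract f b" "bihomogeneous k l r"
      "bihomogeneous k l s" "s \<notin> P" by (metis local_ringE)
    have nz': "q \<noteq> 0" "s \<noteq> 0" using prime_ideal_nonzero[OF P] p r by metis+
    have "p * g * (s * b) = r * f * (q * c)"
      using r(1) nz nz' by (simp add: p(1) eq_fract)
    then have "h * ((p * s * b) * a') = h * ((r * q * c) * a)" by (simp add: h mult_ac)
    then have "(p * s * b) * a' = (r * q * c) * a" using nz by simp
    then obtain \<delta> where "p * s * b = \<delta> * a" using proportional_pair[OF h(3)] a0 by metis
    then have "h * (p * s * b) = \<delta> * f + 0 * f" by (simp add: h)
    moreover have "bihomogeneous (m + k + d) (n + l + d') (p * s * b)"
      by (intro bihomogeneous_mult p r f)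
    ultimately obtain w u v \<alpha> \<beta> where w: "w \<notin> P" "bihomogeneous u v w" "w * (p * s * b) = \<alpha> * f + \<beta> * f"
      "\<forall>b. bihomogeneous d d' b \<longrightarrow> bihomogeneous (u + (m + k + d)) (v + (n + l + d')) (\<alpha> * b)"
      "\<forall>b. bihomogeneous d d' b \<longrightarrow> bihomogeneous (u + (m + k + d)) (v + (n + l + d')) (\<beta> * b)"
      by (rule homogeneous_relation[OF P h(4) _ _ f(2) f(2)])
    have w0: "w \<noteq> 0" using prime_ideal_nonzero[OF P w(1)] .
    let ?y = "Fract (\<alpha> * b + \<beta> * b) (w * (q * s * b))"
    have "w * (q * s * b) \<notin> P" using w(1) p(4) r(4) f(4) prime_idealD(3)[OF P] by metis
    moreover have "bihomogeneous (u + (m + k + d)) (v + (n + l + d')) (w * (q * s * b))"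
      by (intro bihomogeneous_mult w p r f)
    ultimately have "?y \<in> ?A"
      by (intro local_ringI[OF bihomogeneous_add[OF w(4)[rule_format, OF f(3)] w(5)[rule_format, OF f(3)]]])
    moreover have "z = ?y * Fract f b"
    proof -
      have "p * (w * (q * s * b) * b) = (w * (p * s * b)) * (q * b)" by (simp add: mult_ac)
      also have "\<dots> = (\<alpha> * b + \<beta> * b) * f * q" unfolding w(3) by (simp add: algebra_simps)
      finally show ?thesis using nz nz' w0 by (simp add: p(1) eq_fract)
    qed
    ultimately show ?thesis unfolding generated_ideal_single by blast
  qed
  have one: "1 \<notin> generated_ideal ?A [Fract f b, Fract g c]"
  proof
    assume "1 \<in> generated_ideal ?A [Fract f b, Fract g c]"
    then obtain x y where "x \<in> ?A" "y \<in> ?A" "1 = x * Fract f b + y * Fract g c"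
      unfolding generated_ideal_pair by blast
    then have "1 \<in> ideal_stalk P P"
      using sum_in_stalk[OF P prime_idealD(1)[OF P] f(1) g(1) f(2-4) g(2-4)] by metis
    then obtain p q where pq: "1 = Fract p q" "p \<in> P" "q \<notin> P" by (rule ideal_stalkE)
    have "q \<noteq> 0" by (rule prime_ideal_nonzero[OF P pq(3)])
    moreover have "Fract 1 1 = Fract p q" using pq(1) unfolding One_fract_def .
    ultimately have "p = q" using eq_fract(1)[of 1 q 1 p] by simp
    then show False using pq by simp
  qed
  show ?thesis
    unfolding regular_sequence_def
  proof (intro conjI allI impI ballI sub one)
    fix i z
    assume i: "i < length [Fract f b, Fract g c]" and z: "z \<in> ?A"
      "z * [Fract f b, Fract g c] ! i \<in> generated_ideal ?A (take i [Fract f b, Fract g c])"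
    from i consider "i = 0" | "i = 1" by fastforce
    then show "z \<in> generated_ideal ?A (take i [Fract f b, Fract g c])"
    proof cases
      case 1
      then show ?thesis using reg0[of z] z by simp
    next
      case 2
      then show ?thesis using reg1[of z] z by simp
    qed
  qed
qed

lemma prime_outside_dvd:
  "prime_ideal P \<Longrightarrow> prime_elem \<pi> \<Longrightarrow> \<pi> \<in> P \<Longrightarrow> w \<notin> P \<Longrightarrow> \<pi> dvd w * x \<Longrightarrow> \<pi> dvd x"
  using prime_elem_dvd_multD prime_not_dvd_outside by metis

lemma local_generators_coprime:
  fixes f :: "'k::field bipoly ^ 3"
  assumes P: "prime_ideal P"
    and f: "\<And>i. f $ i \<in> P" "no_common_prime (range (($) f))"
    and i: "f $ i \<in> at_prime P (ideal.span {f $ nxt i, f $ prv i})"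
  obtains h a b where "f $ nxt i = h * a" "f $ prv i = h * b" "no_common_prime {a, b}" "h \<notin> P"
proof -
  obtain h a b where h: "f $ nxt i = h * a" "f $ prv i = h * b" "no_common_prime {a, b}"
    by (rule gcd_split)
  obtain w p q where w: "w \<notin> P" "w * f $ i = p * f $ nxt i + q * f $ prv i"
    using i by (auto elim!: at_primeE simp: ideal_span_pair)
  have "h \<notin> P"
  proof
    assume "h \<in> P"
    have "\<exists>\<pi>. prime_elem \<pi> \<and> \<pi> dvd h \<and> \<pi> dvd f $ i"
    proof (cases "h = 0")
      case True
      then have "f $ i = 0" using w h prime_ideal_nonzero[OF P w(1)] by simp
      then show ?thesis using True exists_prime_elem by (metis dvd_0_right)
    next
      case False
      then obtain \<pi> where \<pi>: "prime_elem \<pi>" "\<pi> \<in> P" "\<pi> dvd h"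
        using prime_ideal_prime_factor[OF P False \<open>h \<in> P\<close>] by metis
      have "\<pi> dvd w * f $ i" unfolding w(2) h using \<pi>(3) by (intro dvd_add dvd_mult dvd_mult2)
      then show ?thesis using \<pi> prime_outside_dvd[OF P \<pi>(1,2) w(1)] by metis
    qed
    then obtain \<pi> where \<pi>: "prime_elem \<pi>" "\<pi> dvd h" "\<pi> dvd f $ i" by metis
    have "\<pi> dvd f $ nxt i" "\<pi> dvd f $ prv i" unfolding h by (rule dvd_mult2[OF \<pi>(2)])+
    then show False
      using no_common_primeD[OF f(2) \<pi>(1)] \<pi>(3) unfolding range_nth3[of f i] by (metis insertE singletonD)
  qed
  then show ?thesis using that h by metis
qed

text \<open>The fractions with numerators \<open>f\<^sub>j, f\<^sub>k\<close> and arbitrary denominators of the same bidegrees form the regular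
  sequence; it generates the stalk because \<open>f\<^sub>i\<close> is redundant.\<close>

lemma regular_generators_of_redundant:
  fixes f :: "'k::field bipoly ^ 3"
  assumes P: "P \<in> points"
    and bihom: "\<And>i. bihomogeneous (d i) (d' i) (f $ i)"
    and f: "\<And>i. f $ i \<in> P" "no_common_prime (range (($) f))"
    and i: "f $ i \<in> at_prime P (ideal.span {f $ nxt i, f $ prv i})"
  shows "\<exists>xs. regular_sequence (local_ring P) xs \<and>
    ideal_stalk (ideal.span (range (($) f))) P = generated_ideal (local_ring P) xs"
proof -
  note pr = points_prime[OF P]
  let ?A = "local_ring P" and ?J = "ideal.span (range (($) f))"
  obtain b where b: "bihomogeneous (d (nxt i)) (d' (nxt i)) b" "b \<notin> P" by (rule point_denominator[OF P])
  obtain c where c: "bihomogeneous (d (prv i)) (d' (prv i)) c" "c \<notin> P" by (rule point_denominator[OF P])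
  let ?x = "Fract (f $ nxt i) b" and ?y = "Fract (f $ prv i) c"
  have "regular_sequence ?A [?x, ?y]"
  proof -
    obtain h a a' where "f $ nxt i = h * a" "f $ prv i = h * a'" "no_common_prime {a, a'}" "h \<notin> P"
      using local_generators_coprime[OF pr f i] by metis
    then show ?thesis
      by (intro regular_sequence_of_coprime[OF pr f(1) bihom b f(1) bihom c])
  qed
  moreover have "ideal_stalk ?J P = generated_ideal ?A [?x, ?y]"
  proof (intro equalityI subsetI)
    fix z assume "z \<in> generated_ideal ?A [?x, ?y]"
    then show "z \<in> ideal_stalk ?J P"
      unfolding generated_ideal_pair
      using sum_in_stalk[OF pr ideal.subspace_span ideal.span_base ideal.span_base bihom b bihom c]
      by blast
  next
    fix z assume "z \<in> ideal_stalk ?J P"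
    then obtain p q m n where p: "z = Fract p q" "p \<in> ?J" "bihomogeneous m n p"
      "bihomogeneous m n q" "q \<notin> P"
      by (rule ideal_stalkE)
    have "p \<in> at_prime P (ideal.span {f $ nxt i, f $ prv i})"
    proof -
      let ?I = "at_prime P (ideal.span {f $ nxt i, f $ prv i})"
      have "f $ nxt i \<in> ?I" "f $ prv i \<in> ?I"
        by (rule subsetD[OF subset_at_prime[OF pr]], simp add: ideal.span_base)+
      then have "range (($) f) \<subseteq> ?I" unfolding range_nth3[of f i] using i by simp
      then show ?thesis
        using p(2) ideal.span_minimal[OF _ at_prime_subspace[OF pr ideal.subspace_span]] by blast
    qed
    then obtain w \<alpha> \<beta> where "w \<notin> P" "w * p = \<alpha> * f $ nxt i + \<beta> * f $ prv i"
      by (auto elim!: at_primeE simp: ideal_span_pair)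
    then obtain w k l \<alpha> \<beta> where w: "w \<notin> P" "bihomogeneous k l w"
      "w * p = \<alpha> * f $ nxt i + \<beta> * f $ prv i"
      "\<forall>b. bihomogeneous (d (nxt i)) (d' (nxt i)) b \<longrightarrow> bihomogeneous (k + m) (l + n) (\<alpha> * b)"
      "\<forall>b. bihomogeneous (d (prv i)) (d' (prv i)) b \<longrightarrow> bihomogeneous (k + m) (l + n) (\<beta> * b)"
      using homogeneous_relation[OF pr _ _ p(3) bihom[of "nxt i"] bihom[of "prv i"]] by metis
    have wq: "w * q \<notin> P" using w(1) p(5) prime_idealD(3)[OF pr] by metis
    have nz: "w \<noteq> 0" "q \<noteq> 0" "b \<noteq> 0" "c \<noteq> 0" using prime_ideal_nonzero[OF pr] w(1) p(5) b c by metis+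
    have bh: "bihomogeneous (k + m) (l + n) (w * q)" by (intro bihomogeneous_mult w p)
    have "Fract (\<alpha> * b) (w * q) \<in> ?A" "Fract (\<beta> * c) (w * q) \<in> ?A"
      by (rule local_ringI[OF w(4)[rule_format, OF b(1)] bh wq], rule local_ringI[OF w(5)[rule_format, OF c(1)] bh wq])
    moreover have "z = Fract (\<alpha> * b) (w * q) * ?x + Fract (\<beta> * c) (w * q) * ?y"
    proof -
      have "Fract (\<alpha> * b) (w * q) * ?x = Fract (\<alpha> * f $ nxt i) (w * q)"
        "Fract (\<beta> * c) (w * q) * ?y = Fract (\<beta> * f $ prv i) (w * q)"
        using nz by (simp_all add: eq_fract mult_ac)
      moreover have "Fract (\<alpha> * f $ nxt i) (w * q) + Fract (\<beta> * f $ prv i) (w * q) = Fract (w * p) (w * q)"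
        unfolding w(3) using nz by (simp add: eq_fract algebra_simps)
      moreover have "z = Fract (w * p) (w * q)" using nz by (simp add: p(1) eq_fract mult_ac)
      ultimately show ?thesis by (simp only:)
    qed
    ultimately show "z \<in> generated_ideal ?A [?x, ?y]" unfolding generated_ideal_pair by blast
  qed
  ultimately show ?thesis by blast
qed

lemma zero_in_generated_ideal: "0 \<in> A \<Longrightarrow> 0 \<in> generated_ideal A xs"
  unfolding generated_ideal_def by (intro CollectI exI[of _ "\<lambda>_. 0"]) simp

lemma nth_in_generated_ideal:
  assumes A: "0 \<in> A" "1 \<in> A" and j: "j < length xs"
  shows "xs ! j \<in> generated_ideal A xs"
proof -
  have "0 + 1 * xs ! j \<in> generated_ideal A (take (Suc j) xs)"
    unfolding take_Suc_conv_app_nth[OF j] generated_ideal_snoc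
    using zero_in_generated_ideal[OF A(1)] A(2) by blast
  then show ?thesis
    using generated_ideal_take_mono[OF A(1), of "Suc j" "length xs" xs] j by auto
qed

lemma generated_ideal_fractions:
  assumes P: "prime_ideal P" and J: "ideal.subspace J"
    and xs: "\<And>x. x \<in> set xs \<Longrightarrow> \<exists>a w. x = Fract a w \<and> a \<in> J \<and> w \<notin> P"
    and z: "z \<in> generated_ideal (local_ring P) xs"
  shows "\<exists>a w. z = Fract a w \<and> a \<in> J \<and> w \<notin> P"
  using xs z
proof (induction xs arbitrary: z rule: rev_induct)
  case Nil
  then have "z = Fract 0 1" by (simp add: generated_ideal_Nil fract_collapse)
  then show ?case using ideal.subspace_0[OF J] prime_idealD(2)[OF P] by metis
next
  case (snoc x xs)
  obtain y c where y: "z = y + c * x" "y \<in> generated_ideal (local_ring P) xs" "c \<in> local_ring P"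
    using snoc.prems(2) unfolding generated_ideal_snoc by blast
  obtain a w where a: "y = Fract a w" "a \<in> J" "w \<notin> P"
    using snoc.IH[OF _ y(2)] snoc.prems(1) by auto
  obtain b v where b: "x = Fract b v" "b \<in> J" "v \<notin> P" using snoc.prems(1)[of x] by auto
  obtain r s where c: "c = Fract r s" "s \<notin> P" using y(3) by (rule local_ringE)
  have nz: "w \<noteq> 0" "v \<noteq> 0" "s \<noteq> 0" using prime_ideal_nonzero[OF P] a b c by metis+
  have "z = Fract (a * (s * v) + r * b * w) (w * (s * v))"
    using nz by (simp add: y(1) a(1) b(1) c(1))
  moreover have "a * (s * v) + r * b * w \<in> J"
    using ideal.subspace_add[OF J ideal.subspace_scale[OF J a(2), of "s * v"] ideal.subspace_scale[OF J b(2), of "r * w"]]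
    by (simp add: mult_ac)
  moreover have "w * (s * v) \<notin> P" using a(3) b(3) c(2) prime_idealD(3)[OF P] by metis
  ultimately show ?case by blast
qed

lemma Fract_power: "Fract a b ^ k = Fract (a ^ k) (b ^ k)"
  by (induction k) (simp_all add: fract_collapse)

text \<open>The local ring has dimension two. The numerators \<open>p\<^sub>0, p\<^sub>1\<close> of the first two terms are coprime at \<open>P\<close>:
  with a common prime factor \<open>\<pi>\<close>, the quotient \<open>p\<^sub>0 / \<pi>\<close> would multiply \<open>p\<^sub>1\<close> into the ideal of \<open>p\<^sub>0\<close>
  without being in it. Therefore a power of the third term lies in the ideal of the first two, and by
  regularity \<open>1\<close> does.\<close>

lemma regular_sequence_length:
  fixes P :: "'k::field bipoly set"
  assumes P: "P \<in> points" and reg: "regular_sequence (local_ring P) xs"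
    and max: "set xs \<subseteq> ideal_stalk P P"
  shows "length xs \<le> 2"
proof (rule ccontr)
  assume "\<not> length xs \<le> 2"
  then obtain x0 x1 x2 ys where xs: "xs = x0 # x1 # x2 # ys"
    by (metis Suc_le_length_iff not_less_eq_eq numeral_2_eq_2)
  note pr = points_prime[OF P]
  let ?A = "local_ring P"
  have A: "0 \<in> ?A" "1 \<in> ?A" by (rule local_ring_zero[OF pr], rule local_ring_one[OF pr])
  have reg_step: "a \<in> generated_ideal ?A (take i xs)"
    if "i < length xs" "a \<in> ?A" "a * xs ! i \<in> generated_ideal ?A (take i xs)" for i a
    using reg that unfolding regular_sequence_def by blast
  have R0: "a \<in> {0}" if "a \<in> ?A" "a * x0 \<in> {0}" for a
    using reg_step[of 0 a] that by (simp add: xs generated_ideal_Nil)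
  have R1: "a \<in> generated_ideal ?A [x0]" if "a \<in> ?A" "a * x1 \<in> generated_ideal ?A [x0]" for a
    using reg_step[of 1 a] that by (simp add: xs)
  have R2: "a \<in> generated_ideal ?A [x0, x1]" if "a \<in> ?A" "a * x2 \<in> generated_ideal ?A [x0, x1]" for a
    using reg_step[of 2 a] that by (simp add: xs numeral_2_eq_2)
  have one: "1 \<notin> generated_ideal ?A [x0, x1]"
    using reg generated_ideal_take_mono[OF A(1), of 2 "length xs" xs]
    unfolding regular_sequence_def by (auto simp: xs numeral_2_eq_2)
  obtain p0 q0 m0 n0 where x0: "x0 = Fract p0 q0" "p0 \<in> P" "bihomogeneous m0 n0 p0"
    "bihomogeneous m0 n0 q0" "q0 \<notin> P"
    using max by (auto simp: xs elim!: ideal_stalkE)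
  obtain p1 q1 m1 n1 where x1: "x1 = Fract p1 q1" "p1 \<in> P" "bihomogeneous m1 n1 p1"
    "bihomogeneous m1 n1 q1" "q1 \<notin> P"
    using max by (auto simp: xs elim!: ideal_stalkE)
  obtain p2 q2 m2 n2 where x2: "x2 = Fract p2 q2" "p2 \<in> P" "bihomogeneous m2 n2 p2"
    "bihomogeneous m2 n2 q2" "q2 \<notin> P"
    using max by (auto simp: xs elim!: ideal_stalkE)
  have nz: "q0 \<noteq> 0" "q1 \<noteq> 0" "q2 \<noteq> 0" using prime_ideal_nonzero[OF pr] x0 x1 x2 by metis+
  have p0: "p0 \<noteq> 0"
  proof
    assume "p0 = 0"
    then have "x0 = 0" using x0 nz by (simp add: fract_collapse)
    then show False using R0[OF A(2)] by simp
  qed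
  obtain h a b where h: "p0 = h * a" "p1 = h * b" "no_common_prime {a, b}" by (rule gcd_split)
  have "h \<notin> P"
  proof
    assume "h \<in> P"
    moreover have "h \<noteq> 0" using p0 h by auto
    ultimately obtain \<pi> where \<pi>: "prime_elem \<pi>" "\<pi> \<in> P" "\<pi> dvd h"
      using prime_ideal_prime_factor[OF pr] by metis
    then obtain h' where h': "h = \<pi> * h'" by (elim dvdE)
    define a' b' where "a' = h' * a" and "b' = h' * b"
    have a': "p0 = \<pi> * a'" "p1 = \<pi> * b'" by (simp_all add: h h' a'_def b'_def mult.assoc)
    have rel: "a' * p1 = b' * p0" by (simp add: a' mult_ac)
    have "component m n a' \<in> at_prime P (ideal.span {p0})" for m n
    proof -
      obtain \<beta> where \<beta>: "component (m + m1) (n + n1) (b' * p0) = \<beta> * p0"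
        "\<And>b. bihomogeneous m0 n0 b \<Longrightarrow> bihomogeneous (m + m1) (n + n1) (\<beta> * b)"
        using component_multiple[OF x0(3)] by metis
      have eq: "component m n a' * p1 = \<beta> * p0"
        using \<beta>(1) by (simp add: component_mult[OF x1(3)] flip: rel)
      obtain e where e: "bihomogeneous m n e" "e \<notin> P" by (rule point_denominator[OF P])
      have e0: "e \<noteq> 0" using prime_ideal_nonzero[OF pr e(2)] .
      define z where "z = Fract (component m n a') e"
      have zA: "z \<in> ?A" unfolding z_def by (rule local_ringI[OF bihomogeneous_component e])
      have "z * x1 = Fract (\<beta> * q0) (e * q1) * x0"
        using nz e0 eq by (simp add: z_def x0(1) x1(1) eq_fract)
      moreover have "Fract (\<beta> * q0) (e * q1) \<in> ?A"
        using prime_idealD(3)[OF pr, of e q1] e(2) x1(5)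
        by (intro local_ringI[OF \<beta>(2)[OF x0(4)] bihomogeneous_mult[OF e(1) x1(4)]]) blast
      ultimately have "z \<in> generated_ideal ?A [x0]"
        using R1[OF zA] unfolding generated_ideal_single by blast
      then obtain c where c: "c \<in> ?A" "z = c * x0" unfolding generated_ideal_single by blast
      obtain r s where rs: "c = Fract r s" "s \<notin> P" using c(1) by (rule local_ringE)
      have "s \<noteq> 0" using prime_ideal_nonzero[OF pr rs(2)] .
      then have "component m n a' * (s * q0) = r * p0 * e"
        using c(2) nz e0 by (simp add: z_def rs(1) x0(1) eq_fract)
      then have "(s * q0) * component m n a' = (r * e) * p0" by (simp add: mult_ac)
      then have "(s * q0) * component m n a' \<in> ideal.span {p0}"
        using ideal.span_scale[OF ideal.span_base[of p0 "{p0}"]] by simp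
      moreover have "s * q0 \<notin> P" using rs(2) x0(5) prime_idealD(3)[OF pr] by metis
      ultimately show ?thesis by (intro at_primeI)
    qed
    then have "a' \<in> at_prime P (ideal.span {p0})"
      by (rule components_in_ideal[OF at_prime_subspace[OF pr ideal.subspace_span]])
    then obtain w k where w: "w \<notin> P" "w * a' = k * p0"
      by (auto elim!: at_primeE simp: ideal.span_singleton)
    then have "a' * w = a' * (k * \<pi>)" by (simp add: a' mult_ac)
    then have "w = k * \<pi>" using p0 a' by simp
    then show False using w(1) prime_idealD(4)[OF pr \<pi>(2)] by simp
  qed
  have "a \<in> P" "b \<in> P" using x0(2) x1(2) h \<open>h \<notin> P\<close> prime_idealD(3)[OF pr] by metis+
  then obtain k where "p2 ^ k \<in> at_prime P (ideal.span {a, b})"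
    using point_structure[OF P _ h(3)] x2(2) by auto
  then obtain w \<alpha> \<beta> where w: "w \<notin> P" "w * p2 ^ k = \<alpha> * a + \<beta> * b"
    by (auto elim!: at_primeE simp: ideal_span_pair)
  have "h * w \<notin> P" using w(1) \<open>h \<notin> P\<close> prime_idealD(3)[OF pr] by metis
  moreover have "(h * w) * p2 ^ k = \<alpha> * p0 + \<beta> * p1"
    using arg_cong[OF w(2), of "\<lambda>t. h * t"] by (simp add: h algebra_simps)
  ultimately obtain v i j \<gamma> \<delta> where v: "v \<notin> P" "bihomogeneous i j v" "v * p2 ^ k = \<gamma> * p0 + \<delta> * p1"
    "\<forall>b. bihomogeneous m0 n0 b \<longrightarrow> bihomogeneous (i + k * m2) (j + k * n2) (\<gamma> * b)"
    "\<forall>b. bihomogeneous m1 n1 b \<longrightarrow> bihomogeneous (i + k * m2) (j + k * n2) (\<delta> * b)"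
    using homogeneous_relation[OF pr _ _ bihomogeneous_power[OF x2(3)] x0(3) x1(3)] by metis
  have v0: "v \<noteq> 0" using prime_ideal_nonzero[OF pr v(1)] .
  have vq: "v * q2 ^ k \<notin> P" using v(1) x2(5) prime_idealD(3)[OF pr] prime_ideal_power[OF pr] by metis
  have bh: "bihomogeneous (i + k * m2) (j + k * n2) (v * q2 ^ k)"
    by (intro bihomogeneous_mult bihomogeneous_power v x2)
  have in_A: "Fract (\<gamma> * q0) (v * q2 ^ k) \<in> ?A" "Fract (\<delta> * q1) (v * q2 ^ k) \<in> ?A"
    by (rule local_ringI[OF v(4)[rule_format, OF x0(4)] bh vq], rule local_ringI[OF v(5)[rule_format, OF x1(4)] bh vq])
  have "Fract (\<gamma> * q0) (v * q2 ^ k) * x0 = Fract (\<gamma> * p0) (v * q2 ^ k)"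
    "Fract (\<delta> * q1) (v * q2 ^ k) * x1 = Fract (\<delta> * p1) (v * q2 ^ k)"
    using nz v0 by (simp_all add: x0(1) x1(1) eq_fract mult_ac)
  moreover have "Fract (\<gamma> * p0) (v * q2 ^ k) + Fract (\<delta> * p1) (v * q2 ^ k) = Fract (v * p2 ^ k) (v * q2 ^ k)"
    unfolding v(3) using nz v0 by (simp add: eq_fract algebra_simps)
  moreover have "x2 ^ k = Fract (v * p2 ^ k) (v * q2 ^ k)"
    using nz v0 by (simp add: x2(1) Fract_power eq_fract mult_ac)
  ultimately have "x2 ^ k = Fract (\<gamma> * q0) (v * q2 ^ k) * x0 + Fract (\<delta> * q1) (v * q2 ^ k) * x1"
    by (simp only:)
  then have "x2 ^ k \<in> generated_ideal ?A [x0, x1]" unfolding generated_ideal_pair using in_A by blast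
  \<comment> \<open>Regularity of the third term lowers the exponent down to zero.\<close>
  moreover have "x2 ^ k \<in> generated_ideal ?A [x0, x1] \<Longrightarrow> 1 \<in> generated_ideal ?A [x0, x1]" for k
  proof (induction k)
    case (Suc k)
    have "x2 \<in> ?A" using reg by (simp add: regular_sequence_def xs)
    then have "x2 ^ k \<in> ?A" by (rule local_ring_power[OF pr])
    then show ?case using Suc R2 by (simp add: mult.commute)
  qed simp
  ultimately show False using one by blast
qed

text \<open>The numerators of the at most two terms of the sequence generate \<open>I\<close> at \<open>P\<close>; a repeated or zero
  numerator fills up shorter sequences.\<close>

lemma redundant_generator_of_regular:
  fixes f :: "'k::field bipoly ^ 3"
  assumes P: "P \<in> points"
    and bihom: "\<And>i. bihomogeneous (d i) (d' i) (f $ i)"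
    and f: "\<And>i. f $ i \<in> P" "no_common_prime (range (($) f))" "f \<noteq> 0"
    and reg: "regular_sequence (local_ring P) xs"
    and gen: "ideal_stalk (ideal.span (range (($) f))) P = generated_ideal (local_ring P) xs"
  shows "\<exists>i. f $ i \<in> at_prime P (ideal.span {f $ nxt i, f $ prv i})"
proof -
  note pr = points_prime[OF P]
  let ?A = "local_ring P" and ?J = "ideal.span (range (($) f))"
  have A: "0 \<in> ?A" "1 \<in> ?A" by (rule local_ring_zero[OF pr], rule local_ring_one[OF pr])
  have J_P: "?J \<subseteq> P" by (rule prime_ideal_span[OF pr]) (use f(1) in auto)
  have xs_stalk: "x \<in> ideal_stalk ?J P" if "x \<in> set xs" for x
    using that nth_in_generated_ideal[OF A] unfolding gen by (auto simp: in_set_conv_nth)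
  then have "set xs \<subseteq> ideal_stalk P P"
    using J_P by (auto simp: ideal_stalk_def) (metis subsetD)
  then have len: "length xs \<le> 2" by (rule regular_sequence_length[OF P reg])
  have "\<exists>p. p \<in> ?J \<and> (\<exists>w. x = Fract p w \<and> w \<notin> P)" if "x \<in> set xs" for x
    using xs_stalk[OF that] by (metis ideal_stalkE)
  then obtain p where p: "\<And>x. x \<in> set xs \<Longrightarrow> p x \<in> ?J \<and> (\<exists>w. x = Fract (p x) w \<and> w \<notin> P)" by metis
  obtain p1 p2 where p12: "p1 \<in> ?J" "p2 \<in> ?J" "\<And>x. x \<in> set xs \<Longrightarrow> p x \<in> {p1, p2}"
  proof -
    consider "xs = []" | x where "xs = [x]" | x y where "xs = [x, y]"
    proof -
      have "length xs = 0 \<or> length xs = Suc 0 \<or> length xs = Suc (Suc 0)" using len by linarith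
      then show ?thesis using that by (auto simp: length_Suc_conv)
    qed
    then show ?thesis
    proof cases
      case 1
      then show ?thesis using that[of 0 0] ideal.span_zero by auto
    next
      case (2 x)
      then show ?thesis using that[of "p x" "p x"] p by auto
    next
      case (3 x y)
      then show ?thesis using that[of "p x" "p y"] p by auto
    qed
  qed
  have "f $ i \<in> at_prime P (ideal.span {p1, p2})" for i
  proof -
    obtain b where b: "bihomogeneous (d i) (d' i) b" "b \<notin> P" by (rule point_denominator[OF P])
    have "Fract (f $ i) b \<in> ideal_stalk ?J P"
      by (intro ideal_stalkI[OF _ bihom b] ideal.span_base rangeI)
    then have mem: "Fract (f $ i) b \<in> generated_ideal ?A xs" using gen by simp
    have frac: "\<exists>a w. x = Fract a w \<and> a \<in> ideal.span {p1, p2} \<and> w \<notin> P" if "x \<in> set xs" for x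
      using p[OF that] ideal.span_base[OF p12(3)[OF that]] by metis
    obtain a w where a: "Fract (f $ i) b = Fract a w" "a \<in> ideal.span {p1, p2}" "w \<notin> P"
      using generated_ideal_fractions[OF pr ideal.subspace_span frac mem] by blast
    have "b \<noteq> 0" "w \<noteq> 0" using prime_ideal_nonzero[OF pr] b a by metis+
    then have "w * f $ i = b * a" using a(1) by (simp add: eq_fract mult.commute)
    then have "w * f $ i \<in> ideal.span {p1, p2}" using ideal.span_scale[OF a(2), of b] by simp
    then show ?thesis by (rule at_primeI[OF a(3)])
  qed
  then show ?thesis by (rule generator_redundant_of_two_generated[OF pr f p12(1,2)])
qed


section \<open>Codimension two\<close>

lemma prime_ideal_span_prime_elem:
  assumes \<pi>: "prime_elem \<pi>"
  shows "prime_ideal (ideal.span {\<pi>})"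
proof -
  have mem: "x \<in> ideal.span {\<pi>} \<longleftrightarrow> \<pi> dvd x" for x
    by (auto simp: ideal.span_singleton dvd_def mult.commute)
  show ?thesis
    unfolding prime_ideal_def mem
    using prime_elem_not_unit[OF \<pi>] prime_elem_dvd_multD[OF \<pi>] ideal.subspace_span by metis
qed

text \<open>A nonzero \<open>q \<in> Q\<close> has a prime factor \<open>\<rho> \<in> Q\<close>; it is a multiple of \<open>\<pi>\<close>, hence an associate of \<open>\<pi>\<close>, and
  \<open>Q\<close> is the whole ideal of \<open>\<pi>\<close>.\<close>

lemma prime_ideal_below_principal:
  fixes \<pi> :: "'a::ufd"
  assumes \<pi>: "prime_elem \<pi>" and Q: "prime_ideal Q" "Q \<subset> ideal.span {\<pi>}"
  shows "Q = {0}"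
proof (rule ccontr)
  assume "Q \<noteq> {0}"
  then obtain q where "q \<in> Q" "q \<noteq> 0" using prime_idealD(6)[OF Q(1)] by blast
  then obtain \<rho> where \<rho>: "prime_elem \<rho>" "\<rho> \<in> Q"
    using prime_ideal_prime_factor[OF Q(1)] by metis
  then obtain k where k: "\<rho> = k * \<pi>" using Q(2) by (auto simp: ideal.span_singleton)
  then have "k dvd 1"
    using irreducibleD[OF prime_elem_imp_irreducible[OF \<rho>(1)] k] prime_elem_not_unit[OF \<pi>] by metis
  then obtain l where "1 = k * l" by (rule dvdE)
  then have "\<pi> = l * \<rho>" unfolding k by (metis mult.assoc mult.commute mult_1)
  then have "\<pi> \<in> Q" using prime_idealD(4)[OF Q(1) \<rho>(2)] by simp
  then have "ideal.span {\<pi>} \<subseteq> Q" by (intro ideal.span_minimal prime_idealD(1)[OF Q(1)]) simp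
  then show False using Q(2) by blast
qed

lemma height_principal_prime:
  fixes \<pi> :: "'a::ufd"
  assumes \<pi>: "prime_elem \<pi>"
  shows "height (ideal.span {\<pi>}) \<le> 1"
  unfolding height_def
proof (rule Sup_least)
  fix e assume "e \<in> {enat n |n. \<exists>C :: nat \<Rightarrow> 'a set. (\<forall>i\<le>n. prime_ideal (C i)) \<and>
    (\<forall>i<n. C i \<subset> C (Suc i)) \<and> C n = ideal.span {\<pi>}}"
  then obtain n and C :: "nat \<Rightarrow> 'a set" where C: "e = enat n" "\<And>i. i \<le> n \<Longrightarrow> prime_ideal (C i)"
    "\<And>i. i < n \<Longrightarrow> C i \<subset> C (Suc i)" "C n = ideal.span {\<pi>}"
    by blast
  have "n \<le> 1"
  proof (rule ccontr)
    assume "\<not> n \<le> 1"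
    then obtain m where n: "n = Suc (Suc m)" by (metis One_nat_def Suc_le_eq not_less_eq_eq nat.exhaust le0)
    have "C (Suc m) = {0}"
      using prime_ideal_below_principal[OF \<pi> C(2)[of "Suc m"]] C(3)[of "Suc m"] C(4) n by simp
    then have "C m \<subset> {0}" using C(3)[of m] n by simp
    moreover have "0 \<in> C m" using prime_idealD(6)[OF C(2)[of m]] n by simp
    ultimately show False by blast
  qed
  then show "e \<le> 1" using C(1) by (simp add: one_enat_def)
qed

lemma no_common_prime_of_codim:
  fixes F :: "'a::ufd set"
  assumes "codim (ideal.span F) = 2"
  shows "no_common_prime F"
  unfolding no_common_prime_def
proof (rule notI, elim exE conjE)
  fix \<pi> assume \<pi>: "prime_elem \<pi>" "\<forall>a\<in>F. \<pi> dvd a"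
  have "F \<subseteq> ideal.span {\<pi>}"
  proof
    fix a assume "a \<in> F"
    then have "\<pi> dvd a" using \<pi>(2) by metis
    then obtain k where "a = \<pi> * k" by (rule dvdE)
    then show "a \<in> ideal.span {\<pi>}"
      using ideal.span_scale[OF ideal.span_base, of \<pi> "{\<pi>}" k] by (simp add: mult.commute)
  qed
  then have "ideal.span F \<subseteq> ideal.span {\<pi>}" by (intro ideal.span_minimal ideal.subspace_span)
  then have "codim (ideal.span F) \<le> height (ideal.span {\<pi>})"
    unfolding codim_def using prime_ideal_span_prime_elem[OF \<pi>(1)] by (intro Inf_lower) blast
  also have "\<dots> \<le> 1" by (rule height_principal_prime[OF \<pi>(1)])
  finally have "(2 :: enat) \<le> 1" using assms by simp
  moreover have "\<not> (2 :: enat) \<le> 1" by (simp add: one_enat_def numeral_eq_enat)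
  ultimately show False by blast
qed

section \<open>Saturation and primes\<close>

text \<open>By Zorn's lemma there is a maximal ideal among those that contain \<open>J\<close> and no power of \<open>g\<close>. It is
  prime: if \<open>a\<close> and \<open>b\<close> are outside, each of them adds a power of \<open>g\<close>, and with \<open>a b\<close> inside the product
  of these powers would be inside.\<close>

lemma prime_ideal_avoiding_powers:
  fixes g :: "'a::comm_ring_1"
  assumes J: "ideal.subspace J" and g: "\<And>j. g ^ j \<notin> J"
  obtains P where "prime_ideal P" "J \<subseteq> P" "g \<notin> P"
proof -
  define S where "S = {I. ideal.subspace I \<and> J \<subseteq> I \<and> (\<forall>j. g ^ j \<notin> I)}"
  have "\<exists>M\<in>S. \<forall>X\<in>S. M \<subseteq> X \<longrightarrow> X = M"
  proof (rule subset_Zorn_nonempty)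
    show "S \<noteq> {}" using J g by (auto simp: S_def)
    fix C assume C: "C \<noteq> {}" "subset.chain S C"
    have CS: "C \<subseteq> S" and lin: "\<And>X Y. X \<in> C \<Longrightarrow> Y \<in> C \<Longrightarrow> X \<subseteq> Y \<or> Y \<subseteq> X"
      using C(2) by (auto simp: subset.chain_def)
    have "ideal.subspace (\<Union>C)"
    proof (rule ideal.subspaceI)
      obtain X where X: "X \<in> C" using C(1) by blast
      then have "ideal.subspace X" using CS by (auto simp: S_def)
      then show "0 \<in> \<Union>C" using X ideal.subspace_0 by blast
      show "c * x \<in> \<Union>C" if x: "x \<in> \<Union>C" for c x
      proof -
        obtain X where X: "X \<in> C" "x \<in> X" using x by blast
        then have "ideal.subspace X" using CS by (auto simp: S_def)
        then have "c * x \<in> X" using X(2) by (rule ideal.subspace_scale)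
        then show ?thesis using X(1) by blast
      qed
      show "x + y \<in> \<Union>C" if xy: "x \<in> \<Union>C" "y \<in> \<Union>C" for x y
      proof -
        obtain X Y where XY: "X \<in> C" "x \<in> X" "Y \<in> C" "y \<in> Y" using xy by blast
        then obtain Z where Z: "Z \<in> C" "x \<in> Z" "y \<in> Z" using lin[of X Y] by blast
        then have "ideal.subspace Z" using CS by (auto simp: S_def)
        then have "x + y \<in> Z" using Z(2,3) by (rule ideal.subspace_add)
        then show ?thesis using Z(1) by blast
      qed
    qed
    moreover have "J \<subseteq> \<Union>C" using C(1) CS by (auto simp: S_def)
    moreover have "\<forall>j. g ^ j \<notin> \<Union>C" using CS by (auto simp: S_def)
    ultimately show "\<Union>C \<in> S" by (simp add: S_def)
  qed
  then obtain M where M: "M \<in> S" and max: "\<And>X. X \<in> S \<Longrightarrow> M \<subseteq> X \<Longrightarrow> X = M" by blast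
  have sub: "ideal.subspace M" and JM: "J \<subseteq> M" and gM: "\<And>j. g ^ j \<notin> M"
    using M by (auto simp: S_def)
  have span_M: "ideal.span M = M" by (rule ideal.span_eq_iff[THEN iffD2, OF sub])
  have extend: "\<exists>j k. g ^ j - k * a \<in> M" if "a \<notin> M" for a
  proof (rule ccontr)
    assume neg: "\<nexists>j k. g ^ j - k * a \<in> M"
    have ins: "x \<in> ideal.span (insert a M) \<longleftrightarrow> (\<exists>k. x - k * a \<in> M)" for x
      by (simp add: ideal.span_insert span_M)
    have "M \<subseteq> ideal.span (insert a M)" using ideal.span_superset by blast
    moreover have "ideal.span (insert a M) \<in> S"
      unfolding S_def using ideal.subspace_span JM calculation neg by (auto simp: ins)
    ultimately have "ideal.span (insert a M) = M" using max by blast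
    moreover have "a \<in> ideal.span (insert a M)" by (rule ideal.span_base) simp
    ultimately show False using that by simp
  qed
  have "prime_ideal M"
    unfolding prime_ideal_def
  proof (intro conjI allI impI sub)
    show "1 \<notin> M" using gM[of 0] by simp
    fix a b assume ab: "a * b \<in> M"
    show "a \<in> M \<or> b \<in> M"
    proof (rule ccontr)
      assume "\<not> ?thesis"
      then obtain i k j l where i: "g ^ i - k * a \<in> M" and j: "g ^ j - l * b \<in> M" using extend by blast
      have "g ^ (i + j) = g ^ j * (g ^ i - k * a) + (k * a) * (g ^ j - l * b) + (k * l) * (a * b)"
        by (simp add: power_add algebra_simps)
      also have "\<dots> \<in> M"
        by (intro ideal.subspace_add[OF sub] ideal.subspace_scale[OF sub i]
            ideal.subspace_scale[OF sub j] ideal.subspace_scale[OF sub ab])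
      finally show False using gM by blast
    qed
  qed
  moreover have "g \<notin> M" using gM[of 1] by simp
  ultimately show ?thesis using that JM by blast
qed

definition irrelevant_generators :: "'k::field bipoly set" where
  "irrelevant_generators = {var_s * var_t, var_s * var_v, var_u * var_t, var_u * var_v}"

lemma irrelevant_ideal_eq: "irrelevant_ideal = ideal.span irrelevant_generators"
  by (simp add: irrelevant_ideal_def irrelevant_generators_def)

lemma generator_power_in_ideal_power:
  "e \<in> irrelevant_generators \<Longrightarrow> e ^ j \<in> ideal_power irrelevant_ideal j"
proof (induction j)
  case (Suc j)
  then show ?case
    using ideal.span_base[of e irrelevant_generators]
    by (auto simp: irrelevant_ideal_eq intro!: ideal.span_base)
qed simp

lemma span_mult_span:
  fixes x y :: "'a::comm_ring_1"
  assumes x: "x \<in> ideal.span A" and y: "y \<in> ideal.span B"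
    and AB: "\<And>a b. a \<in> A \<Longrightarrow> b \<in> B \<Longrightarrow> a * b \<in> J" and J: "ideal.subspace J"
  shows "x * y \<in> J"
proof -
  have "a * y \<in> J" if "a \<in> A" for a
  proof -
    have "ideal.subspace {y. a * y \<in> J}"
      using ideal.subspace_0[OF J] ideal.subspace_add[OF J] ideal.subspace_scale[OF J]
      by (intro ideal.subspaceI) (simp_all add: distrib_left mult.left_commute)
    then have "ideal.span B \<subseteq> {y. a * y \<in> J}" using AB that by (intro ideal.span_minimal) auto
    then show ?thesis using y by blast
  qed
  moreover have "ideal.subspace {x. x * y \<in> J}"
    using ideal.subspace_0[OF J] ideal.subspace_add[OF J] ideal.subspace_scale[OF J]
    by (intro ideal.subspaceI) (simp_all add: distrib_right mult.assoc)
  ultimately have "ideal.span A \<subseteq> {x. x * y \<in> J}" by (intro ideal.span_minimal) auto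
  then show ?thesis using x by blast
qed

lemma ideal_power_monomials:
  fixes a b c d :: "'a::comm_ring_1"
  shows "ideal_power (ideal.span {a, b, c, d}) n \<subseteq>
    ideal.span {a ^ i * b ^ j * c ^ k * d ^ l |i j k l. i + j + k + l = n}"
proof (induction n)
  case 0
  have "(1 :: 'a) \<in> ideal.span {a ^ i * b ^ j * c ^ k * d ^ l |i j k l. i + j + k + l = 0}"
    by (rule ideal.span_base) auto
  then have "x * 1 \<in> ideal.span {a ^ i * b ^ j * c ^ k * d ^ l |i j k l. i + j + k + l = 0}" for x :: 'a
    by (rule ideal.span_scale)
  then show ?case by auto
next
  case (Suc n)
  let ?M = "\<lambda>n. {a ^ i * b ^ j * c ^ k * d ^ l |i j k l. i + j + k + l = n}"
  have step: "e * m \<in> ideal.span (?M (Suc n))" if e: "e \<in> {a, b, c, d}" and m: "m \<in> ?M n" for e m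
  proof (rule ideal.span_base)
    obtain i j k l where m: "m = a ^ i * b ^ j * c ^ k * d ^ l" "i + j + k + l = n" using m by blast
    from e consider "e = a" | "e = b" | "e = c" | "e = d" by blast
    then show "e * m \<in> ?M (Suc n)"
    proof cases
      case 1
      then have "e * m = a ^ Suc i * b ^ j * c ^ k * d ^ l" by (simp add: m(1) mult_ac)
      then show ?thesis using m(2) by (intro CollectI exI[of _ "Suc i"] exI[of _ j] exI[of _ k] exI[of _ l]) simp
    next
      case 2
      then have "e * m = a ^ i * b ^ Suc j * c ^ k * d ^ l" by (simp add: m(1) mult_ac)
      then show ?thesis using m(2) by (intro CollectI exI[of _ i] exI[of _ "Suc j"] exI[of _ k] exI[of _ l]) simp
    next
      case 3
      then have "e * m = a ^ i * b ^ j * c ^ Suc k * d ^ l" by (simp add: m(1) mult_ac)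
      then show ?thesis using m(2) by (intro CollectI exI[of _ i] exI[of _ j] exI[of _ "Suc k"] exI[of _ l]) simp
    next
      case 4
      then have "e * m = a ^ i * b ^ j * c ^ k * d ^ Suc l" by (simp add: m(1) mult_ac)
      then show ?thesis using m(2) by (intro CollectI exI[of _ i] exI[of _ j] exI[of _ k] exI[of _ "Suc l"]) simp
    qed
  qed
  have "x * y \<in> ideal.span (?M (Suc n))"
    if "x \<in> ideal.span {a, b, c, d}" "y \<in> ideal_power (ideal.span {a, b, c, d}) n" for x y
    using span_mult_span[OF that(1) subsetD[OF Suc.IH that(2)] step ideal.subspace_span] .
  then show ?case
    unfolding ideal_power.simps by (intro ideal.span_minimal ideal.subspace_span) blast
qed

text \<open>A monomial of large degree in the four generators contains one of them with a large exponent.\<close>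

lemma ideal_power_subset:
  assumes J: "ideal.subspace J" and nil: "\<And>e. e \<in> irrelevant_generators \<Longrightarrow> \<exists>j. e ^ j \<in> J"
  shows "\<exists>n. ideal_power irrelevant_ideal n \<subseteq> J"
proof -
  obtain i where i: "(var_s * var_t) ^ i \<in> J" using nil[of "var_s * var_t"] by (auto simp: irrelevant_generators_def)
  obtain j where j: "(var_s * var_v) ^ j \<in> J" using nil[of "var_s * var_v"] by (auto simp: irrelevant_generators_def)
  obtain k where k: "(var_u * var_t) ^ k \<in> J" using nil[of "var_u * var_t"] by (auto simp: irrelevant_generators_def)
  obtain l where l: "(var_u * var_v) ^ l \<in> J" using nil[of "var_u * var_v"] by (auto simp: irrelevant_generators_def)
  have up: "x ^ m \<in> J" if "x ^ n \<in> J" "n \<le> m" for x m n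
    using ideal.subspace_scale[OF J that(1), of "x ^ (m - n)"] that(2) by (simp flip: power_add)
  have fac: "p * x * q \<in> J" if "x \<in> J" for p x q
    using ideal.subspace_scale[OF J that, of "p * q"] by (simp add: mult_ac)
  have "(var_s * var_t) ^ i' * (var_s * var_v) ^ j' * (var_u * var_t) ^ k' * (var_u * var_v) ^ l' \<in> J"
    if sum: "i' + j' + k' + l' = i + j + k + l" for i' j' k' l'
  proof -
    consider "i \<le> i'" | "j \<le> j'" | "k \<le> k'" | "l \<le> l'" using sum by linarith
    then show ?thesis
    proof cases
      case 1
      then show ?thesis using fac[OF up[OF i 1], of 1] by (simp add: mult.assoc)
    next
      case 2
      then show ?thesis using fac[OF up[OF j 2]] by (simp add: mult.assoc)
    next
      case 3
      then show ?thesis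
        using fac[OF up[OF k 3], of "(var_s * var_t) ^ i' * (var_s * var_v) ^ j'" "(var_u * var_v) ^ l'"]
        by blast
    next
      case 4
      then show ?thesis using fac[OF up[OF l 4], of _ 1] by simp
    qed
  qed
  then have "ideal.span {(var_s * var_t) ^ i' * (var_s * var_v) ^ j' * (var_u * var_t) ^ k' * (var_u * var_v) ^ l'
      |i' j' k' l'. i' + j' + k' + l' = i + j + k + l} \<subseteq> J"
    by (intro ideal.span_minimal J) blast
  then show ?thesis
    using ideal_power_monomials[of "var_s * var_t" "var_s * var_v" "var_u * var_t" "var_u * var_v" "i + j + k + l"]
    unfolding irrelevant_ideal_def by blast
qed

lemma point_generator:
  assumes "P \<in> points"
  obtains e where "e \<in> irrelevant_generators" "e \<notin> P"
proof -
  have "\<not> irrelevant_generators \<subseteq> P"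
    using assms prime_ideal_span[OF points_prime[OF assms]] by (auto simp: points_def irrelevant_ideal_eq)
  then show ?thesis using that by blast
qed

section \<open>Koszul syzygies and syzygies vanishing at the base points\<close>

lemma cross_components:
  "cross p f $ 1 = p $ 2 * f $ 3 - p $ 3 * f $ 2"
  "cross p f $ 2 = p $ 3 * f $ 1 - p $ 1 * f $ 3"
  "cross p f $ 3 = p $ 1 * f $ 2 - p $ 2 * f $ 1"
proof -
  have "nxt 1 = 2" "nxt 2 = 3" "nxt 3 = 1" "prv 1 = 3" "prv 2 = 1" "prv 3 = 2"
    by (simp_all add: nxt_def prv_def)
  then show "cross p f $ 1 = p $ 2 * f $ 3 - p $ 3 * f $ 2"
    "cross p f $ 2 = p $ 3 * f $ 1 - p $ 1 * f $ 3"
    "cross p f $ 3 = p $ 1 * f $ 2 - p $ 2 * f $ 1"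
    by (simp_all add: cross_nth)
qed

lemma koszul_syzygies_eq: "koszul_syzygies f = range (\<lambda>p. cross p f)"
proof
  have "free.subspace (range (\<lambda>p. cross p f))"
  proof (rule free.subspaceI)
    show "0 \<in> range (\<lambda>p. cross p f)"
      by (rule range_eqI[of _ _ 0]) (simp add: Finite_Cartesian_Product.vec_eq_iff cross_nth)
    show "x + y \<in> range (\<lambda>p. cross p f)"
      if "x \<in> range (\<lambda>p. cross p f)" "y \<in> range (\<lambda>p. cross p f)" for x y
      using that by (auto simp flip: cross_add)
    show "c *s x \<in> range (\<lambda>p. cross p f)" if "x \<in> range (\<lambda>p. cross p f)" for c x
      using that by (auto simp flip: cross_smult)
  qed
  moreover have "vector [f $ 2, - f $ 1, 0] = cross (vector [0, 0, - 1]) f"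
    "vector [f $ 3, 0, - f $ 1] = cross (vector [0, 1, 0]) f"
    "vector [0, f $ 3, - f $ 2] = cross (vector [- 1, 0, 0]) f"
    by (simp_all add: Finite_Cartesian_Product.vec_eq_iff forall_3 cross_components)
  ultimately show "koszul_syzygies f \<subseteq> range (\<lambda>p. cross p f)"
    unfolding koszul_syzygies_def by (intro free.span_minimal) auto
  show "range (\<lambda>p. cross p f) \<subseteq> koszul_syzygies f"
  proof (rule image_subsetI)
    fix p
    have "cross p f = (- p $ 3) *s vector [f $ 2, - f $ 1, 0] + p $ 2 *s vector [f $ 3, 0, - f $ 1]
        + (- p $ 1) *s vector [0, f $ 3, - f $ 2]"
      by (simp add: Finite_Cartesian_Product.vec_eq_iff forall_3 cross_components)
    also have "\<dots> \<in> koszul_syzygies f"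
      unfolding koszul_syzygies_def
      by (intro free.span_add free.span_scale) (simp_all add: free.span_base)
    finally show "cross p f \<in> koszul_syzygies f" .
  qed
qed

lemma generated_by_eq: "generated_by f = ideal.span (range (($) f))"
  unfolding generated_by_def UNIV_3 by simp

lemma vanishing_syzygies_eq:
  "vanishing_syzygies f = {a. dot a f = 0 \<and> (\<forall>i. a $ i \<in> saturation (*) (ideal.span (range (($) f))))}"
  by (simp add: vanishing_syzygies_def dot_def sum_3 generated_by_eq)

text \<open>Koszul syzygies are syzygies with entries in \<open>I\<close>. Both properties survive saturation, the first one because the ring
  has no zero divisors.\<close>

lemma saturation_koszul_subset: "saturation (*s) (koszul_syzygies f) \<subseteq> vanishing_syzygies f"
proof
  fix a assume "a \<in> saturation (*s) (koszul_syzygies f)"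
  then obtain j where j: "\<And>r. r \<in> ideal_power irrelevant_ideal j \<Longrightarrow> \<exists>p. r *s a = cross p f"
    unfolding saturation_def koszul_syzygies_eq by blast
  define e :: "'a bipoly" where "e = var_s * var_t"
  have e: "e \<in> irrelevant_generators" by (simp add: e_def irrelevant_generators_def)
  have e0: "e ^ j \<noteq> 0" by (simp add: e_def var_s_def var_t_def)
  obtain p where "e ^ j *s a = cross p f" using j[OF generator_power_in_ideal_power[OF e]] by blast
  then have "e ^ j * dot a f = 0" by (metis dot_smult dot_cross)
  then have "dot a f = 0" using e0 by (metis mult_eq_0_iff)
  moreover have "a $ i \<in> saturation (*) (ideal.span (range (($) f)))" for i
    unfolding saturation_def
  proof (intro CollectI exI[of _ j] ballI)
    fix r :: "'a bipoly" assume "r \<in> ideal_power irrelevant_ideal j"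
    then obtain p where "r *s a = cross p f" using j by blast
    then have "r * a $ i = cross p f $ i" by (metis vector_smult_component)
    also have "\<dots> \<in> ideal.span (range (($) f))"
      using cross_entry_in_span[of p f i]
        ideal.span_minimal[OF pair_subset_range[of f i] ideal.subspace_span] by blast
    finally show "r * a $ i \<in> ideal.span (range (($) f))" .
  qed
  ultimately show "a \<in> vanishing_syzygies f" by (simp add: vanishing_syzygies_eq)
qed

text \<open>The given \<open>a \<in> V\<close> need not be bihomogeneous, so the ideal \<open>J\<close> of its multipliers is tested at primes \<open>Q\<close>
  that need not be points. Only the point \<open>P\<close> below \<open>Q\<close> is used to find a redundant \<open>f\<^sub>i\<close>; the
  multiplier \<open>w\<close> that witnesses it is bihomogeneous, and for such elements \<open>P\<close> and \<open>Q\<close> agree.\<close>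

lemma vanishing_subset_saturation:
  fixes f :: "'k::field bipoly ^ 3"
  assumes bihom: "\<And>i. bihomogeneous (d i) (d' i) (f $ i)"
    and f: "no_common_prime (range (($) f))" "f \<noteq> 0"
    and lci: "local_complete_intersection (ideal.span (range (($) f)))"
  shows "vanishing_syzygies f \<subseteq> saturation (*s) (koszul_syzygies f)"
proof
  fix a assume "a \<in> vanishing_syzygies f"
  then have a: "dot a f = 0" "\<And>i. a $ i \<in> saturation (*) (ideal.span (range (($) f)))"
    by (simp_all add: vanishing_syzygies_eq)
  define J where "J = {w. w *s a \<in> koszul_syzygies f}"
  have KJ: "\<And>w. w \<in> J \<longleftrightarrow> (\<exists>p. w *s a = cross p f)" by (auto simp: J_def koszul_syzygies_eq)
  have K: "free.subspace (koszul_syzygies f)"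
    unfolding koszul_syzygies_def by (rule free.subspace_span)
  have J: "ideal.subspace J"
  proof (rule ideal.subspaceI)
    show "0 \<in> J" unfolding J_def using free.subspace_0[OF K] by simp
    show "x + y \<in> J" if "x \<in> J" "y \<in> J" for x y
      using free.subspace_add[OF K, of "x *s a" "y *s a"] that
      unfolding J_def by (simp only: mem_Collect_eq free.scale_left_distrib)
    show "c * x \<in> J" if "x \<in> J" for c x
      using free.subspace_scale[OF K, of "x *s a" c] that
      unfolding J_def by (simp only: mem_Collect_eq free.scale_scale)
  qed
  have "\<exists>j. e ^ j \<in> J" if e: "e \<in> irrelevant_generators" for e
  proof (rule ccontr)
    assume "\<nexists>j. e ^ j \<in> J"
    then obtain Q where Q: "prime_ideal Q" "J \<subseteq> Q" "e \<notin> Q"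
      using prime_ideal_avoiding_powers[OF J, of e] by blast
    define P where "P = bihomogeneous_part Q"
    have sub: "ideal.subspace Q" by (rule prime_idealD(1)[OF Q(1)])
    have "e \<notin> P" using Q(3) bihomogeneous_part_subset[OF sub] unfolding P_def by blast
    then have "\<not> irrelevant_ideal \<subseteq> P"
      using ideal.span_base[OF e] unfolding irrelevant_ideal_eq by blast
    then have P: "P \<in> points"
      unfolding points_def P_def
      using bihomogeneous_part_prime[OF Q(1)] bihomogeneous_ideal_part[OF sub] by blast
    have fQ: "f $ i \<in> Q" for i
    proof -
      \<comment> \<open>The multipliers of \<open>a\<close> include the \<open>f\<^sub>i\<close>, so \<open>P\<close> is a base point.\<close>
      have "f $ i *s a = cross (cross (axis i 1) a) f"
        by (simp add: cross_cross a(1) dot_axis)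
      then show ?thesis using KJ Q(2) by blast
    qed
    then have fP: "f $ i \<in> P" for i
      unfolding P_def using bihomogeneous_in_part[OF sub _ bihom] by blast
    have "ideal.span (range (($) f)) \<subseteq> P"
      by (rule prime_ideal_span[OF points_prime[OF P]]) (use fP in auto)
    then have "P \<in> base_locus (ideal.span (range (($) f)))" using P by (simp add: base_locus_def)
    then obtain xs where xs: "regular_sequence (local_ring P) xs"
      "ideal_stalk (ideal.span (range (($) f))) P = generated_ideal (local_ring P) xs"
      using lci unfolding local_complete_intersection_def by blast
    obtain i where "f $ i \<in> at_prime P (ideal.span {f $ nxt i, f $ prv i})"
      using redundant_generator_of_regular[OF P bihom fP f xs] by blast
    then obtain w \<alpha> \<beta> where "w \<notin> P" "w * f $ i = \<alpha> * f $ nxt i + \<beta> * f $ prv i"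
      by (auto elim!: at_primeE simp: ideal_span_pair)
    then obtain w k l \<alpha> \<beta> where w: "w \<notin> P" "bihomogeneous k l w"
      "w * f $ i = \<alpha> * f $ nxt i + \<beta> * f $ prv i"
      using homogeneous_relation[OF points_prime[OF P] _ _ bihom[of i] bihom[of "nxt i"] bihom[of "prv i"]]
      by metis
    have "w \<notin> Q" using bihomogeneous_in_part[OF sub _ w(2)] w(1) unfolding P_def by blast
    then have red: "f $ i \<in> at_prime Q (ideal.span {f $ nxt i, f $ prv i})"
      using w(3) by (intro at_primeI[of w]) (auto simp: ideal_span_pair)
    obtain j where "\<And>r. r \<in> ideal_power irrelevant_ideal j \<Longrightarrow> r * a $ i \<in> ideal.span (range (($) f))"
      using a(2)[of i] unfolding saturation_def by blast
    then have "e ^ j * a $ i \<in> ideal.span (range (($) f))" using generator_power_in_ideal_power[OF e] by blast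
    moreover have "e ^ j \<notin> Q" using Q(3) prime_ideal_power[OF Q(1)] by blast
    ultimately have "a $ i \<in> at_prime Q (ideal.span (range (($) f)))" by (intro at_primeI)
    then have "a \<in> koszul_at Q f"
      by (rule koszul_of_generator_redundant[OF Q(1) f red a(1)])
    then obtain v p where "v \<notin> Q" "v *s a = cross p f" by (rule koszul_atE)
    then show False using KJ Q(2) by blast
  qed
  then obtain n where "ideal_power irrelevant_ideal n \<subseteq> J" using ideal_power_subset[OF J] by blast
  then show "a \<in> saturation (*s) (koszul_syzygies f)" unfolding saturation_def J_def by blast
qed

text \<open>A syzygy with entries in \<open>I\<^sub>P\<close> becomes an element of \<open>V\<close> after clearing denominators; by assumption it
  is Koszul up to a power of the irrelevant ideal, which contains elements outside \<open>P\<close>.\<close>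

lemma lci_of_saturation:
  fixes f :: "'k::field bipoly ^ 3"
  assumes bihom: "\<And>i. bihomogeneous (d i) (d' i) (f $ i)"
    and f: "no_common_prime (range (($) f))" "f \<noteq> 0"
    and sat: "vanishing_syzygies f \<subseteq> saturation (*s) (koszul_syzygies f)"
  shows "local_complete_intersection (ideal.span (range (($) f)))"
  unfolding local_complete_intersection_def
proof
  let ?I = "ideal.span (range (($) f))"
  fix P assume "P \<in> base_locus ?I"
  then have P: "P \<in> points" and I_P: "?I \<subseteq> P" unfolding base_locus_def by blast+
  note pr = points_prime[OF P]
  have fP: "f $ i \<in> P" for i
    by (rule subsetD[OF I_P]) (intro ideal.span_base rangeI)
  then have range_P: "range (($) f) \<subseteq> P" by blast
  have nil: "\<exists>k. q ^ k \<in> at_prime P (ideal.span F)" if "F \<subseteq> P" "no_common_prime F" "q \<in> P" for F q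
    using point_structure[OF P that(1,2)] that(3) by blast
  obtain x y where xy: "local_parameters P x y"
    using point_structure[OF P range_P f(1)] local_parameters_exist[OF pr range_P f(1)] by blast
  have V: "a \<in> koszul_at P f" if a: "dot a f = 0" "\<And>i. a $ i \<in> at_prime P ?I" for a
  proof -
    obtain w where w: "w \<notin> P" "\<And>i. w * a $ i \<in> ?I"
      using at_prime_common_denominator[OF pr ideal.subspace_span, of "($) a"] a(2) by blast
    have "(w *s a) $ i \<in> saturation (*) ?I" for i
      unfolding saturation_def using ideal.span_scale[OF w(2)] by (auto intro!: exI[of _ 0])
    then have "w *s a \<in> vanishing_syzygies f"
      by (simp add: vanishing_syzygies_eq dot_smult a(1))
    then obtain j where j: "\<And>r. r \<in> ideal_power irrelevant_ideal j \<Longrightarrow> r *s (w *s a) \<in> koszul_syzygies f"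
      using sat unfolding saturation_def by blast
    obtain e where e: "e \<in> irrelevant_generators" "e \<notin> P" by (rule point_generator[OF P])
    obtain p where "e ^ j *s (w *s a) = cross p f"
      using j[OF generator_power_in_ideal_power[OF e(1)]] unfolding koszul_syzygies_eq by blast
    moreover have "e ^ j \<notin> P" using e(2) prime_ideal_power[OF pr] by blast
    ultimately have "w *s a \<in> koszul_at P f" by (intro koszul_atI)
    then show ?thesis by (rule koszul_at_cancel[OF pr w(1)])
  qed
  obtain i where i: "\<And>a. dot a f = 0 \<Longrightarrow> a $ i \<in> at_prime P ?I \<Longrightarrow> a \<in> koszul_at P f"
    using vanishing_coordinate_suffices[OF pr xy nil[OF range_P f(1)] fP f V] by blast
  have "f $ i \<in> at_prime P (ideal.span {f $ nxt i, f $ prv i})"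
    by (rule generator_redundant_of_koszul[OF pr nil fP f i])
  then show "\<exists>xs. regular_sequence (local_ring P) xs \<and> ideal_stalk ?I P = generated_ideal (local_ring P) xs"
    by (rule regular_generators_of_redundant[OF P bihom fP f(1)])
qed

theorem theorem3p14:
  fixes f :: "'k::field bipoly ^ 3" and d d' :: "3 \<Rightarrow> nat"
  assumes "\<And>i. bihomogeneous (d i) (d' i) (f $ i)"
    and "codim (generated_by f) = 2"
  shows "saturation (*s) (koszul_syzygies f) = vanishing_syzygies f \<longleftrightarrow>
    local_complete_intersection (generated_by f)"
proof -
  have f: "no_common_prime (range (($) f))"
    using assms(2) by (intro no_common_prime_of_codim) (simp add: generated_by_eq)
  have f0: "f \<noteq> 0"
  proof
    assume "f = 0"
    obtain \<pi> :: "'k bipoly" where "prime_elem \<pi>" using exists_prime_elem by metis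
    then show False using no_common_primeD[OF f] \<open>f = 0\<close> by auto
  qed
  show ?thesis
    unfolding generated_by_eq
    using vanishing_subset_saturation[OF assms(1) f f0] lci_of_saturation[OF assms(1) f f0]
      saturation_koszul_subset[of f] by blast
qed

end
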